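(* Let $\lambda\vdash n$ and $\mu\in\lambda^\downarrow$, and let $W\le V_\lambda$ be the $\pi_\mu$-isotypic component of $\pi_\lambda|_{S_{n-1}}$. Assume $W\ne V_\lambda$. Choose any elements $t_1,\dots,t_n\in S_n$ with $t_k(n)=k$ for each $k$. Then $\mathcal{W}:=\{\pi_\lambda(t_k)W\}_{k\in[n]}$ is a totally symmetric real equi-chordal tight fusion frame for $V_\lambda$. Furthermore, $\mathcal{W}$ is equi-isoclinic if and only if one of the following holds: (i) for some integers $a\ge2$, $b\ge1$: $\mu=(b^a)$ and $\lambda=(b+1,b^{a-1})$; (ii) for some integers $a\ge2$, $b\ge1$: $\mu=(a^b)$ and $\lambda=(a^b,1)$; (iii) for some integers $a,b\ge1$, $c\ge2$: $\mu=((b+c)^a,b^c)$ and $\lambda=((b+c)^a,b+1,b^{c-1})$. In that case $\mathcal{W}$ is a totally symmetric equi-isoclinic tight fusion frame of $n$ subspaces of dimension $r$ in a real space of dimension $d$, where in cases (i)–(ii) \[d=\tfrac{a}{a+b}rn,\quad r=(ab)!\prod_{k=0}^{a-1}\tfrac{k!}{(k+b)!}=(ab)!\prod_{k=0}^{b-1}\tfrac{k!}{(k+a)!},\quad n=ab+1,\] and in case (iii) \[d=\tfrac{c^2}{(a+c)(b+c)}rn,\quad r=(ab+ac+bc)!\prod_{k=0}^{c-1}\tfrac{(k!)^2}{(a+k)!(b+k)!}\prod_{\ell=0}^{a-1}\tfrac{(2c+\ell)!}{(2c+b+\ell)!}=(ab+ac+bc)!\prod_{k=0}^{c-1}\tfrac{(k!)^2}{(a+k)!(b+k)!}\prod_{\ell=0}^{b-1}\tfrac{(2c+\ell)!}{(2c+a+\ell)!},\]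 \[n=ab+ac+bc+1.\]
   Context: Partitions: $\lambda\vdash n$ means $\lambda=(\lambda_1\ge\dots\ge\lambda_h)$ positive integers summing to $n$; $(l_1^{a_1},\dots,l_m^{a_m})$ denotes $l_1$ repeated $a_1$ times, etc. The Young diagram of $\lambda$ has boxes $(i,j)$ with $j\le\lambda_i$ (rows top-down, columns left-right). A Young tableau of shape $\lambda$ fills the boxes bijectively with $1,\dots,n$; it is standard if entries increase to the right along rows and downward along columns; $\operatorname{Tab}(\lambda)$ is the set of standard tableaux. $S_n$ acts on tableaux by $(gT)_{ij}=g(T_{ij})$. For a tableau $T$ and $a,b\in[n]$, $D_T(a,b):=(j-i)-(j'-i')$ where $a$ is in box $(i,j)$ and $b$ in box $(i',j')$. Young's orthogonal form: $V_\lambda$ is the real Hilbert space with orthonormal basis $\{v_T\}_{T\in\operatorname{Tab}(\lambda)}$ and $\pi_\lambda\colon S_n\to\operatorname{U}(V_\lambda)$ is the homomorphism with $\pi_\lambda(s_k)v_T=\frac{1}{D_T(k+1,k)}v_T+\sqrt{1-\frac{1}{D_T(k+1,k)^2}}\,v_{s_kT}$ for $s_k=(k\ k{+}1)$ (the second coefficient vanishes exactly when $s_kT$ is not standard); these are the irreducible representations of $S_n$. $S_{n-1}\le S_n$ is the stabilizer of $n$. For $\lambda\vdash n$, $\lambda^\downarrow$ is the set of partitions $\mu\vdash n-1$ whose Young diagram is obtained by deleting one box from that of $\lambda$. The $\pi_\mu$-isotypic component of $\pi_\lambda|_{S_{n-1}}$ is the sum of the images of all isometries $V_\mu\to V_\lambda$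 intertwining $\pi_\mu$ with $\pi_\lambda|_{S_{n-1}}$; it equals $\operatorname{span}\{v_T: T\in\operatorname{Tab}(\lambda),\ n\text{ lies in the box of }\lambda\text{ not in }\mu\}$. Tight fusion frame, equi-chordal, equi-isoclinic: an ensemble of $r$-dimensional subspaces $\{W_k\}$ of $V$ is a tight fusion frame if the sum of orthogonal projections onto the $W_k$ is a multiple of the identity; with isometries $\Phi_k$ onto $W_k$, it is equi-chordal if $\|\Phi_k^*\Phi_\ell\|_F$ is the same for all $k\ne\ell$, and equi-isoclinic if there is $\alpha$ with $(\Phi_k^*\Phi_\ell)^*(\Phi_k^*\Phi_\ell)=\alpha I$ for all $k\ne\ell$. Its automorphism group consists of permutations $\tau$ of the index set such that some unitary $U$ has $UW_k=W_{\tau(k)}$ for all $k$; totally symmetric means the automorphism group is the full symmetric group $S_n$. *)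

theory Defs
  imports "HOL-Analysis.Analysis" "HOL-Combinatorics.Permutations"
begin

subsection \<open>Partitions and standard tableaux\<close>

definition partition_of :: "nat \<Rightarrow> nat list \<Rightarrow> bool" where
  "partition_of n lam \<longleftrightarrow> sorted_wrt (\<ge>) lam \<and> 0 \<notin> set lam \<and> sum_list lam = n"

text \<open>Boxes are indexed from 0; only the differences between column and row index matter.\<close>

definition diagram :: "nat list \<Rightarrow> (nat \<times> nat) set" where
  "diagram lam = {(i, j). i < length lam \<and> j < lam ! i}"

text \<open>A tableau is extended by 0 outside its diagram, so that distinct fillings are distinct
  functions. A permutation \<open>g\<close> of \<open>{1..n}\<close> fixes 0, so it acts on tableaux by
  \<open>T \<mapsto> g \<circ> T\<close>.\<close>

type_synonym tableau = "nat \<times> nat \<Rightarrow> nat"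

definition young_tableau :: "nat list \<Rightarrow> tableau \<Rightarrow> bool" where
  "young_tableau lam T \<longleftrightarrow>
     bij_betw T (diagram lam) {1..sum_list lam} \<and> (\<forall>x. x \<notin> diagram lam \<longrightarrow> T x = 0)"

definition Tab :: "nat list \<Rightarrow> tableau set" where
  "Tab lam = {T. young_tableau lam T \<and>
     (\<forall>i j j'. (i, j) \<in> diagram lam \<and> (i, j') \<in> diagram lam \<and> j < j' \<longrightarrow> T (i, j) < T (i, j')) \<and>
     (\<forall>i i' j. (i, j) \<in> diagram lam \<and> (i', j) \<in> diagram lam \<and> i < i' \<longrightarrow> T (i, j) < T (i', j))}"

definition content :: "nat \<times> nat \<Rightarrow> int" where
  "content x = int (snd x) - int (fst x)"

definition box_of :: "nat list \<Rightarrow> tableau \<Rightarrow> nat \<Rightarrow> nat \<times> nat" where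
  "box_of lam T a = inv_into (diagram lam) T a"

definition axial_dist :: "nat list \<Rightarrow> tableau \<Rightarrow> nat \<Rightarrow> nat \<Rightarrow> int" where
  "axial_dist lam T a b = content (box_of lam T a) - content (box_of lam T b)"

definition down :: "nat list \<Rightarrow> nat list set" where
  "down lam = {\<mu>. partition_of (sum_list lam - 1) \<mu> \<and>
                   (\<exists>x \<in> diagram lam. diagram \<mu> = diagram lam - {x})}"

subsection \<open>Young's orthogonal form\<close>

text \<open>The symmetric group on \<open>{1..n}\<close> consists of the functions \<open>g\<close> with \<open>g permutes {1..n}\<close>,
  multiplied by composition. The space of the representation is the whole type \<open>'v\<close>, with
  orthonormal basis \<open>v T\<close> for \<open>T \<in> Tab lam\<close>. If \<open>s\<^sub>k T\<close> is not standard, then the second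
  coefficient is 0, and the value of \<open>v\<close> at \<open>s\<^sub>k T\<close> is irrelevant.\<close>

definition young_orthogonal_form ::
  "nat \<Rightarrow> nat list \<Rightarrow> (tableau \<Rightarrow> 'v::euclidean_space) \<Rightarrow> ((nat \<Rightarrow> nat) \<Rightarrow> 'v \<Rightarrow> 'v) \<Rightarrow> bool" where
  "young_orthogonal_form n lam v \<pi> \<longleftrightarrow>
     (\<forall>S \<in> Tab lam. \<forall>T \<in> Tab lam. v S \<bullet> v T = (if S = T then 1 else 0)) \<and>
     span (v ` Tab lam) = UNIV \<and>
     (\<forall>g. g permutes {1..n} \<longrightarrow> orthogonal_transformation (\<pi> g)) \<and>
     (\<forall>g h. g permutes {1..n} \<and> h permutes {1..n} \<longrightarrow> \<pi> (g \<circ> h) = \<pi> g \<circ> \<pi> h) \<and>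
     (\<forall>k T. 1 \<le> k \<and> k < n \<and> T \<in> Tab lam \<longrightarrow>
        (let s = Transposition.transpose k (k + 1);
             D = real_of_int (axial_dist lam T (k + 1) k)
         in \<pi> s (v T) = (1 / D) *\<^sub>R v T + sqrt (1 - 1 / D\<^sup>2) *\<^sub>R v (s \<circ> T)))"

text \<open>The component of \<open>\<pi>\<close>, restricted to the symmetric group on \<open>{1..m}\<close>, that belongs to a
  representation \<open>\<rho>\<close> of this group.\<close>

definition isotypic_component ::
  "nat \<Rightarrow> ((nat \<Rightarrow> nat) \<Rightarrow> 'w::euclidean_space \<Rightarrow> 'w) \<Rightarrow> ((nat \<Rightarrow> nat) \<Rightarrow> 'v \<Rightarrow> 'v)
     \<Rightarrow> 'v::euclidean_space set" where
  "isotypic_component m \<rho> \<pi> =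
     span (\<Union>{range \<Phi> | \<Phi> :: 'w \<Rightarrow> 'v. linear \<Phi> \<and> (\<forall>x. norm (\<Phi> x) = norm x) \<and>
              (\<forall>g. g permutes {1..m} \<longrightarrow> \<Phi> \<circ> \<rho> g = \<pi> g \<circ> \<Phi>)})"

subsection \<open>Fusion frames\<close>

definition orth_proj :: "'v::euclidean_space set \<Rightarrow> 'v \<Rightarrow> 'v" where
  "orth_proj U x = (THE y. y \<in> U \<and> (\<forall>u \<in> U. (x - y) \<bullet> u = 0))"

definition tight_fusion_frame :: "nat \<Rightarrow> 'i set \<Rightarrow> ('i \<Rightarrow> 'v::euclidean_space set) \<Rightarrow> bool" where
  "tight_fusion_frame r I W \<longleftrightarrow>
     finite I \<and> (\<forall>k \<in> I. subspace (W k) \<and> dim (W k) = r) \<and>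
     (\<exists>c::real. \<forall>x. (\<Sum>k \<in> I. orth_proj (W k) x) = c *\<^sub>R x)"

text \<open>An isometry of \<open>\<real>\<^sup>r\<close> into \<open>'v\<close> is given by its columns, the images of the \<open>r\<close> standard
  basis vectors. For two such isometries, \<open>\<Phi>\<^sup>*\<Psi>\<close> is then an \<open>r \<times> r\<close> matrix of inner products.\<close>

definition isometry_onto :: "nat \<Rightarrow> (nat \<Rightarrow> 'v::euclidean_space) \<Rightarrow> 'v set \<Rightarrow> bool" where
  "isometry_onto r \<Phi> U \<longleftrightarrow>
     (\<forall>i<r. \<forall>j<r. \<Phi> i \<bullet> \<Phi> j = (if i = j then 1 else 0)) \<and> span (\<Phi> ` {..<r}) = U"

definition cross_gram :: "(nat \<Rightarrow> 'v::euclidean_space) \<Rightarrow> (nat \<Rightarrow> 'v) \<Rightarrow> nat \<Rightarrow> nat \<Rightarrow> real" where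
  "cross_gram \<Phi> \<Psi> i j = \<Phi> i \<bullet> \<Psi> j"

definition frobenius_norm :: "nat \<Rightarrow> (nat \<Rightarrow> nat \<Rightarrow> real) \<Rightarrow> real" where
  "frobenius_norm r M = sqrt (\<Sum>i<r. \<Sum>j<r. (M i j)\<^sup>2)"

text \<open>The two notions below do not depend on the choice of the isometries onto the subspaces.\<close>

definition equi_chordal :: "nat \<Rightarrow> 'i set \<Rightarrow> ('i \<Rightarrow> 'v::euclidean_space set) \<Rightarrow> bool" where
  "equi_chordal r I W \<longleftrightarrow>
     (\<exists>\<Phi>. (\<forall>k \<in> I. isometry_onto r (\<Phi> k) (W k)) \<and>
       (\<exists>c. \<forall>k \<in> I. \<forall>l \<in> I. k \<noteq> l \<longrightarrow> frobenius_norm r (cross_gram (\<Phi> k) (\<Phi> l)) = c))"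

definition equi_isoclinic :: "nat \<Rightarrow> 'i set \<Rightarrow> ('i \<Rightarrow> 'v::euclidean_space set) \<Rightarrow> bool" where
  "equi_isoclinic r I W \<longleftrightarrow>
     (\<exists>\<Phi>. (\<forall>k \<in> I. isometry_onto r (\<Phi> k) (W k)) \<and>
       (\<exists>\<alpha>. \<forall>k \<in> I. \<forall>l \<in> I. k \<noteq> l \<longrightarrow>
          (\<forall>i<r. \<forall>j<r. (\<Sum>m<r. cross_gram (\<Phi> k) (\<Phi> l) m i * cross_gram (\<Phi> k) (\<Phi> l) m j)
                        = (if i = j then \<alpha> else 0))))"

definition automorphisms :: "'i set \<Rightarrow> ('i \<Rightarrow> 'v::euclidean_space set) \<Rightarrow> ('i \<Rightarrow> 'i) set" where
  "automorphisms I W =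
     {\<tau>. \<tau> permutes I \<and> (\<exists>U. orthogonal_transformation U \<and> (\<forall>k \<in> I. U ` W k = W (\<tau> k)))}"

definition totally_symmetric :: "'i set \<Rightarrow> ('i \<Rightarrow> 'v::euclidean_space set) \<Rightarrow> bool" where
  "totally_symmetric I W \<longleftrightarrow> automorphisms I W = {\<tau>. \<tau> permutes I}"

subsection \<open>The exceptional shapes\<close>

definition rect_longer_row :: "nat \<Rightarrow> nat \<Rightarrow> nat list \<Rightarrow> nat list \<Rightarrow> bool" where
  "rect_longer_row a b \<mu> lam \<longleftrightarrow> a \<ge> 2 \<and> b \<ge> 1 \<and>
     \<mu> = replicate a b \<and> lam = (b + 1) # replicate (a - 1) b"

definition rect_new_row :: "nat \<Rightarrow> nat \<Rightarrow> nat list \<Rightarrow> nat list \<Rightarrow> bool" where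
  "rect_new_row a b \<mu> lam \<longleftrightarrow> a \<ge> 2 \<and> b \<ge> 1 \<and>
     \<mu> = replicate b a \<and> lam = replicate b a @ [1]"

definition two_step_inner :: "nat \<Rightarrow> nat \<Rightarrow> nat \<Rightarrow> nat list \<Rightarrow> nat list \<Rightarrow> bool" where
  "two_step_inner a b c \<mu> lam \<longleftrightarrow> a \<ge> 1 \<and> b \<ge> 1 \<and> c \<ge> 2 \<and>
     \<mu> = replicate a (b + c) @ replicate c b \<and>
     lam = replicate a (b + c) @ [b + 1] @ replicate (c - 1) b"

end

theory Submission
  imports Defs
begin

text \<open>
  The Jucys-Murphy elements act on the basis vectors \<open>v T\<close> by the contents of the boxes of \<open>T\<close>.
  Content vectors separate tableaux, and any two standard tableaux are connected by admissible
  adjacent transpositions, so only scalars commute with the whole action. This gives tightness.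
  Comparing sums of contents identifies the isotypic component with the span of those \<open>v T\<close> that
  have the largest entry in the box \<open>x\<close> that is removed from the shape.

  Every permutation that moves the last point \<open>n\<close> lies in the double coset of the adjacent
  transposition of \<open>n - 1\<close> and \<open>n\<close> under the stabilizer of \<open>n\<close>. Hence all pairs of subspaces are
  in the same relative position, and the cross Gram matrix is diagonal in the basis \<open>v T\<close> with
  entries \<open>1 / (content x - content y)\<close>, where \<open>y\<close> is the box of \<open>n - 1\<close>. So the frame is
  equi-isoclinic iff all corners \<open>y\<close> of the smaller shape have the same content distance to \<open>x\<close>.
  As corners have distinct contents, there are then at most two of them, one on each side of \<open>x\<close>.

  The dimensions come from Frobenius' formula for the number of standard tableaux; its recursion
  over corners is an instance of Lagrange interpolation.
\<close>

subsection \<open>Standard tableaux on order ideals\<close>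

text \<open>Diagrams are handled as finite order ideals of \<open>nat \<times> nat\<close> in the
  componentwise order. A tableau is then a monotone bijection, deleting a corner stays within the
  same class, and inductions on tableaux run over \<open>card D\<close>. That \<pi> is a
  homomorphism is part of \<open>young_orthogonal_form\<close>, so identities about the group are
  checked on adjacent transpositions, where the coefficient of a non-standard filling is 0. Contents
  are effective as eigenvalues because boxes of equal content are comparable: corners form an
  antichain and are therefore told apart by their contents. This one fact separates tableaux, pins
  down the removed box in the isotypic component and limits the corners in the equi-isoclinic case.
  The entries of the cross Gram matrix are the diagonal coefficients of Young's formula; the other
  term moves the largest entry out of x and is orthogonal to W. Properness of W supplies a second
  corner of the shape. It gives n \<ge> 2 and, in the classification, the bounds a \<ge> 2 and c
  \<ge> 2. For the dimensions, the numbers \<open>f i + (m - 1 - i)\<close> serve as interpolation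
  nodes; lowering one of them by 1 removes a box.\<close>

definition young_ideal :: "(nat \<times> nat) set \<Rightarrow> bool" where
  "young_ideal D \<longleftrightarrow> finite D \<and> (\<forall>y\<in>D. \<forall>x\<le>y. x \<in> D)"

definition corners :: "(nat \<times> nat) set \<Rightarrow> (nat \<times> nat) set" where
  "corners D = {x \<in> D. \<forall>y\<in>D. \<not> x < y}"

text \<open>Monotonicity along the product order replaces the two conditions on rows and columns;
  \<open>Tab_eq_std\<close> shows that both amount to the same on a diagram.\<close>

definition std :: "(nat \<times> nat) set \<Rightarrow> tableau set" where
  "std D = {T. bij_betw T D {1..card D} \<and> (\<forall>x. x \<notin> D \<longrightarrow> T x = 0) \<and>
     (\<forall>x\<in>D. \<forall>y\<in>D. x < y \<longrightarrow> T x < T y)}"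

abbreviation adj_swap :: "nat \<Rightarrow> nat \<Rightarrow> nat" where
  "adj_swap k \<equiv> Transposition.transpose k (Suc k)"

lemma young_idealD: "young_ideal D \<Longrightarrow> y \<in> D \<Longrightarrow> x \<le> y \<Longrightarrow> x \<in> D"
  unfolding young_ideal_def by blast

lemma finite_young_ideal: "young_ideal D \<Longrightarrow> finite D"
  by (simp add: young_ideal_def)

lemma corners_subset: "corners D \<subseteq> D"
  by (auto simp: corners_def)

lemma finite_corners: "young_ideal D \<Longrightarrow> finite (corners D)"
  using corners_subset finite_subset finite_young_ideal by blast

lemma young_ideal_remove:
  assumes "young_ideal D" "x \<in> corners D"
  shows "young_ideal (D - {x})"
  using assms unfolding young_ideal_def corners_def
  by (auto simp: order_less_le)

lemma corner_if_young_ideal_remove: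
  assumes "young_ideal (D - {x})" "x \<in> D"
  shows "x \<in> corners D"
  using assms unfolding young_ideal_def corners_def order_less_le
  by blast

lemma corner_above:
  assumes "young_ideal D" "y \<in> D"
  obtains x where "x \<in> corners D" "y \<le> x"
proof -
  obtain x where "x \<in> D" "y \<le> x" "\<forall>b\<in>D. x \<le> b \<longrightarrow> x = b"
    using finite_has_maximal2[OF finite_young_ideal[OF assms(1)] assms(2)] by blast
  then show ?thesis
    using that[of x] by (auto simp: corners_def order_less_le)
qed

text \<open>Boxes of equal content lie on one diagonal and differ by a vector (k, k), so one of them
  dominates the other.\<close>

lemma content_eq_comparable:
  assumes "content x = content y"
  shows "x = y \<or> x < y \<or> y < x"
  using assms by (cases x; cases y) (auto simp: content_def less_prod_def less_eq_prod_def)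

lemma corners_content_inj:
  assumes "x \<in> corners D" "y \<in> corners D" "content x = content y"
  shows "x = y"
  using content_eq_comparable[OF assms(3)] assms(1,2) by (auto simp: corners_def)

lemma stdD:
  assumes "T \<in> std D"
  shows "bij_betw T D {1..card D}" "inj_on T D" "T ` D = {1..card D}"
    "\<And>x. x \<notin> D \<Longrightarrow> T x = 0" "\<And>x y. x \<in> D \<Longrightarrow> y \<in> D \<Longrightarrow> x < y \<Longrightarrow> T x < T y"
  using assms by (auto simp: std_def bij_betw_def)

lemma std_ex_box:
  assumes "T \<in> std D" "1 \<le> k" "k \<le> card D"
  obtains x where "x \<in> D" "T x = k"
proof -
  have "k \<in> T ` D" using stdD(3)[OF assms(1)] assms(2,3) by auto
  then show ?thesis using that by auto
qed

lemma std_range: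
  assumes "T \<in> std D" "x \<in> D"
  shows "1 \<le> T x" "T x \<le> card D"
  using stdD(3)[OF assms(1)] assms(2) by auto

lemma std_max_corner:
  assumes "T \<in> std D" "x \<in> D" "T x = card D"
  shows "x \<in> corners D"
proof -
  have "\<not> x < y" if "y \<in> D" for y
    using stdD(5)[OF assms(1,2) that] std_range(2)[OF assms(1) that] assms(3) by auto
  then show ?thesis using assms(2) unfolding corners_def by blast
qed

lemma std_restrict:
  assumes "T \<in> std D" "x \<in> D" "T x = card D" "finite D"
  shows "T(x := 0) \<in> std (D - {x})"
proof -
  have "inj_on (T(x := 0)) (D - {x})"
    using stdD(2)[OF assms(1)] by (auto simp: inj_on_def)
  moreover have "(T(x := 0)) ` (D - {x}) = {1..card (D - {x})}"
  proof -
    have "(T(x := 0)) ` (D - {x}) = T ` D - {T x}"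
      using stdD(2)[OF assms(1)] assms(2) by (auto simp: inj_on_def)
    also have "\<dots> = {1..card D - 1}"
      using stdD(3)[OF assms(1)] assms(3) by auto
    finally show ?thesis using assms by simp
  qed
  ultimately show ?thesis
    using stdD(4,5)[OF assms(1)] by (auto simp: std_def bij_betw_def)
qed

lemma std_extend:
  assumes "S \<in> std (D - {x})" "x \<in> corners D" "finite D"
  shows "S(x := card D) \<in> std D"
proof -
  have x: "x \<in> D" using assms(2) corners_subset by blast
  then obtain N where c: "card D = Suc N" "card (D - {x}) = N" using assms(3)
    by (metis card.remove)
  have r: "S y \<le> N" if "y \<in> D - {x}" for y
    using std_range(2)[OF assms(1) that] c by simp
  have "inj_on (S(x := card D)) D"
  proof (rule inj_onI)
    fix y z assume yz: "y \<in> D" "z \<in> D" "(S(x := card D)) y = (S(x := card D)) z"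
    show "y = z"
    proof (cases "y = x \<or> z = x")
      case True
      then show ?thesis using yz r[of y] r[of z] c by (auto split: if_splits)
    next
      case False
      then show ?thesis using yz inj_onD[OF stdD(2)[OF assms(1)], of y z] by auto
    qed
  qed
  moreover have "(S(x := card D)) ` D = {1..card D}"
  proof -
    have "(S(x := card D)) ` D = insert (card D) (S ` (D - {x}))" using x by auto
    then show ?thesis using stdD(3)[OF assms(1)] c by auto
  qed
  moreover have "(S(x := card D)) y < (S(x := card D)) z" if "y \<in> D" "z \<in> D" "y < z" for y z
  proof (cases "y = x")
    case True then show ?thesis using assms(2) that by (auto simp: corners_def)
  next
    case False
    then show ?thesis using that r[of y] c stdD(5)[OF assms(1), of y z] by auto
  qed
  ultimately show ?thesis
    using stdD(4)[OF assms(1)] x by (auto simp: std_def bij_betw_def)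
qed

text \<open>The branching rule on the level of tableaux. It drives the recursion for the counts and
  later matches the bases of the two representations.\<close>

lemma bij_betw_std_extend:
  assumes "young_ideal D" "x \<in> corners D"
  shows "bij_betw (\<lambda>S. S(x := card D)) (std (D - {x})) {T \<in> std D. T x = card D}"
proof (rule bij_betwI[where g = "\<lambda>T. T(x := 0)"])
  note [simp] = finite_young_ideal[OF assms(1)]
  have x: "x \<in> D" using assms(2) corners_subset by blast
  show "(\<lambda>S. S(x := card D)) \<in> std (D - {x}) \<rightarrow> {T \<in> std D. T x = card D}"
    using std_extend[OF _ assms(2)] by auto
  show "(\<lambda>T. T(x := 0)) \<in> {T \<in> std D. T x = card D} \<rightarrow> std (D - {x})"
    using std_restrict[OF _ x] by auto
  show "(S(x := card D))(x := 0) = S" if "S \<in> std (D - {x})" for S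
    using stdD(4)[OF that, of x] by auto
qed auto

lemma std_nonempty:
  assumes "young_ideal D"
  shows "std D \<noteq> {}"
  using assms
proof (induction "card D" arbitrary: D)
  case 0
  then have "(\<lambda>_. 0) \<in> std D"
    using finite_young_ideal[of D] by (auto simp: std_def bij_betw_def)
  then show ?case by auto
next
  case (Suc n)
  then have "D \<noteq> {}" by auto
  then obtain y where "y \<in> D" by blast
  then obtain x where x: "x \<in> corners D" using corner_above Suc.prems by metis
  have "card (D - {x}) = n" using Suc.hyps(2) x corners_subset by (metis card_Diff_singleton diff_Suc_1 subsetD)
  then have "std (D - {x}) \<noteq> {}"
    using Suc young_ideal_remove[OF Suc.prems x] by auto
  then show ?case using std_extend[OF _ x] finite_young_ideal[OF Suc.prems] by blast
qed

lemma finite_std: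
  assumes "young_ideal D"
  shows "finite (std D)"
proof (rule finite_subset)
  show "std D \<subseteq> {T. \<forall>x. (x \<in> D \<longrightarrow> T x \<in> {1..card D}) \<and> (x \<notin> D \<longrightarrow> T x = 0)}"
    using stdD(3,4) by blast
  show "finite {T. \<forall>x. (x \<in> D \<longrightarrow> T x \<in> {1..card D}) \<and> (x \<notin> D \<longrightarrow> T x = (0::nat))}"
    by (rule finite_set_of_finite_funs[OF finite_young_ideal[OF assms]]) auto
qed

lemma card_std_rec:
  assumes "young_ideal D" "D \<noteq> {}"
  shows "card (std D) = (\<Sum>x\<in>corners D. card (std (D - {x})))"
proof -
  have "card D \<ge> 1" using assms finite_young_ideal by (simp add: Suc_leI card_gt_0_iff)
  then have "\<exists>x\<in>corners D. T x = card D" if "T \<in> std D" for T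
    using std_ex_box[OF that, of "card D"] std_max_corner[OF that] by blast
  then have "std D = (\<Union>x\<in>corners D. {T \<in> std D. T x = card D})" by blast
  moreover have "card (\<Union>x\<in>corners D. {T \<in> std D. T x = card D})
      = (\<Sum>x\<in>corners D. card {T \<in> std D. T x = card D})"
  proof (rule card_UN_disjoint)
    show "\<forall>i\<in>corners D. \<forall>j\<in>corners D. i \<noteq> j \<longrightarrow>
      {T \<in> std D. T i = card D} \<inter> {T \<in> std D. T j = card D} = {}"
    proof (intro ballI impI)
      fix i j assume ij: "i \<in> corners D" "j \<in> corners D" "i \<noteq> j"
      have False if "T \<in> std D" "T i = card D" "T j = card D" for T
        using inj_onD[OF stdD(2)[OF that(1)], of i j] that ij corners_subset by auto
      then show "{T \<in> std D. T i = card D} \<inter> {T \<in> std D. T j = card D} = {}" by auto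
    qed
  qed (use finite_corners[OF assms(1)] finite_std[OF assms(1)] in auto)
  moreover have "card {T \<in> std D. T x = card D} = card (std (D - {x}))" if "x \<in> corners D" for x
    using bij_betw_same_card[OF bij_betw_std_extend[OF assms(1) that]] by simp
  ultimately show ?thesis by simp
qed

text \<open>Between two distinct comparable boxes that are not adjacent there is a third one, so
  consecutive entries are either adjacent or incomparable.\<close>

lemma consecutive_boxes:
  assumes "young_ideal D" "T \<in> std D" "x \<in> D" "y \<in> D" "T x = k" "T y = Suc k"
  shows "(adj_swap k \<circ> T \<in> std D \<and> \<bar>content y - content x\<bar> \<ge> 2) \<or>
         (adj_swap k \<circ> T \<notin> std D \<and> \<bar>content y - content x\<bar> = 1)"
proof (cases "x < y")
  case True
  obtain i j i' j' where xy: "x = (i, j)" "y = (i', j')" by fastforce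
  have nb: "\<not> (x < z \<and> z < y)" for z
  proof
    assume z: "x < z \<and> z < y"
    then have "z \<in> D" using young_idealD[OF assms(1,4), of z] by auto
    then show False using stdD(5)[OF assms(2), of x z] stdD(5)[OF assms(2), of z y] z assms by auto
  qed
  have le: "i \<le> i'" "j \<le> j'" and ne: "i < i' \<or> j < j'"
    using True xy by (auto simp: less_prod_def less_eq_prod_def)
  have "\<bar>content y - content x\<bar> = 1"
  proof (cases "i < i'")
    case True
    have "\<not> (x < (Suc i, j) \<and> (Suc i, j) < y)" by (rule nb)
    then have "i' = Suc i \<and> j' = j" using xy True le
      by (auto simp: less_prod_def less_eq_prod_def)
    then show ?thesis using xy by (simp add: content_def)
  next
    case False
    have "\<not> (x < (i, Suc j) \<and> (i, Suc j) < y)" by (rule nb)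
    then have "i' = i \<and> j' = Suc j" using xy False ne le
      by (auto simp: less_prod_def less_eq_prod_def)
    then show ?thesis using xy by (simp add: content_def)
  qed
  moreover have "adj_swap k \<circ> T \<notin> std D"
    using stdD(5)[of "adj_swap k \<circ> T" D x y] assms True by auto
  ultimately show ?thesis by simp
next
  case False
  have nyx: "\<not> y < x" using stdD(5)[OF assms(2) assms(4,3)] assms by auto
  have nxy: "x \<noteq> y" using assms by auto
  have "\<bar>content y - content x\<bar> \<ge> 2"
    using False nyx nxy by (cases x; cases y) (auto simp: content_def less_prod_def less_eq_prod_def)
  moreover have "adj_swap k \<circ> T \<in> std D"
  proof -
    have kr: "1 \<le> k" "Suc k \<le> card D"
      using std_range(1)[OF assms(2,3)] std_range(2)[OF assms(2,4)] assms(5,6) by auto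
    have "bij_betw (adj_swap k) {1..card D} {1..card D}"
      by (rule permutes_imp_bij, rule permutes_swap_id) (use kr in auto)
    then have "bij_betw (adj_swap k \<circ> T) D {1..card D}"
      using stdD(1)[OF assms(2)] bij_betw_trans by blast
    moreover have "(adj_swap k \<circ> T) z = 0" if "z \<notin> D" for z
      using stdD(4)[OF assms(2) that] kr by (simp add: transpose_def)
    moreover have "(adj_swap k \<circ> T) u < (adj_swap k \<circ> T) z"
      if "u \<in> D" "z \<in> D" "u < z" for u z
    proof -
      have l: "T u < T z" using stdD(5)[OF assms(2)] that by auto
      \<comment> \<open>The swap reverses the order only of the values k and k + 1. These sit in x
        and y, where x < y fails.\<close>
      have "\<not> (T u = k \<and> T z = Suc k)"
        using stdD(2)[OF assms(2)] that False assms(3-6) by (metis inj_onD)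
      then show ?thesis using l by (auto simp: Transposition.transpose_def)
    qed
    ultimately show ?thesis by (auto simp: std_def)
  qed
  ultimately show ?thesis by simp
qed

text \<open>Connectedness is expressed by functions that are constant along admissible swaps, so no
  paths have to be composed. Tableaux with the largest entry in the same box are handled by
  induction on the smaller ideal. For different corners x and y, a tableau with the two largest
  entries in x and y links both cases, since corners are incomparable and the swap of these entries
  is admissible.\<close>

lemma std_connected:
  assumes "young_ideal D"
    and "\<And>T k. T \<in> std D \<Longrightarrow> 1 \<le> k \<Longrightarrow> k < card D \<Longrightarrow> adj_swap k \<circ> T \<in> std D \<Longrightarrow>
           f (adj_swap k \<circ> T) = f T"
    and "T \<in> std D" "T' \<in> std D"
  shows "f T = f T'"
  using assms
proof (induction "card D" arbitrary: D f T T')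
  case 0
  then have "D = {}" using finite_young_ideal by auto
  then have "T = T'" using stdD(4)[OF 0(4)] stdD(4)[OF 0(5)] by auto
  then show ?case by simp
next
  case (Suc n)
  note fin = finite_young_ideal[OF Suc.prems(1)]
  have same: "f U = f U'" if U: "U \<in> std D" "U' \<in> std D" "x \<in> D" "U x = card D" "U' x = card D" for x U U'
  proof -
    have xc: "x \<in> corners D" using std_max_corner U by blast
    have cn: "card (D - {x}) = n" using Suc.hyps(2) U(3) by simp
    have "(\<lambda>S. f (S(x := card D))) (U(x := 0)) = (\<lambda>S. f (S(x := card D))) (U'(x := 0))"
    proof (rule Suc.hyps(1)[where f = "\<lambda>S. f (S(x := card D))"])
      show "n = card (D - {x})" using cn by simp
      show "young_ideal (D - {x})" using young_ideal_remove[OF Suc.prems(1) xc] .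
      show "U(x := 0) \<in> std (D - {x})" "U'(x := 0) \<in> std (D - {x})"
        using std_restrict U fin by auto
      fix S k
      assume S: "S \<in> std (D - {x})" "1 \<le> k" "k < card (D - {x})"
        "adj_swap k \<circ> S \<in> std (D - {x})"
      \<comment> \<open>As k + 1 \<le> n < \<open>card D\<close>, the swap leaves the entry in x
        alone.\<close>
      have eq: "(adj_swap k \<circ> S)(x := card D) = adj_swap k \<circ> (S(x := card D))"
        using S(3) cn Suc.hyps(2) by (auto simp: fun_eq_iff Transposition.transpose_def)
      show "f ((adj_swap k \<circ> S)(x := card D)) = f (S(x := card D))"
        unfolding eq
        by (rule Suc.prems(2)) (use S cn Suc.hyps(2) std_extend[OF S(1) xc fin]
          std_extend[OF S(4) xc fin] eq in auto)
    qed
    then show ?thesis using U(4,5) by (metis fun_upd_triv fun_upd_upd)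
  qed
  obtain x where x: "x \<in> D" "T x = card D" using std_ex_box[OF Suc.prems(3), of "card D"] Suc.hyps(2) by auto
  obtain y where y: "y \<in> D" "T' y = card D" using std_ex_box[OF Suc.prems(4), of "card D"] Suc.hyps(2) by auto
  show ?case
  proof (cases "x = y")
    case True
    then show ?thesis using same[OF Suc.prems(3,4)] x y by auto
  next
    case False
    have xc: "x \<in> corners D" and yc: "y \<in> corners D" using std_max_corner Suc.prems x y by auto
    have yc': "y \<in> corners (D - {x})" using yc False by (auto simp: corners_def)
    obtain R where R: "R \<in> std (D - {x} - {y})"
      using std_nonempty young_ideal_remove xc yc' Suc.prems(1) by (metis ex_in_conv)
    define U where "U = R(y := n, x := Suc n)"
    have cn: "card (D - {x}) = n" using Suc.hyps(2) x by simp
    have U: "U \<in> std D"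
      using std_extend[OF std_extend[OF R yc'] xc] fin cn Suc.hyps(2) by (simp add: U_def)
    have "y \<in> D - {x}" using y False by auto
    then have n1: "n \<ge> 1" using cn fin card_0_eq[of "D - {x}"] by fastforce
    have Ux: "U x = Suc n" "U y = n" using False by (auto simp: U_def)
    have "\<not> y < x" using yc x by (auto simp: corners_def)
    have V: "adj_swap n \<circ> U \<in> std D"
    proof -
      have "adj_swap n \<circ> U \<in> std D \<or> \<bar>content x - content y\<bar> = 1"
        using consecutive_boxes[OF Suc.prems(1) U y(1) x(1) Ux(2,1)] by auto
      moreover have "\<bar>content x - content y\<bar> \<noteq> 1"
      proof -
        have "\<not> x < y" using xc y by (auto simp: corners_def)
        then show ?thesis using \<open>\<not> y < x\<close> False
          by (cases x; cases y) (auto simp: content_def less_prod_def less_eq_prod_def)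
      qed
      ultimately show ?thesis by simp
    qed
    have "f T = f U" using same[OF Suc.prems(3) U x(1)] x Ux Suc.hyps(2) by simp
    also have "\<dots> = f (adj_swap n \<circ> U)"
      using Suc.prems(2)[OF U n1 _ V] Suc.hyps(2) by simp
    also have "\<dots> = f T'" using same[OF V Suc.prems(4) y(1)] y Ux Suc.hyps(2) by simp
    finally show ?thesis .
  qed
qed

text \<open>The largest entries of both tableaux sit in corners, which are determined by their
  contents; remove this common corner and repeat. This is what makes the joint spectrum of the
  Jucys-Murphy elements simple.\<close>

lemma std_eq_if_contents_eq:
  assumes "young_ideal D" "T \<in> std D" "T' \<in> std D"
    and "\<And>x y. x \<in> D \<Longrightarrow> y \<in> D \<Longrightarrow> T x = T' y \<Longrightarrow> content x = content y"
  shows "T = T'"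
  using assms
proof (induction "card D" arbitrary: D T T')
  case 0
  then have "D = {}" using finite_young_ideal by auto
  then show ?case using stdD(4)[OF 0(3)] stdD(4)[OF 0(4)] by auto
next
  case (Suc n)
  note fin = finite_young_ideal[OF Suc.prems(1)]
  obtain x where x: "x \<in> D" "T x = card D" using std_ex_box[OF Suc.prems(2), of "card D"] Suc.hyps(2) by auto
  obtain y where y: "y \<in> D" "T' y = card D" using std_ex_box[OF Suc.prems(3), of "card D"] Suc.hyps(2) by auto
  have "x = y"
    using corners_content_inj std_max_corner x y Suc.prems by metis
  have "T(x := 0) = T'(x := 0)"
  proof (rule Suc.hyps(1))
    show "n = card (D - {x})" using Suc.hyps(2) x by simp
    show "young_ideal (D - {x})"
      using young_ideal_remove std_max_corner x Suc.prems by blast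
    show "T(x := 0) \<in> std (D - {x})" "T'(x := 0) \<in> std (D - {x})"
      using std_restrict Suc.prems x y \<open>x = y\<close> fin by auto
  qed (use Suc.prems(4) in auto)
  then show ?case using x y \<open>x = y\<close> by (metis fun_upd_triv fun_upd_upd)
qed

section \<open>Translation of partitions and their tableaux into order ideals\<close>

lemma partition_of_nth_mono:
  assumes "partition_of n lam" "i \<le> j" "j < length lam"
  shows "lam ! j \<le> lam ! i"
proof (cases "i = j")
  case False
  then show ?thesis using assms unfolding partition_of_def sorted_wrt_iff_nth_less
    by (metis le_neq_implies_less)
qed simp

lemma young_ideal_diagram:
  assumes "partition_of n lam"
  shows "young_ideal (diagram lam)"
proof -
  have "diagram lam = (SIGMA i:{..<length lam}. {..<lam ! i})" by (auto simp: diagram_def)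
  then have "finite (diagram lam)" by simp
  then show ?thesis
    using partition_of_nth_mono[OF assms]
    by (auto simp: young_ideal_def diagram_def less_eq_prod_def) (meson le_trans not_less)
qed

lemma card_diagram: "card (diagram lam) = sum_list lam"
proof -
  have "diagram lam = (SIGMA i:{..<length lam}. {..<lam ! i})" by (auto simp: diagram_def)
  then show ?thesis by (simp add: sum_list_sum_nth atLeast0LessThan)
qed

lemma Tab_eq_std:
  assumes "partition_of n lam"
  shows "Tab lam = std (diagram lam)"
proof -
  note I = young_ideal_diagram[OF assms]
  have mono: "T x < T y"
    if row: "\<forall>i j j'. (i, j) \<in> diagram lam \<and> (i, j') \<in> diagram lam \<and> j < j' \<longrightarrow> T (i, j) < T (i, j')"
    and col: "\<forall>i i' j. (i, j) \<in> diagram lam \<and> (i', j) \<in> diagram lam \<and> i < i' \<longrightarrow> T (i, j) < T (i', j)"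
    and xy: "x \<in> diagram lam" "y \<in> diagram lam" "x < y" for T :: tableau and x y
  proof -
    obtain i j i' j' where e: "x = (i, j)" "y = (i', j')" by fastforce
    then have le: "i \<le> i'" "j \<le> j'" "i < i' \<or> j < j'"
      using xy by (auto simp: less_prod_def less_eq_prod_def)
    \<comment> \<open>The box in the row of x and the column of y lies in the ideal and splits x < y
      into a row step and a column step.\<close>
    have m: "(i, j') \<in> diagram lam" using young_idealD[OF I xy(2), of "(i, j')"] e le by simp
    have "T (i, j) \<le> T (i, j')" using row m xy e le by (metis le_eq_less_or_eq)
    moreover have "T (i, j') \<le> T (i', j')" using col m xy e le by (metis le_eq_less_or_eq)
    moreover have "T (i, j) < T (i, j') \<or> T (i, j') < T (i', j')" using row col m xy e le by blast
    ultimately show ?thesis using e by auto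
  qed
  have "(\<forall>x\<in>diagram lam. \<forall>y\<in>diagram lam. x < y \<longrightarrow> T x < T y) \<longleftrightarrow>
     (\<forall>i j j'. (i, j) \<in> diagram lam \<and> (i, j') \<in> diagram lam \<and> j < j' \<longrightarrow> T (i, j) < T (i, j')) \<and>
     (\<forall>i i' j. (i, j) \<in> diagram lam \<and> (i', j) \<in> diagram lam \<and> i < i' \<longrightarrow> T (i, j) < T (i', j))"
    (is "?L \<longleftrightarrow> ?R") for T :: tableau
  proof
    assume ?L
    then show ?R by (simp add: less_prod_def less_eq_prod_def)
  next
    assume ?R
    then show ?L using mono by blast
  qed
  then show ?thesis
    unfolding Tab_def std_def young_tableau_def card_diagram by simp
qed

lemma box_of_eq:
  assumes "partition_of n lam" "T \<in> Tab lam" "x \<in> diagram lam"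
  shows "box_of lam T (T x) = x"
  unfolding box_of_def
  by (rule inv_into_f_f[OF stdD(2) assms(3)]) (use assms(2) Tab_eq_std[OF assms(1)] in simp)

lemma partition_eq_if_diagram_eq:
  assumes "partition_of n lam" "partition_of m \<mu>" "diagram lam = diagram \<mu>"
  shows "lam = \<mu>"
proof -
  \<comment> \<open>Parts are positive, so the first column determines the number of parts.\<close>
  have len: "i < length l \<longleftrightarrow> (i, 0) \<in> diagram l" if "partition_of k l" for k l i
    using that by (auto simp: diagram_def partition_of_def) (metis bot_nat_0.not_eq_extremum nth_mem)
  have "i < length lam \<longleftrightarrow> i < length \<mu>" for i
    using len assms by metis
  then have l: "length lam = length \<mu>" by (metis nat_neq_iff)
  show ?thesis
  proof (rule nth_equalityI[OF l])
    fix i assume i: "i < length lam"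
    have "j < lam ! i \<longleftrightarrow> j < \<mu> ! i" for j
    proof -
      have "(i, j) \<in> diagram lam \<longleftrightarrow> (i, j) \<in> diagram \<mu>" using assms(3) by simp
      then show ?thesis using i l by (simp add: diagram_def)
    qed
    then show "lam ! i = \<mu> ! i" by (metis nat_neq_iff)
  qed
qed

subsection \<open>Orthogonal projections and isoclinic subspaces\<close>

text \<open>Two candidates for the projection differ by a vector of U that is orthogonal to U, hence
  to itself.\<close>

lemma orth_proj_eq:
  fixes U :: "'v::euclidean_space set"
  assumes "subspace U" "y \<in> U" "\<And>u. u \<in> U \<Longrightarrow> (x - y) \<bullet> u = 0"
  shows "orth_proj U x = y"
  unfolding orth_proj_def
proof (rule the_equality)
  fix z assume z: "z \<in> U \<and> (\<forall>u\<in>U. (x - z) \<bullet> u = 0)"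
  have "z - y \<in> U" using assms z subspace_diff by blast
  then have "(x - y) \<bullet> (z - y) - (x - z) \<bullet> (z - y) = 0" using assms z by auto
  then have "(z - y) \<bullet> (z - y) = 0" by (simp add: inner_diff_left)
  then show "z = y" by simp
qed (use assms in auto)

text \<open>Indexed families rather than sets, so that the notion covers both the columns of an
  isometry and the vectors \<open>v T\<close>.\<close>

definition orthonormal_on :: "'i set \<Rightarrow> ('i \<Rightarrow> 'v::euclidean_space) \<Rightarrow> bool" where
  "orthonormal_on I e \<longleftrightarrow> finite I \<and> (\<forall>i\<in>I. \<forall>j\<in>I. e i \<bullet> e j = (if i = j then 1 else 0))"

lemma orthonormal_on_sum_inner:
  assumes "orthonormal_on I e" "j \<in> I"
  shows "(\<Sum>i\<in>I. c i *\<^sub>R e i) \<bullet> e j = c j"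
proof -
  have "(\<Sum>i\<in>I. c i *\<^sub>R e i) \<bullet> e j = (\<Sum>i\<in>I. if i = j then c i else 0)"
    unfolding inner_sum_left by (rule sum.cong) (use assms in \<open>auto simp: orthonormal_on_def\<close>)
  then show ?thesis using assms by (simp add: orthonormal_on_def)
qed

lemma orthonormal_on_norm_sum:
  assumes "orthonormal_on I e"
  shows "(norm (\<Sum>i\<in>I. c i *\<^sub>R e i))\<^sup>2 = (\<Sum>i\<in>I. (c i)\<^sup>2)"
proof -
  have "(norm (\<Sum>i\<in>I. c i *\<^sub>R e i))\<^sup>2 = (\<Sum>j\<in>I. c j * ((\<Sum>i\<in>I. c i *\<^sub>R e i) \<bullet> e j))"
    unfolding power2_norm_eq_inner by (subst inner_sum_right) simp
  also have "\<dots> = (\<Sum>i\<in>I. (c i)\<^sup>2)"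
    by (rule sum.cong) (auto simp: orthonormal_on_sum_inner[OF assms] power2_eq_square)
  finally show ?thesis .
qed

lemma orthonormal_on_inj:
  assumes "orthonormal_on I e"
  shows "inj_on e I"
  using assms unfolding orthonormal_on_def inj_on_def by (metis zero_neq_one)

lemma dim_span_orthonormal_on:
  assumes "orthonormal_on I e"
  shows "dim (span (e ` I)) = card I"
proof -
  have "pairwise orthogonal (e ` I)"
    using assms by (auto simp: pairwise_def orthogonal_def orthonormal_on_def)
  moreover have "0 \<notin> e ` I"
    using assms unfolding orthonormal_on_def by (metis imageE inner_zero_left zero_neq_one)
  ultimately have "independent (e ` I)" by (rule pairwise_orthogonal_independent)
  then show ?thesis
    using orthonormal_on_inj[OF assms] by (simp add: dim_eq_card_independent card_image)
qed

lemma orth_proj_span: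
  fixes e :: "'i \<Rightarrow> 'v::euclidean_space"
  assumes "orthonormal_on I e"
  shows "orth_proj (span (e ` I)) x = (\<Sum>i\<in>I. (x \<bullet> e i) *\<^sub>R e i)"
proof (rule orth_proj_eq)
  let ?y = "\<Sum>i\<in>I. (x \<bullet> e i) *\<^sub>R e i"
  show "?y \<in> span (e ` I)"
    by (intro span_sum span_scale span_base) auto
  fix u assume "u \<in> span (e ` I)"
  moreover have "e ` I \<subseteq> {u. (x - ?y) \<bullet> u = 0}"
    using orthonormal_on_sum_inner[OF assms] by (auto simp: inner_diff_left)
  moreover have "subspace {u. (x - ?y) \<bullet> u = 0}" by (rule subspace_hyperplane)
  ultimately show "(x - ?y) \<bullet> u = 0" using span_minimal by blast
qed simp

lemma norm_orth_proj_span: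
  assumes "orthonormal_on I e"
  shows "(norm (orth_proj (span (e ` I)) x))\<^sup>2 = (\<Sum>i\<in>I. (x \<bullet> e i)\<^sup>2)"
  unfolding orth_proj_span[OF assms] orthonormal_on_norm_sum[OF assms] ..

lemma isometry_onto_iff:
  "isometry_onto r \<Phi> U \<longleftrightarrow> orthonormal_on {..<r} \<Phi> \<and> span (\<Phi> ` {..<r}) = U"
  by (auto simp: isometry_onto_def orthonormal_on_def)

lemma ex_isometry_onto:
  fixes U :: "'v::euclidean_space set"
  assumes "subspace U"
  obtains \<Phi> where "isometry_onto (dim U) \<Phi> U"
proof -
  obtain B where B: "B \<subseteq> U" "pairwise orthogonal B" "\<And>x. x \<in> B \<Longrightarrow> norm x = 1"
    "independent B" "card B = dim U" "span B = U"
    using orthonormal_basis_subspace[OF assms] by blast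
  have "finite B" using B(4) by (simp add: independent_imp_finite)
  then obtain f where f: "bij_betw f {..<dim U} B"
    using ex_bij_betw_nat_finite B(5) by (metis atLeast0LessThan)
  have "isometry_onto (dim U) f U"
    unfolding isometry_onto_def
  proof (intro conjI allI impI)
    show "span (f ` {..<dim U}) = U" using f B(6) by (simp add: bij_betw_def)
    fix i j assume ij: "i < dim U" "j < dim U"
    have fB: "f i \<in> B" "f j \<in> B" using f ij by (auto simp: bij_betw_def)
    show "f i \<bullet> f j = (if i = j then 1 else 0)"
    proof (cases "i = j")
      case True
      then show ?thesis using B(3)[OF fB(1)] by (simp add: dot_square_norm)
    next
      case False
      then have "f i \<noteq> f j" using f ij by (auto simp: bij_betw_def inj_on_def)
      then show ?thesis using B(2) fB False by (auto simp: pairwise_def orthogonal_def)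
    qed
  qed
  then show ?thesis using that by blast
qed

lemma
  fixes U :: "'v::euclidean_space set"
  assumes "subspace U"
  shows orth_proj_in: "orth_proj U x \<in> U"
    and orth_proj_orthogonal: "u \<in> U \<Longrightarrow> (x - orth_proj U x) \<bullet> u = 0"
    and linear_orth_proj: "linear (orth_proj U)"
proof -
  obtain e where "isometry_onto (dim U) e U" using ex_isometry_onto[OF assms] .
  then have e: "orthonormal_on {..<dim U} e" "span (e ` {..<dim U}) = U"
    by (auto simp: isometry_onto_iff)
  have P: "orth_proj U y = (\<Sum>i<dim U. (y \<bullet> e i) *\<^sub>R e i)" for y
    using orth_proj_span[OF e(1)] e(2) by simp
  show "orth_proj U x \<in> U"
    unfolding P using e(2) by (intro subspace_sum subspace_scale assms) (auto intro: span_base)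
  show "(x - orth_proj U x) \<bullet> u = 0" if "u \<in> U"
  proof -
    have "e ` {..<dim U} \<subseteq> {u. (x - orth_proj U x) \<bullet> u = 0}"
      unfolding P using orthonormal_on_sum_inner[OF e(1)] by (auto simp: inner_diff_left)
    then show ?thesis using that e(2) span_minimal[OF _ subspace_hyperplane] by blast
  qed
  show "linear (orth_proj U)"
    unfolding P[abs_def]
    by (intro linearI) (simp_all add: inner_left_distrib scaleR_left_distrib sum.distrib
        scaleR_sum_right)
qed

lemma orth_proj_orthogonal_transformation:
  fixes U :: "'v::euclidean_space set"
  assumes "subspace U" "orthogonal_transformation f"
  shows "orth_proj (f ` U) (f x) = f (orth_proj U x)"
proof (rule orth_proj_eq)
  have lin: "linear f" using assms(2) by (rule orthogonal_transformation_linear)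
  show "subspace (f ` U)" using linear_subspace_image[OF lin assms(1)] .
  show "f (orth_proj U x) \<in> f ` U" using orth_proj_in[OF assms(1)] by blast
  fix u assume "u \<in> f ` U"
  then obtain z where z: "z \<in> U" "u = f z" by blast
  have "(f x - f (orth_proj U x)) \<bullet> f z = f (x - orth_proj U x) \<bullet> f z"
    by (simp add: linear_diff[OF lin])
  also have "\<dots> = 0"
    using assms(2) orth_proj_orthogonal[OF assms(1) z(1)] by (simp add: orthogonal_transformation_def)
  finally show "(f x - f (orth_proj U x)) \<bullet> u = 0" using z by simp
qed

lemma bilinear_linear_inner:
  fixes f :: "'a::real_vector \<Rightarrow> 'b::real_inner"
  assumes "linear f"
  shows "bilinear (\<lambda>x y. f x \<bullet> f y)"
  unfolding bilinear_def
  by (auto intro!: linearI simp: linear_add[OF assms] linear_scale[OF assms] inner_left_distrib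
      inner_right_distrib)

lemma bilinear_scaled_inner: "bilinear (\<lambda>x y :: 'a::real_inner. c * (x \<bullet> y))"
  unfolding bilinear_def
  by (auto intro!: linearI simp: inner_left_distrib inner_right_distrib algebra_simps)

text \<open>The entry (i, j) of the Gram product is the inner product of the projections to
  \<open>W k\<close> of the columns i and j belonging to \<open>W l\<close>. Both sides are bilinear
  in these columns, so the condition extends to all of \<open>W l\<close> and the chosen isometries
  disappear.\<close>

lemma equi_isoclinic_iff:
  fixes W :: "'i \<Rightarrow> 'v::euclidean_space set"
  assumes "\<And>k. k \<in> I \<Longrightarrow> subspace (W k)" "\<And>k. k \<in> I \<Longrightarrow> dim (W k) = r"
  shows "equi_isoclinic r I W \<longleftrightarrow> (\<exists>\<alpha>. \<forall>k\<in>I. \<forall>l\<in>I. k \<noteq> l \<longrightarrow>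
    (\<forall>x\<in>W l. \<forall>y\<in>W l. orth_proj (W k) x \<bullet> orth_proj (W k) y = \<alpha> * (x \<bullet> y)))"
    (is "_ \<longleftrightarrow> (\<exists>\<alpha>. ?R \<alpha>)")
proof -
  have gram: "(\<Sum>m<r. cross_gram (\<Phi> k) (\<Phi> l) m i * cross_gram (\<Phi> k) (\<Phi> l) m j)
      = orth_proj (W k) (\<Phi> l i) \<bullet> orth_proj (W k) (\<Phi> l j)"
    if "isometry_onto r (\<Phi> k) (W k)" for \<Phi> :: "'i \<Rightarrow> nat \<Rightarrow> 'v" and k l i j
  proof -
    have e: "orthonormal_on {..<r} (\<Phi> k)" "span (\<Phi> k ` {..<r}) = W k"
      using that by (auto simp: isometry_onto_iff)
    have "orth_proj (W k) x \<bullet> orth_proj (W k) y = (\<Sum>m<r. (x \<bullet> \<Phi> k m) * (y \<bullet> \<Phi> k m))" for x y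
    proof -
      have "orth_proj (W k) x \<bullet> orth_proj (W k) y
          = (\<Sum>m<r. (y \<bullet> \<Phi> k m) * (orth_proj (W k) x \<bullet> \<Phi> k m))"
        using orth_proj_span[OF e(1), of y] e(2) by (simp add: inner_sum_right)
      also have "\<dots> = (\<Sum>m<r. (x \<bullet> \<Phi> k m) * (y \<bullet> \<Phi> k m))"
      proof (rule sum.cong)
        fix m assume "m \<in> {..<r}"
        then have "orth_proj (W k) x \<bullet> \<Phi> k m = x \<bullet> \<Phi> k m"
          using orth_proj_span[OF e(1), of x] e(2) orthonormal_on_sum_inner[OF e(1)] by simp
        then show "(y \<bullet> \<Phi> k m) * (orth_proj (W k) x \<bullet> \<Phi> k m) = (x \<bullet> \<Phi> k m) * (y \<bullet> \<Phi> k m)"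
          by simp
      qed simp
      finally show ?thesis .
    qed
    then show ?thesis by (simp add: cross_gram_def inner_commute)
  qed
  show ?thesis
  proof
    assume "equi_isoclinic r I W"
    then obtain \<Phi> \<alpha> where \<Phi>: "\<And>k. k \<in> I \<Longrightarrow> isometry_onto r (\<Phi> k) (W k)"
      and \<alpha>: "\<And>k l i j. k \<in> I \<Longrightarrow> l \<in> I \<Longrightarrow> k \<noteq> l \<Longrightarrow> i < r \<Longrightarrow> j < r \<Longrightarrow>
        (\<Sum>m<r. cross_gram (\<Phi> k) (\<Phi> l) m i * cross_gram (\<Phi> k) (\<Phi> l) m j) = (if i = j then \<alpha> else 0)"
      unfolding equi_isoclinic_def by metis
    have "orth_proj (W k) x \<bullet> orth_proj (W k) y = \<alpha> * (x \<bullet> y)"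
      if kl: "k \<in> I" "l \<in> I" "k \<noteq> l" and xy: "x \<in> W l" "y \<in> W l" for k l x y
    proof (rule bilinear_eq[where f = "\<lambda>x y. orth_proj (W k) x \<bullet> orth_proj (W k) y"
          and g = "\<lambda>x y. \<alpha> * (x \<bullet> y)" and S = "W l" and T = "W l"
          and B = "\<Phi> l ` {..<r}" and C = "\<Phi> l ` {..<r}"])
      note lp = linear_orth_proj[OF assms(1)[OF kl(1)]]
      show "bilinear (\<lambda>x y. orth_proj (W k) x \<bullet> orth_proj (W k) y)"
        by (rule bilinear_linear_inner[OF lp])
      show "bilinear (\<lambda>x y. \<alpha> * (x \<bullet> y))"
        by (rule bilinear_scaled_inner)
      show "W l \<subseteq> span (\<Phi> l ` {..<r})" "W l \<subseteq> span (\<Phi> l ` {..<r})"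
        using \<Phi>[OF kl(2)] by (auto simp: isometry_onto_def)
      fix a b assume "a \<in> \<Phi> l ` {..<r}" "b \<in> \<Phi> l ` {..<r}"
      then obtain i j where ij: "a = \<Phi> l i" "b = \<Phi> l j" "i < r" "j < r" by auto
      have "a \<bullet> b = (if i = j then 1 else 0)"
        using \<Phi>[OF kl(2)] ij by (simp add: isometry_onto_def)
      then show "orth_proj (W k) a \<bullet> orth_proj (W k) b = \<alpha> * (a \<bullet> b)"
        using gram[where \<Phi> = \<Phi>, OF \<Phi>[OF kl(1)], of l i j] \<alpha>[OF kl ij(3,4)] ij by auto
    qed (use xy in auto)
    then show "\<exists>\<alpha>. ?R \<alpha>" by blast
  next
    assume "\<exists>\<alpha>. ?R \<alpha>"
    then obtain \<alpha> where \<alpha>: "?R \<alpha>" by blast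
    have "\<forall>k\<in>I. \<exists>\<Phi>. isometry_onto r \<Phi> (W k)"
      using ex_isometry_onto assms by metis
    then obtain \<Phi> where \<Phi>: "\<And>k. k \<in> I \<Longrightarrow> isometry_onto r (\<Phi> k) (W k)" by metis
    have "(\<Sum>m<r. cross_gram (\<Phi> k) (\<Phi> l) m i * cross_gram (\<Phi> k) (\<Phi> l) m j) = (if i = j then \<alpha> else 0)"
      if "k \<in> I" "l \<in> I" "k \<noteq> l" "i < r" "j < r" for k l i j
    proof -
      have "\<Phi> l i \<in> W l" "\<Phi> l j \<in> W l" "\<Phi> l i \<bullet> \<Phi> l j = (if i = j then 1 else 0)"
        using \<Phi>[OF that(2)] that(4,5) span_base[of _ "\<Phi> l ` {..<r}"] by (auto simp: isometry_onto_def)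
      then show ?thesis unfolding gram[where \<Phi> = \<Phi>, OF \<Phi>[OF that(1)]] using \<alpha> that by auto
    qed
    then show "equi_isoclinic r I W"
      unfolding equi_isoclinic_def using \<Phi> by blast
  qed
qed

subsection \<open>Jucys-Murphy elements and Schur's lemma\<close>

lemma permutes_adj_swap: "1 \<le> k \<Longrightarrow> k < n \<Longrightarrow> adj_swap k permutes {1..n}"
  by (rule permutes_swap_id) auto

text \<open>Conjugation by the swap moves k to k + 1 and fixes i. This serves both to generate all
  transpositions and for the recursion of the Jucys-Murphy elements.\<close>

lemma transpose_Suc_conj:
  "i < k \<Longrightarrow> Transposition.transpose i (Suc k) = adj_swap k \<circ> Transposition.transpose i k \<circ> adj_swap k"
  by (auto simp: fun_eq_iff Transposition.transpose_def)

text \<open>A transposition of a and b is built from adjacent ones by raising b one step at a time;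
  permutations are then products of transpositions.\<close>

lemma permutes_adj_swap_induct [consumes 1, case_names id adj comp]:
  assumes "g permutes {1..n}"
    and id: "P id"
    and adj: "\<And>k. 1 \<le> k \<Longrightarrow> k < n \<Longrightarrow> P (adj_swap k)"
    and comp: "\<And>g h. g permutes {1..n} \<Longrightarrow> h permutes {1..n} \<Longrightarrow> P g \<Longrightarrow> P h \<Longrightarrow> P (g \<circ> h)"
  shows "P g"
proof -
  have tr: "P (Transposition.transpose a b)" if "1 \<le> a" "a < b" "b \<le> n" for a b
  proof -
    from \<open>a < b\<close> have "Suc a \<le> b" by simp
    then show ?thesis using \<open>b \<le> n\<close>
    proof (induction b rule: dec_induct)
      case base
      then show ?case using adj[of a] that by simp
    next
      case (step b)
      have p: "adj_swap b permutes {1..n}" "Transposition.transpose a b permutes {1..n}"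
        using step that by (auto intro!: permutes_swap_id)
      show ?case
        unfolding transpose_Suc_conj[of a b, OF Suc_le_lessD[OF step(1)]]
        using step that p adj[of b]
        by (intro comp permutes_compose) auto
    qed
  qed
  show ?thesis
    using assms(1) finite_atLeastAtMost
  proof (induction rule: permutes_induct)
    case (swap a b p)
    have "P (Transposition.transpose a b)"
      using tr[of a b] tr[of b a] swap(1,2,3) by (cases "a < b") (auto simp: transpose_commute)
    moreover have "Transposition.transpose a b permutes {1..n}"
      using swap by (intro permutes_swap_id) auto
    ultimately show ?case using swap comp by blast
  qed (rule id)
qed

text \<open>The boxes of k and k + 1 are given explicitly, so that no inverse of T appears, and the
  ideal is a parameter, so that the locale applies to D and to D without a corner.\<close>

locale young_rep =
  fixes D :: "(nat \<times> nat) set" and v :: "tableau \<Rightarrow> 'v::euclidean_space"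
    and \<pi> :: "(nat \<Rightarrow> nat) \<Rightarrow> 'v \<Rightarrow> 'v"
  assumes ideal: "young_ideal D"
    and orthonormal: "orthonormal_on (std D) v"
    and span_v: "span (v ` std D) = UNIV"
    and orth: "g permutes {1..card D} \<Longrightarrow> orthogonal_transformation (\<pi> g)"
    and hom: "g permutes {1..card D} \<Longrightarrow> h permutes {1..card D} \<Longrightarrow> \<pi> (g \<circ> h) = \<pi> g \<circ> \<pi> h"
    and adj_swap_v: "T \<in> std D \<Longrightarrow> x \<in> D \<Longrightarrow> y \<in> D \<Longrightarrow> T x = k \<Longrightarrow> T y = Suc k \<Longrightarrow>
      \<pi> (adj_swap k) (v T) = (1 / real_of_int (content y - content x)) *\<^sub>R v T +
        sqrt (1 - 1 / (real_of_int (content y - content x))\<^sup>2) *\<^sub>R v (adj_swap k \<circ> T)"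
begin

lemma linear_pi: "g permutes {1..card D} \<Longrightarrow> linear (\<pi> g)"
  using orth orthogonal_transformation_linear by blast

lemma inner_pi: "g permutes {1..card D} \<Longrightarrow> \<pi> g x \<bullet> \<pi> g y = x \<bullet> y"
  using orth by (simp add: orthogonal_transformation_def)

text \<open>An injective idempotent map is the identity.\<close>

lemma pi_id: "\<pi> id = id"
proof -
  have "\<pi> id (\<pi> id x) = \<pi> id x" for x
    using hom[OF permutes_id permutes_id] by (metis comp_id comp_apply)
  moreover have "inj (\<pi> id)"
    using orth[OF permutes_id] by (rule orthogonal_transformation_inj)
  ultimately show ?thesis by (auto simp: inj_def)
qed

lemma pi_comp:
  "g permutes {1..card D} \<Longrightarrow> h permutes {1..card D} \<Longrightarrow> \<pi> (g \<circ> h) x = \<pi> g (\<pi> h x)"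
  using hom by simp

lemma pi_inv:
  assumes "g permutes {1..card D}"
  shows "\<pi> g (\<pi> (inv g) x) = x" "\<pi> (inv g) (\<pi> g x) = x"
proof -
  show "\<pi> g (\<pi> (inv g) x) = x"
    using pi_comp[OF assms permutes_inv[OF assms]] permutes_inv_o[OF assms] pi_id by simp
  show "\<pi> (inv g) (\<pi> g x) = x"
    using pi_comp[OF permutes_inv[OF assms] assms] permutes_inv_o[OF assms] pi_id by simp
qed

text \<open>An orthogonal involution is self-adjoint.\<close>

lemma inner_pi_transpose:
  assumes "i \<in> {1..card D}" "k \<in> {1..card D}"
  shows "\<pi> (Transposition.transpose i k) x \<bullet> y = x \<bullet> \<pi> (Transposition.transpose i k) y"
proof -
  have p: "Transposition.transpose i k permutes {1..card D}" using assms by (rule permutes_swap_id)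
  have "\<pi> (Transposition.transpose i k) (\<pi> (Transposition.transpose i k) y) = y"
    using pi_comp[OF p p] pi_id by simp
  then show ?thesis using inner_pi[OF p, of x "\<pi> (Transposition.transpose i k) y"] by simp
qed

definition jucys_murphy :: "nat \<Rightarrow> 'v \<Rightarrow> 'v" where
  "jucys_murphy k x = (\<Sum>i=1..<k. \<pi> (Transposition.transpose i k) x)"

lemma inner_jucys_murphy:
  assumes "k \<le> card D"
  shows "jucys_murphy k x \<bullet> y = x \<bullet> jucys_murphy k y"
  unfolding jucys_murphy_def inner_sum_left inner_sum_right
  by (rule sum.cong) (use assms in \<open>auto intro!: inner_pi_transpose\<close>)

lemma linear_jucys_murphy:
  assumes "k \<le> card D"
  shows "linear (jucys_murphy k)"
  unfolding jucys_murphy_def[abs_def]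
  by (intro linear_compose_sum ballI linear_pi permutes_swap_id) (use assms in auto)

text \<open>The classical recursion: conjugation by the swap accounts for the transpositions with i
  < k, and the one with i = k is the swap itself.\<close>

lemma jucys_murphy_Suc:
  assumes "1 \<le> k" "Suc k \<le> card D"
  shows "jucys_murphy (Suc k) x = \<pi> (adj_swap k) (jucys_murphy k (\<pi> (adj_swap k) x)) + \<pi> (adj_swap k) x"
proof -
  have s: "adj_swap k permutes {1..card D}" using assms permutes_adj_swap by auto
  have "(\<Sum>i=1..<k. \<pi> (Transposition.transpose i (Suc k)) x)
      = (\<Sum>i=1..<k. \<pi> (adj_swap k) (\<pi> (Transposition.transpose i k) (\<pi> (adj_swap k) x)))"
  proof (rule sum.cong)
    fix i assume i: "i \<in> {1..<k}"
    then have p: "Transposition.transpose i k permutes {1..card D}"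
      using assms by (intro permutes_swap_id) auto
    show "\<pi> (Transposition.transpose i (Suc k)) x
        = \<pi> (adj_swap k) (\<pi> (Transposition.transpose i k) (\<pi> (adj_swap k) x))"
      using transpose_Suc_conj[of i k] i pi_comp[OF permutes_compose[OF p s] s] pi_comp[OF s p] by simp
  qed simp
  also have "\<dots> = \<pi> (adj_swap k) (jucys_murphy k (\<pi> (adj_swap k) x))"
    unfolding jucys_murphy_def by (simp add: linear_sum[OF linear_pi[OF s]])
  finally show ?thesis using assms by (simp add: jucys_murphy_def)
qed

text \<open>Induction on the entry. Let k + 1 lie in x, of content c, and k in y, of content e. The
  element for k has eigenvalue e on \<open>v T\<close> and, if the swapped tableau is standard, c on
  its vector, because there k lies in x. Expanding u, the image of \<open>v T\<close> under the
  swap, gives the value c u - v T, from which the recursion yields the eigenvalue c.\<close>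

lemma jucys_murphy_v:
  assumes "T \<in> std D" "x \<in> D"
  shows "jucys_murphy (T x) (v T) = real_of_int (content x) *\<^sub>R v T"
proof -
  have "jucys_murphy k (v T) = real_of_int (content x) *\<^sub>R v T"
    if "1 \<le> k" "T \<in> std D" "x \<in> D" "T x = k" for k T x
    using that
  proof (induction k arbitrary: T x rule: dec_induct)
    case base
    \<comment> \<open>The entry 1 occupies the box of content 0, and the sum in the Jucys-Murphy
      element is empty.\<close>
    have "x = (0, 0)"
    proof (rule ccontr)
      assume "x \<noteq> (0, 0)"
      then have l: "(0, 0) < x" by (cases x) (auto simp: less_prod_def less_eq_prod_def)
      then have "(0, 0) \<in> D" using young_idealD[OF ideal base(2)] by auto
      then show False using stdD(5)[OF base(1) _ base(2) l] std_range(1)[OF base(1)] base(3) by fastforce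
    qed
    then show ?case by (simp add: jucys_murphy_def content_def)
  next
    case (step k)
    note T = \<open>T \<in> std D\<close> and x = \<open>x \<in> D\<close> \<open>T x = Suc k\<close>
    have k: "1 \<le> k" "Suc k \<le> card D" using step std_range(2)[OF T x(1)] by auto
    obtain y where y: "y \<in> D" "T y = k" using std_ex_box[OF T, of k] k by auto
    have s: "adj_swap k permutes {1..card D}" using k permutes_adj_swap by auto
    note lin = linear_pi[OF s] and linJ = linear_jucys_murphy[of k, OF Suc_leD[OF k(2)]]
    define c where "c = real_of_int (content x)"
    define e where "e = real_of_int (content y)"
    define u where "u = \<pi> (adj_swap k) (v T)"
    have pu: "\<pi> (adj_swap k) u = v T"
      unfolding u_def using pi_comp[OF s s] pi_id by simp
    have Jy: "jucys_murphy k (v T) = e *\<^sub>R v T"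
      using step.IH[OF T y] by (simp add: e_def)
    have u: "u = (1 / (c - e)) *\<^sub>R v T + sqrt (1 - 1 / (c - e)\<^sup>2) *\<^sub>R v (adj_swap k \<circ> T)"
      unfolding u_def c_def e_def using adj_swap_v[OF T y(1) x(1) y(2) x(2)] by simp
    have Ju: "jucys_murphy k u = - v T + c *\<^sub>R u"
    proof (cases "adj_swap k \<circ> T \<in> std D")
      case True
      then have ne: "\<bar>content x - content y\<bar> \<ge> 2"
        using consecutive_boxes[OF ideal T y(1) x(1) y(2) x(2)] by auto
      then have ce: "c - e \<noteq> 0" by (auto simp: c_def e_def)
      have Jx: "jucys_murphy k (v (adj_swap k \<circ> T)) = c *\<^sub>R v (adj_swap k \<circ> T)"
        using step.IH[OF True x(1)] x(2) by (simp add: c_def del: o_apply) (simp add: o_def)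
      have "jucys_murphy k u = (1 / (c - e)) *\<^sub>R e *\<^sub>R v T + c *\<^sub>R (u - (1 / (c - e)) *\<^sub>R v T)"
        by (simp add: u linear_add[OF linJ] linear_scale[OF linJ] Jy Jx)
      also have "\<dots> = ((e - c) / (c - e)) *\<^sub>R v T + c *\<^sub>R u"
        by (simp add: algebra_simps diff_divide_distrib)
      also have "(e - c) / (c - e) = -1" using ce by (simp add: field_simps)
      finally show ?thesis by simp
    next
      case False
      then have "\<bar>content x - content y\<bar> = 1"
        using consecutive_boxes[OF ideal T y(1) x(1) y(2) x(2)] by auto
      then have "content x - content y = 1 \<or> content x - content y = -1" by linarith
      then have ce: "c - e = 1 \<or> c - e = -1" by (auto simp: c_def e_def)
      \<comment> \<open>As c - e is 1 or -1, it equals its inverse, and the coefficient of the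
        non-standard filling is 0.\<close>
      then have u': "u = (c - e) *\<^sub>R v T" using u by auto
      then have "jucys_murphy k u = ((c - e) * e) *\<^sub>R v T" by (simp add: linear_scale[OF linJ] Jy)
      also have "(c - e) * e = c * (c - e) - 1"
        using ce by (auto simp: algebra_simps)
      also have "(c * (c - e) - 1) *\<^sub>R v T = - v T + c *\<^sub>R u"
        unfolding u' by (simp add: algebra_simps)
      finally show ?thesis .
    qed
    have "jucys_murphy (Suc k) (v T) = \<pi> (adj_swap k) (jucys_murphy k u) + u"
      unfolding u_def by (rule jucys_murphy_Suc[OF k])
    also have "\<dots> = c *\<^sub>R v T"
      unfolding Ju by (simp add: linear_diff[OF lin] linear_add[OF lin] linear_neg[OF lin] linear_scale[OF lin] pu)
        (simp add: u_def)
    finally show ?case by (simp add: c_def)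
  qed
  then show ?thesis using assms std_range(1)[OF assms] by blast
qed

text \<open>A commutes with the self-adjoint Jucys-Murphy elements, and two different tableaux have
  different eigenvalues for one of them; so A is diagonal in the basis \<open>v T\<close>. Commuting
  with an admissible swap makes the diagonal entries of T and of the swapped tableau equal, and
  \<open>std_connected\<close> spreads this to all tableaux.\<close>

lemma schur:
  assumes lin: "linear A"
    and comm: "\<And>g x. g permutes {1..card D} \<Longrightarrow> A (\<pi> g x) = \<pi> g (A x)"
  obtains c where "\<And>x. A x = c *\<^sub>R x"
proof -
  have off: "A (v T) \<bullet> v T' = 0" if T: "T \<in> std D" "T' \<in> std D" "T \<noteq> T'" for T T'
  proof -
    obtain x y where xy: "x \<in> D" "y \<in> D" "T x = T' y" "content x \<noteq> content y"
      using std_eq_if_contents_eq[OF ideal T(1,2)] T(3) by blast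
    define k where "k = T x"
    have k: "k \<le> card D" using std_range[OF T(1) xy(1)] by (simp add: k_def)
    have "A (jucys_murphy k z) = jucys_murphy k (A z)" for z
      unfolding jucys_murphy_def linear_sum[OF lin]
      by (rule sum.cong) (use k in \<open>auto intro!: comm permutes_swap_id\<close>)
    then have "A (jucys_murphy k (v T)) \<bullet> v T' = A (v T) \<bullet> jucys_murphy k (v T')"
      using inner_jucys_murphy[OF k] by simp
    then have "content x * (A (v T) \<bullet> v T') = content y * (A (v T) \<bullet> v T')"
      using jucys_murphy_v[OF T(1) xy(1)] jucys_murphy_v[OF T(2) xy(2)] xy(3)
      by (simp add: k_def linear_scale[OF lin])
    then show ?thesis using xy(4) by simp
  qed
  obtain T0 where T0: "T0 \<in> std D" using std_nonempty[OF ideal] by blast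
  define d where "d T = A (v T) \<bullet> v T" for T
  have dT: "A (v T) = d T *\<^sub>R v T" if "T \<in> std D" for T
  proof -
    have "A (v T) = orth_proj (span (v ` std D)) (A (v T))"
      unfolding span_v by (rule orth_proj_eq[symmetric]) auto
    also have "\<dots> = (\<Sum>S\<in>std D. (A (v T) \<bullet> v S) *\<^sub>R v S)"
      by (rule orth_proj_span[OF orthonormal])
    also have "\<dots> = (\<Sum>S\<in>std D. if S = T then d T *\<^sub>R v T else 0)"
      by (rule sum.cong) (use off that in \<open>auto simp: d_def\<close>)
    finally show ?thesis using that finite_std[OF ideal] by simp
  qed
  have "d T0 = d T" if "T \<in> std D" for T
  proof (rule std_connected[OF ideal _ T0 that])
    fix T k assume T: "T \<in> std D" "1 \<le> k" "k < card D" "adj_swap k \<circ> T \<in> std D"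
    obtain x where x: "x \<in> D" "T x = k" using std_ex_box[OF T(1,2)] T by auto
    obtain y where y: "y \<in> D" "T y = Suc k" using std_ex_box[OF T(1), of "Suc k"] T by auto
    have s: "adj_swap k permutes {1..card D}" using T permutes_adj_swap by auto
    define \<beta> where "\<beta> = sqrt (1 - 1 / (real_of_int (content y - content x))\<^sup>2)"
    have "(\<bar>content y - content x\<bar>) \<ge> 2"
      using consecutive_boxes[OF ideal T(1) x(1) y(1) x(2) y(2)] T by auto
    then have "(real_of_int (content y - content x))\<^sup>2 \<ge> 2\<^sup>2"
      by (metis abs_le_square_iff abs_numeral of_int_abs of_int_le_iff of_int_numeral)
    \<comment> \<open>The content distance is at least 2, so the off-diagonal coefficient of Young's
      formula is nonzero and can be cancelled below.\<close>
    then have "\<beta> \<noteq> 0" by (auto simp: \<beta>_def field_simps)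
    have ne: "T \<noteq> adj_swap k \<circ> T" using x by (metis comp_apply n_not_Suc_n transpose_apply_first)
    have act: "\<pi> (adj_swap k) (v T) = (1 / real_of_int (content y - content x)) *\<^sub>R v T + \<beta> *\<^sub>R v (adj_swap k \<circ> T)"
      unfolding \<beta>_def by (rule adj_swap_v) (use T x y in auto)
    have 1: "\<pi> (adj_swap k) (v T) \<bullet> v (adj_swap k \<circ> T) = \<beta>"
      unfolding act using orthonormal T ne by (simp add: orthonormal_on_def inner_left_distrib)
    have "A (\<pi> (adj_swap k) (v T)) \<bullet> v (adj_swap k \<circ> T) = \<beta> * d (adj_swap k \<circ> T)"
      unfolding act using off[OF T(1,4) ne]
      by (simp add: linear_add[OF lin] linear_scale[OF lin] inner_left_distrib d_def)
    moreover have "A (\<pi> (adj_swap k) (v T)) \<bullet> v (adj_swap k \<circ> T) = d T * \<beta>"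
      using comm[OF s] dT[OF T(1)] 1 by (simp add: linear_scale[OF linear_pi[OF s]])
    ultimately show "d (adj_swap k \<circ> T) = d T" using \<open>\<beta> \<noteq> 0\<close> by simp
  qed
  then have "A x = d T0 *\<^sub>R x" for x
  proof -
    have "x \<in> span (v ` std D)" using span_v by simp
    then show ?thesis
    proof (rule linear_eq_on[OF lin, rotated])
      show "linear (\<lambda>x. d T0 *\<^sub>R x)" by (intro linearI) (simp_all add: scaleR_right_distrib)
      fix b assume "b \<in> v ` std D"
      then show "A b = d T0 *\<^sub>R b" using dT \<open>\<And>T. T \<in> std D \<Longrightarrow> d T0 = d T\<close> by auto
    qed
  qed
  then show ?thesis using that by blast
qed

end

lemma young_rep_of_young_orthogonal_form:
  assumes "partition_of n lam" "young_orthogonal_form n lam v \<pi>"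
  shows "young_rep (diagram lam) v \<pi>"
proof -
  note I = young_ideal_diagram[OF assms(1)] and Tab = Tab_eq_std[OF assms(1)]
  have n: "card (diagram lam) = n" using assms(1) by (simp add: card_diagram partition_of_def)
  note Y = assms(2)[unfolded young_orthogonal_form_def Tab]
  show ?thesis
  proof (unfold_locales, unfold n)
    show "orthonormal_on (std (diagram lam)) v"
      using Y finite_std[OF I] by (simp add: orthonormal_on_def)
    fix T x y k
    assume T: "T \<in> std (diagram lam)" "x \<in> diagram lam" "y \<in> diagram lam" "T x = k" "T y = Suc k"
    have k: "1 \<le> k" "k < n" using std_range(1)[OF T(1,2)] std_range(2)[OF T(1,3)] T n by auto
    have "axial_dist lam T (Suc k) k = content y - content x"
      using box_of_eq[OF assms(1), of T] T Tab unfolding axial_dist_def by metis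
    then show "\<pi> (adj_swap k) (v T) = (1 / real_of_int (content y - content x)) *\<^sub>R v T +
        sqrt (1 - 1 / (real_of_int (content y - content x))\<^sup>2) *\<^sub>R v (adj_swap k \<circ> T)"
      using Y k T(1) by (auto simp: Let_def)
  qed (use Y I in auto)
qed

subsection \<open>The isotypic component\<close>

lemma sum_inv_into_bij_betw:
  assumes "bij_betw f A B"
  shows "(\<Sum>b\<in>B. g (inv_into A f b)) = (\<Sum>a\<in>A. g a)"
proof -
  have "(\<Sum>b\<in>B. g (inv_into A f b)) = (\<Sum>a\<in>A. g (inv_into A f (f a)))"
    using sum.reindex_bij_betw[OF assms, of "\<lambda>b. g (inv_into A f b)"] by simp
  also have "\<dots> = (\<Sum>a\<in>A. g a)"
    by (rule sum.cong) (use assms in \<open>auto simp: bij_betw_def\<close>)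
  finally show ?thesis .
qed

lemma permutes_factor_adj_swap:
  assumes "g permutes {1..n}" "g n \<noteq> n" "2 \<le> n"
  obtains h h' where "h permutes {1..n - 1}" "h' permutes {1..n - 1}"
    "g = h \<circ> adj_swap (n - 1) \<circ> h'"
proof -
  let ?s = "adj_swap (n - 1)"
  \<comment> \<open>It sends g n to n - 1, which the swap sends on to n, so the remaining factor
    fixes n. If g n = n - 1, it is the identity.\<close>
  let ?h = "Transposition.transpose (g n) (n - 1)"
  have "g n \<in> {1..n}" using permutes_in_image[OF assms(1), of n] assms(3) by simp
  then have gn: "g n \<in> {1..n - 1}" using assms(2) by auto
  have h: "?h permutes {1..n - 1}" by (rule permutes_swap_id) (use gn assms(3) in auto)
  have s: "?s permutes {1..n}" by (rule permutes_swap_id) (use assms(3) in auto)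
  have h1: "?h permutes {1..n}" using permutes_subset[OF h] by auto
  have "?s \<circ> ?h \<circ> g permutes {1..n}"
    using permutes_compose[OF permutes_compose[OF assms(1) h1] s] by (simp add: o_assoc)
  moreover have "(?s \<circ> ?h \<circ> g) n = n" using assms(3) by (auto simp: Transposition.transpose_def)
  moreover have "{1..n} - {1..n - 1} = {n}" using assms(3) by auto
  ultimately have h': "?s \<circ> ?h \<circ> g permutes {1..n - 1}"
    using permutes_superset[of "?s \<circ> ?h \<circ> g" "{1..n}" "{1..n - 1}"] by auto
  have "g = ?h \<circ> ?s \<circ> (?s \<circ> ?h \<circ> g)"
    by (simp add: fun_eq_iff)
  then show ?thesis using that h h' by blast
qed

context young_rep
begin

lemma expand: "z = (\<Sum>T\<in>std D. (z \<bullet> v T) *\<^sub>R v T)"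
proof -
  have "orth_proj (span (v ` std D)) z = z"
    unfolding span_v by (rule orth_proj_eq) auto
  then show ?thesis unfolding orth_proj_span[OF orthonormal] by simp
qed

lemma dim_eq_card_std: "DIM('v) = card (std D)"
  using dim_span_orthonormal_on[OF orthonormal] unfolding span_v by simp

end

locale young_restriction = V: young_rep D v \<pi> + M: young_rep "D - {x}" w \<rho>
  for D x and v :: "tableau \<Rightarrow> 'v::euclidean_space" and \<pi>
    and w :: "tableau \<Rightarrow> 'w::euclidean_space" and \<rho> +
  assumes x_corner: "x \<in> corners D"
begin

definition W :: "'v set" where
  "W = isotypic_component (card D - 1) \<rho> \<pi>"

definition top_tabs :: "tableau set" where
  "top_tabs = {T \<in> std D. T x = card D}"

lemma x_in: "x \<in> D" using x_corner corners_subset by blast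

lemma fin_D: "finite D" using V.ideal finite_young_ideal by blast

lemma card_D: "card D \<ge> 1" using x_in fin_D card_gt_0_iff[of D] by fastforce

lemma card_rem: "card (D - {x}) = card D - 1" using x_in by simp

lemma permutes_lift: "g permutes {1..card D - 1} \<Longrightarrow> g permutes {1..card D}"
  by (erule permutes_subset) auto

lemma bij_top_tabs: "bij_betw (\<lambda>S. S(x := card D)) (std (D - {x})) top_tabs"
  unfolding top_tabs_def using bij_betw_std_extend[OF V.ideal x_corner] .

lemma orthonormal_top: "orthonormal_on top_tabs v"
  using V.orthonormal unfolding orthonormal_on_def top_tabs_def by auto

lemma extend_in_std: "S \<in> std (D - {x}) \<Longrightarrow> S(x := card D) \<in> std D"
  using std_extend[OF _ x_corner fin_D] .

text \<open>One explicit intertwiner, sending \<open>w S\<close> to the vector of the extended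
  tableau. Its range turns out to be the whole isotypic component.\<close>

definition embed :: "'w \<Rightarrow> 'v" where
  "embed z = (\<Sum>S\<in>std (D - {x}). (z \<bullet> w S) *\<^sub>R v (S(x := card D)))"

lemma orthonormal_extend: "orthonormal_on (std (D - {x})) (\<lambda>S. v (S(x := card D)))"
  unfolding orthonormal_on_def
proof (intro conjI ballI)
  show "finite (std (D - {x}))" using M.ideal finite_std by blast
  fix S S' assume S: "S \<in> std (D - {x})" "S' \<in> std (D - {x})"
  have "S(x := card D) = S'(x := card D) \<longleftrightarrow> S = S'"
    using bij_top_tabs S unfolding bij_betw_def inj_on_def by blast
  then show "v (S(x := card D)) \<bullet> v (S'(x := card D)) = (if S = S' then 1 else 0)"
    using V.orthonormal extend_in_std S by (auto simp: orthonormal_on_def)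
qed

lemma linear_embed: "linear embed"
  unfolding embed_def
  by (intro linearI) (simp_all add: inner_left_distrib scaleR_left_distrib sum.distrib scaleR_sum_right)

lemma norm_embed: "norm (embed z) = norm z"
proof -
  have "(norm (embed z))\<^sup>2 = (\<Sum>S\<in>std (D - {x}). (z \<bullet> w S)\<^sup>2)"
    unfolding embed_def by (rule orthonormal_on_norm_sum[OF orthonormal_extend])
  also have "\<dots> = (norm z)\<^sup>2"
    using orthonormal_on_norm_sum[OF M.orthonormal, of "\<lambda>S. z \<bullet> w S"] M.expand[of z] by simp
  finally show ?thesis by simp
qed

lemma embed_w: "S \<in> std (D - {x}) \<Longrightarrow> embed (w S) = v (S(x := card D))"
proof -
  assume S: "S \<in> std (D - {x})"
  have "embed (w S) = (\<Sum>S'\<in>std (D - {x}). if S' = S then v (S(x := card D)) else 0)"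
    unfolding embed_def
    by (rule sum.cong) (use M.orthonormal S in \<open>auto simp: orthonormal_on_def\<close>)
  then show ?thesis using S finite_std[OF M.ideal] by simp
qed

lemma v_top_tabs: "v ` top_tabs \<subseteq> range embed"
proof
  fix b assume "b \<in> v ` top_tabs"
  then obtain T where T: "T \<in> top_tabs" "b = v T" by blast
  then have "T \<in> (\<lambda>S. S(x := card D)) ` std (D - {x})"
    using bij_top_tabs by (simp add: bij_betw_def)
  then obtain S where "S \<in> std (D - {x})" "T = S(x := card D)" by blast
  then show "b \<in> range embed" using embed_w T by (metis rangeI)
qed

text \<open>Filling x with the largest entry does not move the smaller entries. Hence the content
  differences in Young's formula agree on both sides for every swap of entries below
  \<open>card D\<close>.\<close>

lemma embed_intertwines:
  assumes "g permutes {1..card D - 1}"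
  shows "embed \<circ> \<rho> g = \<pi> g \<circ> embed"
  using assms
proof (induction rule: permutes_adj_swap_induct)
  case id
  show ?case unfolding V.pi_id M.pi_id by simp
next
  case (comp g h)
  have "embed (\<rho> g z) = \<pi> g (embed z)" "embed (\<rho> h z) = \<pi> h (embed z)" for z
    using comp(3,4) by (simp_all add: fun_eq_iff)
  moreover have pgh: "\<pi> (g \<circ> h) = \<pi> g \<circ> \<pi> h"
    by (rule V.hom) (use comp(1,2) permutes_lift in auto)
  moreover have rgh: "\<rho> (g \<circ> h) = \<rho> g \<circ> \<rho> h"
    by (rule M.hom) (use comp(1,2) card_rem in auto)
  ultimately show ?case unfolding pgh rgh by (simp add: fun_eq_iff)
next
  case (adj k)
  have s: "adj_swap k permutes {1..card D - 1}" using adj permutes_adj_swap by auto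
  have lin: "linear (embed \<circ> \<rho> (adj_swap k))" "linear (\<pi> (adj_swap k) \<circ> embed)"
    using linear_compose[OF M.linear_pi linear_embed, of "adj_swap k"]
      linear_compose[OF linear_embed V.linear_pi[OF permutes_lift[OF s]]] s card_rem by auto
  show ?case
  proof
    fix z
    have z: "z \<in> span (w ` std (D - {x}))" using M.span_v by simp
    show "(embed \<circ> \<rho> (adj_swap k)) z = (\<pi> (adj_swap k) \<circ> embed) z"
    proof (rule linear_eq_on[OF lin z])
      fix b assume "b \<in> w ` std (D - {x})"
      then obtain S where S: "S \<in> std (D - {x})" "b = w S" by blast
      obtain y where y: "y \<in> D - {x}" "S y = k" using std_ex_box[OF S(1), of k] adj card_rem by auto
      obtain z where z: "z \<in> D - {x}" "S z = Suc k" using std_ex_box[OF S(1), of "Suc k"] adj card_rem by auto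
      let ?T = "S(x := card D)"
      let ?d = "real_of_int (content z - content y)"
      have eq: "(adj_swap k \<circ> S)(x := card D) = adj_swap k \<circ> ?T"
        using adj by (auto simp: fun_eq_iff Transposition.transpose_def)
      have "\<pi> (adj_swap k) (v ?T) = (1 / ?d) *\<^sub>R v ?T + sqrt (1 - 1 / ?d\<^sup>2) *\<^sub>R v (adj_swap k \<circ> ?T)"
        by (rule V.adj_swap_v[OF extend_in_std[OF S(1)]]) (use y z in auto)
      moreover have "\<rho> (adj_swap k) (w S) = (1 / ?d) *\<^sub>R w S + sqrt (1 - 1 / ?d\<^sup>2) *\<^sub>R w (adj_swap k \<circ> S)"
        by (rule M.adj_swap_v[OF S(1) y(1) z(1) y(2) z(2)])
      \<comment> \<open>For a non-standard filling \<open>embed_w\<close> says nothing, but there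
        the coefficient is 0.\<close>
      moreover have "sqrt (1 - 1 / ?d\<^sup>2) *\<^sub>R embed (w (adj_swap k \<circ> S)) = sqrt (1 - 1 / ?d\<^sup>2) *\<^sub>R v (adj_swap k \<circ> ?T)"
      proof (cases "adj_swap k \<circ> S \<in> std (D - {x})")
        case True
        then show ?thesis using embed_w[OF True] eq by simp
      next
        case False
        then have "\<bar>content z - content y\<bar> = 1"
          using consecutive_boxes[OF M.ideal S(1) y(1) z(1) y(2) z(2)] by auto
        then have "?d\<^sup>2 = 1" by (metis of_int_1 of_int_abs power2_abs power_one)
        then show ?thesis by simp
      qed
      ultimately show "(embed \<circ> \<rho> (adj_swap k)) b = (\<pi> (adj_swap k) \<circ> embed) b"
        using S embed_w[OF S(1)] by (simp add: linear_add[OF linear_embed] linear_scale[OF linear_embed])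
    qed
  qed
qed

text \<open>An intertwiner respects the Jucys-Murphy elements for k < \<open>card D\<close>, since
  these only involve the smaller group. If the image of \<open>w S\<close> had a component along
  \<open>v T\<close>, where T has its largest entry in z, then each smaller entry would have the
  same content in S and in T. Summing over these entries gives equal content sums of D without x and
  of D without z. So x and z have equal contents and, being corners, coincide.\<close>

lemma intertwiner_range:
  assumes lin: "linear \<Phi>" and int: "\<And>g. g permutes {1..card D - 1} \<Longrightarrow> \<Phi> \<circ> \<rho> g = \<pi> g \<circ> \<Phi>"
  shows "\<Phi> z \<in> span (v ` top_tabs)"
proof -
  have *: "\<Phi> (w S) \<bullet> v T = 0" if S: "S \<in> std (D - {x})" and T: "T \<in> std D" "T \<notin> top_tabs" for S T
  proof (rule ccontr)
    assume ne: "\<Phi> (w S) \<bullet> v T \<noteq> 0"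
    obtain z where z: "z \<in> D" "T z = card D" using std_ex_box[OF T(1) card_D] by auto
    have "T x \<noteq> card D" using T by (auto simp: top_tabs_def)
    then have zx: "z \<noteq> x" using z by auto
    have bS: "bij_betw S (D - {x}) {1..card D - 1}" using stdD(1)[OF S] card_rem by simp
    have bT: "bij_betw T (D - {z}) {1..card D - 1}"
    proof -
      have "T ` (D - {z}) = {1..card D} - {card D}"
        using inj_on_image_set_diff[OF stdD(2)[OF T(1)], of D "{z}"] stdD(3)[OF T(1)] z by auto
      then show ?thesis using stdD(2)[OF T(1)] unfolding bij_betw_def by (auto intro: inj_on_subset)
    qed
    have eqk: "content (inv_into (D - {x}) S k) = content (inv_into (D - {z}) T k)"
      if k: "k \<in> {1..card D - 1}" for k
    proof -
      define y where "y = inv_into (D - {x}) S k"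
      define u where "u = inv_into (D - {z}) T k"
      have y: "y \<in> D - {x}" "S y = k"
        using bS k unfolding y_def bij_betw_def by (auto intro!: inv_into_into f_inv_into_f simp del: Diff_iff)
      have u: "u \<in> D - {z}" "T u = k"
        using bT k unfolding u_def bij_betw_def by (auto intro!: inv_into_into f_inv_into_f simp del: Diff_iff)
      have "\<Phi> (\<rho> (Transposition.transpose i k) q) = \<pi> (Transposition.transpose i k) (\<Phi> q)"
        if "i \<in> {1..<k}" for i q
        using int[of "Transposition.transpose i k"] permutes_swap_id[of i "{1..card D - 1}" k] that k
        by (auto simp: fun_eq_iff)
      then have "\<Phi> (M.jucys_murphy k (w S)) = V.jucys_murphy k (\<Phi> (w S))"
        unfolding V.jucys_murphy_def M.jucys_murphy_def linear_sum[OF lin] by (intro sum.cong) auto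
      then have "\<Phi> (M.jucys_murphy k (w S)) \<bullet> v T = \<Phi> (w S) \<bullet> V.jucys_murphy k (v T)"
        using V.inner_jucys_murphy[of k] k by auto
      then have "content y * (\<Phi> (w S) \<bullet> v T) = content u * (\<Phi> (w S) \<bullet> v T)"
        using M.jucys_murphy_v[OF S y(1)] V.jucys_murphy_v[OF T(1), of u] y u
        by (simp add: linear_scale[OF lin])
      then show ?thesis using ne by (simp add: y_def u_def)
    qed
    have "(\<Sum>y\<in>D - {x}. content y) = (\<Sum>k\<in>{1..card D - 1}. content (inv_into (D - {x}) S k))"
      using sum_inv_into_bij_betw[OF bS, of content] by simp
    also have "\<dots> = (\<Sum>k\<in>{1..card D - 1}. content (inv_into (D - {z}) T k))"
      using eqk by (intro sum.cong) auto
    also have "\<dots> = (\<Sum>y\<in>D - {z}. content y)" by (rule sum_inv_into_bij_betw[OF bT])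
    finally have "content x = content z"
      using sum.remove[OF fin_D x_in, of content] sum.remove[OF fin_D z(1), of content] by simp
    then show False
      using corners_content_inj[OF x_corner std_max_corner[OF T(1) z]] zx by simp
  qed
  have "\<Phi> (w S) \<in> span (v ` top_tabs)" if S: "S \<in> std (D - {x})" for S
  proof (subst V.expand, rule span_sum)
    fix T assume "T \<in> std D"
    then show "(\<Phi> (w S) \<bullet> v T) *\<^sub>R v T \<in> span (v ` top_tabs)"
      using *[OF S, of T] by (cases "T \<in> top_tabs") (auto intro: span_scale span_base span_zero)
  qed
  then have "\<Phi> ` span (w ` std (D - {x})) \<subseteq> span (v ` top_tabs)"
    unfolding linear_span_image[OF lin, symmetric] by (intro span_minimal) auto
  then show ?thesis using M.span_v by auto
qed

lemma W_eq: "W = span (v ` top_tabs)"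
proof
  show "W \<subseteq> span (v ` top_tabs)"
    unfolding W_def isotypic_component_def
    by (intro span_minimal) (auto intro!: intertwiner_range)
  note v_top_tabs
  also have "range embed \<subseteq> W"
    unfolding W_def isotypic_component_def
    using linear_embed norm_embed embed_intertwines by (intro order_trans[OF _ span_superset]) blast
  finally show "span (v ` top_tabs) \<subseteq> W"
    using span_minimal[of "v ` top_tabs" W] unfolding W_def isotypic_component_def by simp
qed

lemma subspace_W: "subspace W" unfolding W_eq by simp

lemma dim_W: "dim W = card (std (D - {x}))"
  unfolding W_eq dim_span_orthonormal_on[OF orthonormal_top]
  using bij_betw_same_card[OF bij_top_tabs] by simp

lemma pi_W:
  assumes "h permutes {1..card D - 1}"
  shows "\<pi> h ` W = W"
proof -
  have sub: "\<pi> h ` W \<subseteq> W" if h: "h permutes {1..card D - 1}" for h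
  proof -
    have "\<pi> h ` (v ` top_tabs) \<subseteq> W"
    proof -
      have "\<pi> h (embed z) = embed (\<rho> h z)" for z
        using embed_intertwines[OF h] by (simp add: fun_eq_iff)
      then have "\<pi> h ` range embed \<subseteq> range embed" by auto
      moreover have "range embed \<subseteq> W"
        unfolding W_eq using intertwiner_range[OF linear_embed embed_intertwines] by auto
      ultimately show ?thesis using v_top_tabs by blast
    qed
    then have "span (\<pi> h ` (v ` top_tabs)) \<subseteq> W" using span_minimal subspace_W by blast
    then show ?thesis
      unfolding W_eq linear_span_image[OF V.linear_pi[OF permutes_lift[OF h]]] .
  qed
  show ?thesis
  proof
    show "W \<subseteq> \<pi> h ` W"
    proof
      fix z assume "z \<in> W"
      then have "\<pi> (inv h) z \<in> W" using sub[OF permutes_inv[OF assms]] by blast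
      then show "z \<in> \<pi> h ` W" using V.pi_inv(1)[OF permutes_lift[OF assms], of z] by (metis imageI)
    qed
  qed (rule sub[OF assms])
qed

text \<open>The swapped tableau has \<open>card D - 1\<close> in x, so its vector is orthogonal to
  W; for a non-standard filling the coefficient is 0. Only the diagonal term of Young's formula
  survives.\<close>

lemma proj_adj_swap:
  assumes "T \<in> top_tabs" "y \<in> D" "Suc (T y) = card D"
  shows "orth_proj W (\<pi> (adj_swap (card D - 1)) (v T)) = (1 / real_of_int (content x - content y)) *\<^sub>R v T"
proof -
  have T: "T \<in> std D" "T x = card D" using assms(1) by (auto simp: top_tabs_def)
  let ?k = "card D - 1"
  let ?d = "real_of_int (content x - content y)"
  have Ty: "T y = ?k" "T x = Suc ?k" using assms(3) T(2) by auto
  have act: "\<pi> (adj_swap ?k) (v T) = (1 / ?d) *\<^sub>R v T + sqrt (1 - 1 / ?d\<^sup>2) *\<^sub>R v (adj_swap ?k \<circ> T)"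
    by (rule V.adj_swap_v[OF T(1) assms(2) x_in Ty])
  have inn: "\<pi> (adj_swap ?k) (v T) \<bullet> v T' = (if T' = T then 1 / ?d else 0)" if T': "T' \<in> top_tabs" for T'
  proof -
    have T's: "T' \<in> std D" "T' x = card D" using T' by (auto simp: top_tabs_def)
    have "sqrt (1 - 1 / ?d\<^sup>2) * (v (adj_swap ?k \<circ> T) \<bullet> v T') = 0"
    proof (cases "adj_swap ?k \<circ> T \<in> std D")
      case True
      have "(adj_swap ?k \<circ> T) x = ?k" using Ty by simp
      then have "adj_swap ?k \<circ> T \<noteq> T'" using T's(2) card_D by auto
      then show ?thesis using V.orthonormal True T's by (auto simp: orthonormal_on_def)
    next
      case False
      then have "\<bar>content x - content y\<bar> = 1"
        using consecutive_boxes[OF V.ideal T(1) assms(2) x_in Ty] by auto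
      then have "?d\<^sup>2 = 1" by (metis of_int_1 of_int_abs power2_abs power_one)
      then show ?thesis by simp
    qed
    then show ?thesis
      unfolding act using V.orthonormal T(1) T's(1) by (auto simp: orthonormal_on_def inner_left_distrib)
  qed
  have "orth_proj W (\<pi> (adj_swap ?k) (v T)) = (\<Sum>T'\<in>top_tabs. (\<pi> (adj_swap ?k) (v T) \<bullet> v T') *\<^sub>R v T')"
    unfolding W_eq by (rule orth_proj_span[OF orthonormal_top])
  also have "\<dots> = (\<Sum>T'\<in>top_tabs. if T' = T then (1 / ?d) *\<^sub>R v T else 0)"
    by (rule sum.cong[OF refl], subst inn) auto
  also have "\<dots> = (1 / ?d) *\<^sub>R v T"
    using assms(1) orthonormal_top by (simp add: orthonormal_on_def)
  finally show ?thesis .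
qed

end

subsection \<open>The fusion frame\<close>

locale young_frame = young_restriction D x v \<pi> w \<rho>
  for D x and v :: "tableau \<Rightarrow> 'v::euclidean_space" and \<pi>
    and w :: "tableau \<Rightarrow> 'w::euclidean_space" and \<rho> +
  fixes t :: "nat \<Rightarrow> nat \<Rightarrow> nat"
  assumes t_permutes: "k \<in> {1..card D} \<Longrightarrow> t k permutes {1..card D}"
    and t_last: "k \<in> {1..card D} \<Longrightarrow> t k (card D) = k"
begin

definition Ws :: "nat \<Rightarrow> 'v set" where
  "Ws k = \<pi> (t k) ` W"

text \<open>Permutations with the same value at the last point differ by an element of its
  stabilizer, and that stabilizer preserves W. So the subspaces do not depend on the choice of the t
  k.\<close>

lemma pi_image_W:
  assumes "g permutes {1..card D}"
  shows "\<pi> g ` W = Ws (g (card D))"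
proof -
  let ?k = "g (card D)"
  have k: "?k \<in> {1..card D}" using permutes_in_image[OF assms] card_D by simp
  note tk = t_permutes[OF k]
  let ?h = "inv (t ?k) \<circ> g"
  have h: "?h permutes {1..card D}" by (rule permutes_compose[OF assms permutes_inv[OF tk]])
  moreover have "?h (card D) = card D" using t_last[OF k] permutes_inv_eq[OF tk] by simp
  moreover have "{1..card D} - {1..card D - 1} = {card D}" using card_D by auto
  ultimately have h': "?h permutes {1..card D - 1}"
    using permutes_superset[of ?h "{1..card D}" "{1..card D - 1}"] by auto
  have "g = t ?k \<circ> ?h" using permutes_inverses(1)[OF tk] by (simp add: fun_eq_iff)
  then have "\<pi> g = \<pi> (t ?k) \<circ> \<pi> ?h" using V.hom[OF tk h] by metis
  then have "\<pi> g ` W = \<pi> (t ?k) ` (\<pi> ?h ` W)" by (simp add: image_comp)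
  then show ?thesis using pi_W[OF h'] by (simp add: Ws_def)
qed

lemma pi_image_Ws:
  assumes "g permutes {1..card D}" "k \<in> {1..card D}"
  shows "\<pi> g ` Ws k = Ws (g k)"
proof -
  have "\<pi> g ` Ws k = \<pi> (g \<circ> t k) ` W"
    unfolding Ws_def V.hom[OF assms(1) t_permutes[OF assms(2)]] by (simp add: image_comp)
  also have "\<dots> = Ws ((g \<circ> t k) (card D))"
    by (rule pi_image_W[OF permutes_compose[OF t_permutes[OF assms(2)] assms(1)]])
  finally show ?thesis using t_last[OF assms(2)] by simp
qed

lemma subspace_Ws: "k \<in> {1..card D} \<Longrightarrow> subspace (Ws k)"
  unfolding Ws_def using linear_subspace_image[OF V.linear_pi[OF t_permutes] subspace_W] .

lemma dim_Ws: "k \<in> {1..card D} \<Longrightarrow> dim (Ws k) = dim W"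
  unfolding Ws_def
  by (rule dim_image_eq[OF V.linear_pi[OF t_permutes]])
    (auto intro: inj_on_subset[OF orthogonal_transformation_inj[OF V.orth[OF t_permutes]]])

lemma totally_symmetric_Ws: "totally_symmetric {1..card D} Ws"
  unfolding totally_symmetric_def automorphisms_def
  using V.orth pi_image_Ws by blast

text \<open>The group permutes the subspaces, so the sum of the projections commutes with its action
  and is a scalar by \<open>schur\<close>.\<close>

lemma tight_fusion_frame_Ws: "tight_fusion_frame (dim W) {1..card D} Ws"
proof -
  define A where "A z = (\<Sum>k\<in>{1..card D}. orth_proj (Ws k) z)" for z
  have "linear A"
    unfolding A_def[abs_def] by (intro linear_compose_sum ballI linear_orth_proj subspace_Ws)
  moreover have "A (\<pi> g z) = \<pi> g (A z)" if g: "g permutes {1..card D}" for g z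
  proof -
    have "\<pi> g (A z) = (\<Sum>k\<in>{1..card D}. orth_proj (Ws (g k)) (\<pi> g z))"
      unfolding A_def linear_sum[OF V.linear_pi[OF g]]
    proof (rule sum.cong)
      fix k assume k: "k \<in> {1..card D}"
      show "\<pi> g (orth_proj (Ws k) z) = orth_proj (Ws (g k)) (\<pi> g z)"
        using orth_proj_orthogonal_transformation[OF subspace_Ws[OF k] V.orth[OF g]]
          pi_image_Ws[OF g k] by simp
    qed simp
    also have "\<dots> = A (\<pi> g z)"
      unfolding A_def using sum.permute[OF g, of "\<lambda>k. orth_proj (Ws k) (\<pi> g z)"] by (simp add: o_def)
    finally show ?thesis ..
  qed
  ultimately obtain c where "\<And>z. A z = c *\<^sub>R z" using V.schur by metis
  then show ?thesis
    unfolding tight_fusion_frame_def using subspace_Ws dim_Ws by (auto simp: A_def)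
qed

text \<open>The model for the relative position of two subspaces: on W it is, up to orthogonal
  identifications, the projection from any one of them to any other.\<close>

definition compress :: "'v \<Rightarrow> 'v" where
  "compress z = orth_proj W (\<pi> (adj_swap (card D - 1)) z)"

text \<open>Write the inverse of \<open>t k\<close> times \<open>t l\<close> as h' s h, with s the
  last adjacent swap and h, h' fixing the last point. Then g is \<open>t k\<close> times h'; it
  still maps W onto \<open>Ws k\<close>, and orthogonal maps carry projections to
  projections.\<close>

lemma orth_proj_Ws:
  assumes "k \<in> {1..card D}" "l \<in> {1..card D}" "k \<noteq> l" "2 \<le> card D"
  obtains g h where "g permutes {1..card D}" "h permutes {1..card D - 1}"
    "\<And>z. orth_proj (Ws k) (\<pi> (t l) z) = \<pi> g (compress (\<pi> h z))"
proof -
  note tk = t_permutes[OF assms(1)] and tl = t_permutes[OF assms(2)]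
  let ?s = "adj_swap (card D - 1)"
  have p: "inv (t k) \<circ> t l permutes {1..card D}" by (rule permutes_compose[OF tl permutes_inv[OF tk]])
  moreover have "(inv (t k) \<circ> t l) (card D) \<noteq> card D"
    using t_last[OF assms(1)] t_last[OF assms(2)] assms(3) permutes_inv_eq[OF tk] by auto
  ultimately obtain h' h where h: "h' permutes {1..card D - 1}" "h permutes {1..card D - 1}"
    and eq: "inv (t k) \<circ> t l = h' \<circ> ?s \<circ> h"
    using permutes_factor_adj_swap assms(4) by metis
  have s: "?s permutes {1..card D}" by (rule permutes_swap_id) (use assms(4) in auto)
  note h1 = permutes_lift[OF h(1)] permutes_lift[OF h(2)]
  have g: "t k \<circ> h' permutes {1..card D}" by (rule permutes_compose[OF h1(1) tk])
  have gW: "\<pi> (t k \<circ> h') ` W = Ws k"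
    unfolding V.hom[OF tk h1(1)] image_comp[symmetric] pi_W[OF h(1)] Ws_def ..
  have "t l = t k \<circ> (inv (t k) \<circ> t l)" using permutes_inverses(1)[OF tk] by (simp add: fun_eq_iff)
  also have "\<dots> = (t k \<circ> h') \<circ> (?s \<circ> h)" unfolding eq by (simp add: o_assoc)
  finally have tl_eq: "t l = (t k \<circ> h') \<circ> (?s \<circ> h)" .
  have "\<pi> (t l) z = \<pi> (t k \<circ> h') (\<pi> ?s (\<pi> h z))" for z
    unfolding tl_eq V.hom[OF g permutes_compose[OF h1(2) s]] V.hom[OF s h1(2)] by simp
  then have "orth_proj (Ws k) (\<pi> (t l) z) = \<pi> (t k \<circ> h') (compress (\<pi> h z))" for z
    unfolding compress_def gW[symmetric]
    using orth_proj_orthogonal_transformation[OF subspace_W V.orth[OF g]] by simp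
  then show ?thesis using that g h(2) by blast
qed

lemma equi_chordal_Ws:
  assumes "2 \<le> card D"
  shows "equi_chordal (dim W) {1..card D} Ws"
proof -
  let ?r = "dim W" and ?s = "adj_swap (card D - 1)"
  obtain B where B: "isometry_onto ?r B W" using ex_isometry_onto[OF subspace_W] .
  then have B': "orthonormal_on {..<?r} B" "span (B ` {..<?r}) = W" by (auto simp: isometry_onto_iff)
  have image: "isometry_onto ?r (\<lambda>i. \<pi> g (B i)) (\<pi> g ` W)" if g: "g permutes {1..card D}" for g
    using B V.inner_pi[OF g] linear_span_image[OF V.linear_pi[OF g], of "B ` {..<?r}"]
    by (simp add: isometry_onto_def image_image)
  have norm_proj: "(\<Sum>i<?r. (y \<bullet> e i)\<^sup>2) = (norm (orth_proj U y))\<^sup>2" if "isometry_onto ?r e U" for e U y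
    using that norm_orth_proj_span[of "{..<?r}" e y] by (auto simp: isometry_onto_iff)
  define \<Phi> where "\<Phi> k i = \<pi> (t k) (B i)" for k i
  have \<Phi>: "isometry_onto ?r (\<Phi> k) (Ws k)" if "k \<in> {1..card D}" for k
    unfolding \<Phi>_def[abs_def] Ws_def using image[OF t_permutes[OF that]] .
  have "frobenius_norm ?r (cross_gram (\<Phi> k) (\<Phi> l)) = sqrt (\<Sum>i<?r. (norm (compress (B i)))\<^sup>2)"
    if kl: "k \<in> {1..card D}" "l \<in> {1..card D}" "k \<noteq> l" for k l
  proof -
    obtain g h where g: "g permutes {1..card D}" and h: "h permutes {1..card D - 1}"
      and eq: "\<And>z. orth_proj (Ws k) (\<pi> (t l) z) = \<pi> g (compress (\<pi> h z))"
      using orth_proj_Ws[OF kl assms] by blast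
    note h1 = permutes_lift[OF h]
    have "(\<Sum>i<?r. \<Sum>j<?r. (\<Phi> k i \<bullet> \<Phi> l j)\<^sup>2) = (\<Sum>j<?r. \<Sum>i<?r. (\<Phi> l j \<bullet> \<Phi> k i)\<^sup>2)"
      by (subst sum.swap) (simp add: inner_commute)
    also have "\<dots> = (\<Sum>j<?r. (norm (orth_proj (Ws k) (\<Phi> l j)))\<^sup>2)"
      using norm_proj[OF \<Phi>[OF kl(1)]] by simp
    also have "\<dots> = (\<Sum>j<?r. (norm (compress (\<pi> h (B j))))\<^sup>2)"
      unfolding \<Phi>_def eq using orthogonal_transformation_norm[OF V.orth[OF g]] by simp
    also have "\<dots> = (\<Sum>j<?r. \<Sum>i<?r. (\<pi> ?s (\<pi> h (B j)) \<bullet> B i)\<^sup>2)"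
      unfolding compress_def norm_proj[OF B] ..
    \<comment> \<open>The swap is self-adjoint, so it can be moved to the other argument. What
      remains of h is a change of orthonormal basis in W, which does not alter a sum of squared
      coordinates.\<close>
    also have "\<dots> = (\<Sum>i<?r. \<Sum>j<?r. (\<pi> ?s (B i) \<bullet> \<pi> h (B j))\<^sup>2)"
      by (subst sum.swap) (use V.inner_pi_transpose[of "card D - 1" "Suc (card D - 1)"] assms
          in \<open>simp add: inner_commute\<close>)
    also have "\<dots> = (\<Sum>i<?r. (norm (compress (B i)))\<^sup>2)"
      using norm_proj[OF image[OF h1]] pi_W[OF h] by (simp add: compress_def)
    finally show ?thesis by (simp add: frobenius_norm_def cross_gram_def)
  qed
  then show ?thesis unfolding equi_chordal_def using \<Phi> by blast
qed

lemma linear_compress: "2 \<le> card D \<Longrightarrow> linear compress"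
  unfolding compress_def[abs_def]
  using linear_compose[OF V.linear_pi linear_orth_proj[OF subspace_W], of "adj_swap (card D - 1)"]
    permutes_swap_id[of "card D - 1" "{1..card D}" "Suc (card D - 1)"] by (simp add: o_def)

lemma equi_isoclinic_iff_compress:
  assumes "2 \<le> card D"
  shows "equi_isoclinic (dim W) {1..card D} Ws \<longleftrightarrow>
    (\<exists>\<alpha>. \<forall>y\<in>W. \<forall>z\<in>W. compress y \<bullet> compress z = \<alpha> * (y \<bullet> z))"
proof -
  have pair: "(\<forall>y\<in>Ws l. \<forall>z\<in>Ws l. orth_proj (Ws k) y \<bullet> orth_proj (Ws k) z = \<alpha> * (y \<bullet> z)) \<longleftrightarrow>
      (\<forall>y\<in>W. \<forall>z\<in>W. compress y \<bullet> compress z = \<alpha> * (y \<bullet> z))"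
    if kl: "k \<in> {1..card D}" "l \<in> {1..card D}" "k \<noteq> l" for k l \<alpha>
  proof -
    obtain g h where g: "g permutes {1..card D}" and h: "h permutes {1..card D - 1}"
      and eq: "\<And>z. orth_proj (Ws k) (\<pi> (t l) z) = \<pi> g (compress (\<pi> h z))"
      using orth_proj_Ws[OF kl assms] by blast
    have "(\<forall>y\<in>Ws l. \<forall>z\<in>Ws l. orth_proj (Ws k) y \<bullet> orth_proj (Ws k) z = \<alpha> * (y \<bullet> z)) \<longleftrightarrow>
        (\<forall>y\<in>W. \<forall>z\<in>W. compress (\<pi> h y) \<bullet> compress (\<pi> h z) = \<alpha> * (\<pi> h y \<bullet> \<pi> h z))"
      unfolding Ws_def[of l]
      by (simp add: eq V.inner_pi[OF g] V.inner_pi[OF t_permutes[OF kl(2)]] V.inner_pi[OF permutes_lift[OF h]])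
    also have "\<dots> \<longleftrightarrow> (\<forall>y\<in>\<pi> h ` W. \<forall>z\<in>\<pi> h ` W. compress y \<bullet> compress z = \<alpha> * (y \<bullet> z))"
      by simp
    finally show ?thesis unfolding pi_W[OF h] .
  qed
  have "(\<forall>k\<in>{1..card D}. \<forall>l\<in>{1..card D}. k \<noteq> l \<longrightarrow>
      (\<forall>y\<in>Ws l. \<forall>z\<in>Ws l. orth_proj (Ws k) y \<bullet> orth_proj (Ws k) z = \<alpha> * (y \<bullet> z))) \<longleftrightarrow>
      (\<forall>y\<in>W. \<forall>z\<in>W. compress y \<bullet> compress z = \<alpha> * (y \<bullet> z))" (is "?L \<longleftrightarrow> ?R") for \<alpha>
  proof
    assume L: ?L
    \<comment> \<open>With two distinct indices the condition over pairs is not vacuous.\<close>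
    have "1 \<in> {1..card D}" "2 \<in> {1..card D}" "(1::nat) \<noteq> 2" using assms by auto
    then show ?R using L pair[of 1 2 \<alpha>] by blast
  next
    assume ?R
    then show ?L using pair by blast
  qed
  then show ?thesis
    using equi_isoclinic_iff[of "{1..card D}" Ws "dim W", OF subspace_Ws dim_Ws] by simp
qed

text \<open>Guarantees that each corner of the smaller shape contributes an eigenvalue of
  \<open>compress\<close>, as needed to pass from equi-isoclinic to equal distances.\<close>

lemma top_tabs_second_corner:
  assumes "2 \<le> card D" "y \<in> corners (D - {x})"
  obtains T where "T \<in> top_tabs" "Suc (T y) = card D"
proof -
  have y: "y \<in> D" "y \<noteq> x" using assms(2) corners_subset by blast+
  obtain R where R: "R \<in> std (D - {x} - {y})"
    using std_nonempty[OF young_ideal_remove[OF M.ideal assms(2)]] by blast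
  have "R(y := card (D - {x})) \<in> std (D - {x})"
    using std_extend[OF R assms(2)] fin_D by simp
  then have "R(y := card D - 1, x := card D) \<in> top_tabs"
    using extend_in_std card_rem by (auto simp: top_tabs_def)
  then show ?thesis using that y(2) assms(1) by fastforce
qed

lemma equi_isoclinic_iff_contents:
  assumes "2 \<le> card D"
  shows "equi_isoclinic (dim W) {1..card D} Ws \<longleftrightarrow>
    (\<exists>d. \<forall>y\<in>corners (D - {x}). \<bar>content x - content y\<bar> = d)"
proof -
  \<comment> \<open>Valid also when a or b is 0, because 1 / 0 = 0.\<close>
  have sq: "(1 / real_of_int a) * (1 / real_of_int a) = (1 / real_of_int b) * (1 / real_of_int b) \<longleftrightarrow> \<bar>a\<bar> = \<bar>b\<bar>" for a b
  proof -
    have "(1 / real_of_int a) * (1 / real_of_int a) = (1 / real_of_int b) * (1 / real_of_int b)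
        \<longleftrightarrow> \<bar>1 / real_of_int a\<bar> = \<bar>1 / real_of_int b\<bar>"
      unfolding power2_eq_square[symmetric] power2_eq_iff abs_eq_iff ..
    also have "\<dots> \<longleftrightarrow> \<bar>real_of_int a\<bar> = \<bar>real_of_int b\<bar>" by (simp add: abs_divide)
    also have "\<dots> \<longleftrightarrow> \<bar>a\<bar> = \<bar>b\<bar>" by linarith
    finally show ?thesis .
  qed
  note lin = linear_compress[OF assms]
  show ?thesis
    unfolding equi_isoclinic_iff_compress[OF assms]
  proof
    assume "\<exists>\<alpha>. \<forall>y\<in>W. \<forall>z\<in>W. compress y \<bullet> compress z = \<alpha> * (y \<bullet> z)"
    then obtain \<alpha> where \<alpha>: "\<And>y z. y \<in> W \<Longrightarrow> z \<in> W \<Longrightarrow> compress y \<bullet> compress z = \<alpha> * (y \<bullet> z)" by blast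
    have \<alpha>y: "(1 / real_of_int (content x - content y)) * (1 / real_of_int (content x - content y)) = \<alpha>"
      if y: "y \<in> corners (D - {x})" for y
    proof -
      obtain T where T: "T \<in> top_tabs" "Suc (T y) = card D" using top_tabs_second_corner[OF assms y] .
      have 1: "v T \<bullet> v T = 1" using orthonormal_top T by (simp add: orthonormal_on_def)
      have "v T \<in> W" unfolding W_eq using T by (simp add: span_base)
      moreover have "compress (v T) = (1 / real_of_int (content x - content y)) *\<^sub>R v T"
        unfolding compress_def by (rule proj_adj_swap) (use T y corners_subset in blast)+
      ultimately show ?thesis using \<alpha>[of "v T" "v T"] 1 by simp
    qed
    show "\<exists>d. \<forall>y\<in>corners (D - {x}). \<bar>content x - content y\<bar> = d"
    proof (cases "corners (D - {x}) = {}")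
      case False
      then obtain y0 where "y0 \<in> corners (D - {x})" by blast
      then have "\<forall>y\<in>corners (D - {x}). \<bar>content x - content y\<bar> = \<bar>content x - content y0\<bar>"
        using \<alpha>y sq by metis
      then show ?thesis by blast
    qed simp
  next
    assume "\<exists>d. \<forall>y\<in>corners (D - {x}). \<bar>content x - content y\<bar> = d"
    then obtain d where d: "\<And>y. y \<in> corners (D - {x}) \<Longrightarrow> \<bar>content x - content y\<bar> = d" by blast
    have ct: "\<exists>e. compress (v T) = e *\<^sub>R v T \<and> e * e = (1 / real_of_int d) * (1 / real_of_int d)"
      if T: "T \<in> top_tabs" for T
    proof -
      have Ts: "T \<in> std D" "T x = card D" using T by (auto simp: top_tabs_def)
      obtain y where y: "y \<in> D" "T y = card D - 1" using std_ex_box[OF Ts(1), of "card D - 1"] assms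
        by (metis Nat.le_diff_conv2 add_leD1 diff_le_self one_add_one)
      have yx: "y \<noteq> x" using y Ts assms by auto
      have "y \<in> corners (D - {x})"
        using std_max_corner[OF std_restrict[OF Ts(1) x_in Ts(2) fin_D], of y] y yx card_rem by simp
      \<comment> \<open>Since a corner exists, d is itself an absolute value; the bars give the form
        required by \<open>sq\<close>.\<close>
      then have "\<bar>content x - content y\<bar> = \<bar>d\<bar>" using d by fastforce
      then have "(1 / real_of_int (content x - content y)) * (1 / real_of_int (content x - content y))
          = (1 / real_of_int d) * (1 / real_of_int d)"
        by (simp only: sq)
      moreover have "compress (v T) = (1 / real_of_int (content x - content y)) *\<^sub>R v T"
        unfolding compress_def by (rule proj_adj_swap[OF T y(1)]) (use y(2) assms in simp)
      ultimately show ?thesis by blast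
    qed
    let ?\<alpha> = "(1 / real_of_int d) * (1 / real_of_int d)"
    have "compress y \<bullet> compress z = ?\<alpha> * (y \<bullet> z)" if "y \<in> W" "z \<in> W" for y z
    proof (rule bilinear_eq[where f = "\<lambda>y z. compress y \<bullet> compress z" and g = "\<lambda>y z. ?\<alpha> * (y \<bullet> z)"
          and S = W and T = W and B = "v ` top_tabs" and C = "v ` top_tabs"])
      show "bilinear (\<lambda>y z. compress y \<bullet> compress z)"
        by (rule bilinear_linear_inner[OF lin])
      show "bilinear (\<lambda>y z. ?\<alpha> * (y \<bullet> z))"
        by (rule bilinear_scaled_inner)
      show "W \<subseteq> span (v ` top_tabs)" "W \<subseteq> span (v ` top_tabs)" using W_eq by auto
      fix a b assume "a \<in> v ` top_tabs" "b \<in> v ` top_tabs"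
      then obtain T T' where T: "T \<in> top_tabs" "T' \<in> top_tabs" "a = v T" "b = v T'" by blast
      obtain e where e: "compress (v T) = e *\<^sub>R v T" "e * e = ?\<alpha>" using ct[OF T(1)] by blast
      obtain e' where e': "compress (v T') = e' *\<^sub>R v T'" using ct[OF T(2)] by blast
      show "compress a \<bullet> compress b = ?\<alpha> * (a \<bullet> b)"
      proof (cases "T = T'")
        case True
        have "v T \<bullet> v T = 1" using orthonormal_top T by (simp add: orthonormal_on_def)
        then show ?thesis unfolding T(3,4) True[symmetric] using e by simp
      next
        case False
        then have "v T \<bullet> v T' = 0" using orthonormal_top T by (simp add: orthonormal_on_def)
        then show ?thesis unfolding T(3,4) e(1) e' by simp
      qed
    qed (use that in auto)
    then show "\<exists>\<alpha>. \<forall>y\<in>W. \<forall>z\<in>W. compress y \<bullet> compress z = \<alpha> * (y \<bullet> z)" by blast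
  qed
qed

end

subsection \<open>Vandermonde products\<close>

text \<open>The left-hand side is the divided difference of order m. The products in Lagrange's
  interpolation formula are monic of degree m, so their weights add up to the top
  coefficient.\<close>

lemma coeff_eq_lagrange:
  fixes x :: "nat \<Rightarrow> real"
  assumes "inj_on x {..<Suc m}" "degree p \<le> m"
  shows "(\<Sum>i<Suc m. poly p (x i) / (\<Prod>j\<in>{..<Suc m} - {i}. x i - x j)) = coeff p m"
proof -
  define L where "L i = (\<Prod>j\<in>{..<Suc m} - {i}. [:- x j, 1:])" for i
  define c where "c i = poly p (x i) / (\<Prod>j\<in>{..<Suc m} - {i}. x i - x j)" for i
  define q where "q = (\<Sum>i<Suc m. smult (c i) (L i))"
  have card: "card ({..<Suc m} - {i}) = m" if "i < Suc m" for i using that by simp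
  have degL: "degree (L i) = m" if "i < Suc m" for i
    unfolding L_def by (subst degree_prod_sum_eq) (use card[OF that] in auto)
  have cL: "coeff (L i) m = 1" if "i < Suc m" for i
  proof -
    have "lead_coeff (L i) = 1" unfolding L_def lead_coeff_prod by simp
    then show ?thesis using degL[OF that] by simp
  qed
  have "degree q \<le> m"
    unfolding q_def by (rule degree_sum_le) (auto intro: order_trans[OF degree_smult_le] simp: degL)
  moreover have "poly p (x i) = poly q (x i)" if i: "i < Suc m" for i
  proof -
    have "poly (L k) (x i) = 0" if "k < Suc m" "k \<noteq> i" for k
      unfolding L_def poly_prod using i that by (intro prod_zero) auto
    then have "poly q (x i) = (\<Sum>k<Suc m. if k = i then c i * poly (L i) (x i) else 0)"
      unfolding q_def poly_sum by (intro sum.cong) auto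
    also have "\<dots> = c i * (\<Prod>j\<in>{..<Suc m} - {i}. x i - x j)"
      using i by (simp add: L_def poly_prod)
    also have "\<dots> = poly p (x i)"
    proof -
      have "(\<Prod>j\<in>{..<Suc m} - {i}. x i - x j) \<noteq> 0"
        using assms(1) i by (auto simp: inj_on_def)
      then show ?thesis by (simp add: c_def)
    qed
    finally show ?thesis ..
  qed
  ultimately have "p = q"
    using assms by (intro poly_eqI_degree[of "x ` {..<Suc m}"]) (auto simp: card_image)
  have "coeff q m = (\<Sum>i<Suc m. c i)"
    unfolding q_def coeff_sum by (rule sum.cong) (auto simp: cL)
  then show ?thesis using \<open>p = q\<close> by (simp add: c_def)
qed

text \<open>Up to sign these are the elementary symmetric functions of degrees 0, 1 and 2. The last
  is a sum nested by the larger index, so that a further factor adds one summand.\<close>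

lemma
  fixes x :: "nat \<Rightarrow> real"
  shows coeff_prod_linear_0: "coeff (\<Prod>j<m. [:- x j, 1:]) m = 1"
    and coeff_prod_linear_1: "coeff (\<Prod>j<Suc m. [:- x j, 1:]) m = - (\<Sum>j<Suc m. x j)"
    and coeff_prod_linear_2:
      "coeff (\<Prod>j<Suc (Suc m). [:- x j, 1:]) m = (\<Sum>j<Suc (Suc m). x j * (\<Sum>i<j. x i))"
proof -
  let ?Q = "\<lambda>m. \<Prod>j<m. [:- x j, 1:]"
  have step: "coeff (?Q (Suc m)) (Suc k) = coeff (?Q m) k - x m * coeff (?Q m) (Suc k)" for m k
    by (simp add: mult_pCons_right)
  have step0: "coeff (?Q (Suc m)) 0 = - x m * coeff (?Q m) 0" for m
    by (simp add: mult_pCons_right)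
  have "degree (?Q m) = m" for m by (subst degree_prod_sum_eq) auto
  then have z: "coeff (?Q m) (Suc m) = 0" for m by (simp add: coeff_eq_0)
  have c0: "coeff (?Q m) m = 1" for m
    by (induction m) (simp_all only: step z, simp_all)
  have c1: "coeff (?Q (Suc m)) m = - (\<Sum>j<Suc m. x j)" for m
  proof (induction m)
    case 0 show ?case unfolding step0 by simp
  next
    case (Suc m)
    show ?case
      unfolding step[of "Suc m"] c0[of "Suc m"] Suc.IH sum.lessThan_Suc[of _ "Suc m"] by simp
  qed
  have c2: "coeff (?Q (Suc (Suc m))) m = (\<Sum>j<Suc (Suc m). x j * (\<Sum>i<j. x i))" for m
  proof (induction m)
    case 0 show ?case unfolding step0 by simp
  next
    case (Suc m)
    show ?case
      unfolding step[of "Suc (Suc m)"] c1[of "Suc m"] Suc.IH sum.lessThan_Suc[of _ "Suc (Suc m)"]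
      by (simp add: algebra_simps)
  qed
  show "coeff (?Q m) m = 1" by (rule c0)
  show "coeff (?Q (Suc m)) m = - (\<Sum>j<Suc m. x j)" by (rule c1)
  show "coeff (?Q (Suc (Suc m))) m = (\<Sum>j<Suc (Suc m). x j * (\<Sum>i<j. x i))" by (rule c2)
qed

text \<open>With \<open>Q = \<Prod>\<^sub>j (z - x\<^sub>j)\<close>, the polynomial \<open>z (Q(z - 1) - Q(z)) + m Q(z)\<close> has degree less
  than \<open>m\<close>, and its values at the nodes are the numerators below, up to sign.\<close>

lemma sum_shifted_ratios:
  fixes x :: "nat \<Rightarrow> real"
  assumes "inj_on x {..<m}"
  shows "(\<Sum>i<m. x i * (\<Prod>j\<in>{..<m} - {i}. (x i - 1 - x j) / (x i - x j)))
    = (\<Sum>i<m. x i) - real m * (real m - 1) / 2"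
proof (cases "m < 2")
  case True
  then consider "m = 0" | "m = 1" by linarith
  then show ?thesis by cases (simp_all add: lessThan_Suc)
next
  case False
  then have "m = Suc (Suc (m - 2))" by simp
  then obtain k where m: "m = Suc (Suc k)" by blast
  define Q where "Q = (\<Prod>j<m. [:- x j, 1:])"
  define R where "R = (\<Prod>j<m. [:- (x j + 1), 1:])"
  define f where "f = pCons 0 (R - Q) + smult (real m) Q"
  have degQ: "degree Q = m" "degree R = m" unfolding Q_def R_def by (subst degree_prod_sum_eq; simp)+
  have Qc: "coeff Q m = 1" "coeff Q (Suc k) = - (\<Sum>j<m. x j)"
      "coeff Q k = (\<Sum>j<m. x j * (\<Sum>i<j. x i))"
    unfolding Q_def m by (rule coeff_prod_linear_0 coeff_prod_linear_1 coeff_prod_linear_2)+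
  have Rc: "coeff R m = 1" "coeff R (Suc k) = - (\<Sum>j<m. x j + 1)"
      "coeff R k = (\<Sum>j<m. (x j + 1) * (\<Sum>i<j. x i + 1))"
    unfolding R_def m by (rule coeff_prod_linear_0 coeff_prod_linear_1 coeff_prod_linear_2)+
  \<comment> \<open>The change of the second elementary symmetric function when all arguments grow
    by 1.\<close>
  have e2: "(\<Sum>j<q. (x j + 1) * (\<Sum>i<j. x i + 1)) - (\<Sum>j<q. x j * (\<Sum>i<j. x i))
      = (real q - 1) * (\<Sum>j<q. x j) + real q * (real q - 1) / 2" for q
    by (induction q) (auto simp: sum.distrib field_simps)
  \<comment> \<open>In \<open>R - Q\<close> the leading terms cancel and -m z^(m - 1) remains;
    multiplied by z, this cancels the leading term of m Q.\<close>
  have "degree f \<le> Suc k"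
  proof (rule degree_le, intro allI impI)
    fix i assume i: "Suc k < i"
    then obtain i' where i': "i = Suc i'" "i' \<ge> Suc k" by (cases i) auto
    show "coeff f i = 0"
    proof (cases "i' = Suc k")
      case True
      then have "coeff f i = coeff R (Suc k) - coeff Q (Suc k) + real m * coeff Q m"
        using i' m by (simp add: f_def)
      then show ?thesis using Qc Rc by (simp add: sum.distrib)
    next
      case False
      then have "i' \<ge> m" using i' m by auto
      then have "coeff Q i' = coeff R i'" using Qc Rc coeff_eq_0[of Q i'] coeff_eq_0[of R i'] degQ
        by (cases "i' = m") auto
      moreover have "coeff Q i = 0" using coeff_eq_0[of Q i] degQ i' \<open>i' \<ge> m\<close> by simp
      ultimately show ?thesis using i' by (simp add: f_def)
    qed
  qed
  from coeff_eq_lagrange[OF _ this, of x] assms m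
  have "(\<Sum>i<m. poly f (x i) / (\<Prod>j\<in>{..<m} - {i}. x i - x j)) = coeff f (Suc k)" by simp
  also have "coeff f (Suc k) = coeff R k - coeff Q k + real m * coeff Q (Suc k)"
    by (simp add: f_def)
  also have "\<dots> = real m * (real m - 1) / 2 - (\<Sum>i<m. x i)"
    using e2[of m] Qc Rc by (simp add: algebra_simps)
  finally have sum: "(\<Sum>i<m. poly f (x i) / (\<Prod>j\<in>{..<m} - {i}. x i - x j))
      = real m * (real m - 1) / 2 - (\<Sum>i<m. x i)" .
  have "x i * (\<Prod>j\<in>{..<m} - {i}. (x i - 1 - x j) / (x i - x j))
      = - (poly f (x i) / (\<Prod>j\<in>{..<m} - {i}. x i - x j))" if i: "i < m" for i
  proof -
    have "poly Q (x i) = 0" unfolding Q_def poly_prod using i by (intro prod_zero) auto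
    \<comment> \<open>The factor with j = i equals -1, the source of the sign.\<close>
    moreover have "poly R (x i) = - (\<Prod>j\<in>{..<m} - {i}. x i - 1 - x j)"
    proof -
      have "poly R (x i) = (\<Prod>j<m. x i - 1 - x j)"
        unfolding R_def poly_prod by (rule prod.cong) auto
      also have "\<dots> = (x i - 1 - x i) * (\<Prod>j\<in>{..<m} - {i}. x i - 1 - x j)"
        using i by (intro prod.remove) auto
      finally show ?thesis by simp
    qed
    ultimately show ?thesis by (simp add: f_def prod_dividef)
  qed
  then have "(\<Sum>i<m. x i * (\<Prod>j\<in>{..<m} - {i}. (x i - 1 - x j) / (x i - x j)))
      = - (\<Sum>i<m. poly f (x i) / (\<Prod>j\<in>{..<m} - {i}. x i - x j))"
    unfolding sum_negf[symmetric] by (intro sum.cong) auto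
  then show ?thesis using sum by simp
qed

text \<open>The sign convention makes the product positive on strictly decreasing sequences, such as
  the shifted row lengths.\<close>

definition vandermonde :: "nat \<Rightarrow> (nat \<Rightarrow> real) \<Rightarrow> real" where
  "vandermonde m x = (\<Prod>j<m. \<Prod>i<j. x i - x j)"

lemma vandermonde_cong: "(\<And>i. i < m \<Longrightarrow> x i = y i) \<Longrightarrow> vandermonde m x = vandermonde m y"
  unfolding vandermonde_def by (intro prod.cong) auto

text \<open>The constant E is independent of y: it collects the signs and the factors without index
  k, and it cancels in the quotient formed in \<open>vandermonde_update\<close>.\<close>

lemma vandermonde_update_ex:
  assumes "k < m"
  shows "\<exists>E. \<forall>y. vandermonde m (x(k := y)) = E * (\<Prod>j\<in>{..<m} - {k}. y - x j)"
  using assms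
proof (induction m)
  case (Suc m)
  have step: "vandermonde (Suc m) z = vandermonde m z * (\<Prod>i<m. z i - z m)" for z
    by (simp add: vandermonde_def)
  show ?case
  proof (cases "k = m")
    case True
    have "vandermonde (Suc m) (x(k := y)) = (vandermonde m x * (-1) ^ m) * (\<Prod>j\<in>{..<Suc m} - {k}. y - x j)" for y
    proof -
      have "vandermonde m (x(k := y)) = vandermonde m x" using True by (intro vandermonde_cong) auto
      moreover have "(\<Prod>i<m. (x(k := y)) i - (x(k := y)) m) = (\<Prod>i<m. (-1) * (y - x i))"
        using True by (intro prod.cong) auto
      moreover have "{..<Suc m} - {k} = {..<m}" using True by auto
      ultimately show ?thesis unfolding step prod.distrib by simp
    qed
    then show ?thesis by blast
  next
    case False
    then have k: "k < m" using Suc by simp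
    then obtain E where E: "\<And>y. vandermonde m (x(k := y)) = E * (\<Prod>j\<in>{..<m} - {k}. y - x j)"
      using Suc by blast
    have "vandermonde (Suc m) (x(k := y))
        = (E * (\<Prod>i\<in>{..<m} - {k}. x i - x m)) * (\<Prod>j\<in>{..<Suc m} - {k}. y - x j)" for y
    proof -
      have "(\<Prod>i<m. (x(k := y)) i - (x(k := y)) m) = (y - x m) * (\<Prod>i\<in>{..<m} - {k}. x i - x m)"
        using k by (subst prod.remove[of _ k]) (auto intro!: prod.cong)
      moreover have "{..<Suc m} - {k} = insert m ({..<m} - {k})" using k by auto
      ultimately show ?thesis unfolding step E by simp
    qed
    then show ?thesis by blast
  qed
qed simp

lemma vandermonde_update:
  assumes "inj_on x {..<m}" "k < m"
  shows "vandermonde m (x(k := y)) = vandermonde m x * (\<Prod>j\<in>{..<m} - {k}. (y - x j) / (x k - x j))"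
proof -
  obtain E where E: "\<And>y. vandermonde m (x(k := y)) = E * (\<Prod>j\<in>{..<m} - {k}. y - x j)"
    using vandermonde_update_ex[OF assms(2)] by blast
  have "(\<Prod>j\<in>{..<m} - {k}. x k - x j) \<noteq> 0"
    using assms by (auto simp: inj_on_def)
  then show ?thesis using E[of y] E[of "x k"] by (simp add: prod_dividef)
qed

lemma vandermonde_arithmetic:
  assumes "\<And>i j. i < j \<Longrightarrow> j < m \<Longrightarrow> x i - x j = real (j - i)"
  shows "vandermonde m x = (\<Prod>j<m. fact j)"
  unfolding vandermonde_def
proof (rule prod.cong)
  fix j assume "j \<in> {..<m}"
  then have "(\<Prod>i<j. x i - x j) = (\<Prod>i<j. real (j - i))"
    using assms by (intro prod.cong) auto
  then show "(\<Prod>i<j. x i - x j) = fact j"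
    unfolding fact_prod_rev atLeast0LessThan by simp
qed simp

lemma prod_lessThan_add:
  "(\<Prod>i<a + q. g i) = (\<Prod>i<a. g i) * (\<Prod>i<q. g (a + i))" for g :: "nat \<Rightarrow> 'a::comm_monoid_mult"
  by (induction q) (simp_all add: mult.assoc)

text \<open>Splits the pairs of indices into those within each of two blocks and the mixed ones, as
  suits a shape with two distinct row lengths.\<close>

lemma vandermonde_add:
  "vandermonde (a + c) x = vandermonde a x * vandermonde c (\<lambda>i. x (a + i)) * (\<Prod>j<c. \<Prod>i<a. x i - x (a + j))"
proof (induction c)
  case (Suc c)
  have "(\<Prod>i<a + c. x i - x (a + c)) = (\<Prod>i<a. x i - x (a + c)) * (\<Prod>i<c. x (a + i) - x (a + c))"
    by (rule prod_lessThan_add)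
  moreover have "vandermonde (Suc m) z = vandermonde m z * (\<Prod>i<m. z i - z m)" for z m
    by (simp add: vandermonde_def)
  ultimately show ?case using Suc by simp
qed (simp add: vandermonde_def)

subsection \<open>Frobenius' formula for the number of standard tableaux\<close>

text \<open>Row lengths as a function on all of nat: adding or removing a box is a function update,
  and empty rows are no special case.\<close>

definition rows_diagram :: "(nat \<Rightarrow> nat) \<Rightarrow> (nat \<times> nat) set" where
  "rows_diagram f = {(i, j). j < f i}"

text \<open>Frobenius' formula in the nodes l i = f i + m - 1 - i. The bound m may exceed the number
  of nonempty rows, which leaves room to open a new row.\<close>

definition frobenius_count :: "nat \<Rightarrow> (nat \<Rightarrow> nat) \<Rightarrow> real" where
  "frobenius_count m f = fact (\<Sum>i<m. f i) * vandermonde m (\<lambda>i. real (f i + (m - 1 - i))) /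
     (\<Prod>i<m. fact (f i + (m - 1 - i)))"

lemma rows_diagram_eq_Sigma:
  assumes "\<And>i. m \<le> i \<Longrightarrow> f i = 0"
  shows "rows_diagram f = (SIGMA i:{..<m}. {..<f i})"
proof -
  have "i < m" if "j < f i" for i j using that assms[of i] by (cases "i < m") auto
  then show ?thesis by (auto simp: rows_diagram_def)
qed

lemma young_ideal_rows_diagram:
  assumes "antimono f" "\<And>i. m \<le> i \<Longrightarrow> f i = 0"
  shows "young_ideal (rows_diagram f)"
proof -
  have "finite (rows_diagram f)" using rows_diagram_eq_Sigma[OF assms(2)] by simp
  moreover have "x \<in> rows_diagram f" if "y \<in> rows_diagram f" "x \<le> y" for x y
  proof -
    have "f (fst y) \<le> f (fst x)" using assms(1) that(2) by (simp add: antimono_def less_eq_prod_def)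
    then show ?thesis using that by (auto simp: rows_diagram_def less_eq_prod_def)
  qed
  ultimately show ?thesis unfolding young_ideal_def by blast
qed

lemma card_rows_diagram:
  assumes "\<And>i. m \<le> i \<Longrightarrow> f i = 0"
  shows "card (rows_diagram f) = (\<Sum>i<m. f i)"
  using rows_diagram_eq_Sigma[OF assms] by simp

lemma corners_rows_diagram:
  assumes "antimono f"
  shows "corners (rows_diagram f) = (\<lambda>i. (i, f i - 1)) ` {i. f (Suc i) < f i}"
proof -
  have "x \<in> corners (rows_diagram f) \<longleftrightarrow> x \<in> (\<lambda>i. (i, f i - 1)) ` {i. f (Suc i) < f i}" for x
  proof -
    obtain i j where x: "x = (i, j)" by fastforce
    show ?thesis
    proof
      assume c: "x \<in> corners (rows_diagram f)"
      then have j: "j < f i" and max: "\<And>y. y \<in> rows_diagram f \<Longrightarrow> \<not> x < y"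
        using x by (auto simp: corners_def rows_diagram_def)
      have "\<not> Suc j < f i" using max[of "(i, Suc j)"] x by (auto simp: rows_diagram_def less_prod_def less_eq_prod_def)
      moreover have "\<not> j < f (Suc i)" using max[of "(Suc i, j)"] x by (auto simp: rows_diagram_def less_prod_def less_eq_prod_def)
      ultimately show "x \<in> (\<lambda>i. (i, f i - 1)) ` {i. f (Suc i) < f i}" using x j by auto
    next
      assume "x \<in> (\<lambda>i. (i, f i - 1)) ` {i. f (Suc i) < f i}"
      then have i: "f (Suc i) < f i" "j = f i - 1" using x by auto
      have "\<not> x < y" if y: "y \<in> rows_diagram f" for y
      proof
        assume l: "x < y"
        obtain i' j' where y': "y = (i', j')" by fastforce
        have le: "i \<le> i'" "j \<le> j'" "i < i' \<or> j < j'" using l x y' by (auto simp: less_prod_def less_eq_prod_def)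
        have j': "j' < f i'" using y y' by (simp add: rows_diagram_def)
        show False
        proof (cases "i = i'")
          case True then show ?thesis using le j' i by auto
        next
          case False
          then have "f i' \<le> f (Suc i)" using le assms by (simp add: antimono_def)
          then show ?thesis using le j' i by simp
        qed
      qed
      then show "x \<in> corners (rows_diagram f)" using i x by (auto simp: corners_def rows_diagram_def)
    qed
  qed
  then show ?thesis by blast
qed

lemma rows_diagram_remove:
  assumes "f (Suc i) < f i"
  shows "rows_diagram f - {(i, f i - 1)} = rows_diagram (f(i := f i - 1))"
  using assms by (auto simp: rows_diagram_def split: if_splits)

text \<open>Removing a box from row i lowers one node by 1, and the quotient of the factorials
  contributes a factor l i. A row whose box is not removable gives 0: either two nodes collide, or
  it is the last row and l i = 0. So the recursion over corners becomes a sum over all rows, which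
  \<open>sum_shifted_ratios\<close> evaluates.\<close>

lemma card_std_eq_frobenius_count:
  assumes "antimono f" "\<And>i. m \<le> i \<Longrightarrow> f i = 0"
  shows "real (card (std (rows_diagram f))) = frobenius_count m f"
  using assms
proof (induction "\<Sum>i<m. f i" arbitrary: f)
  case 0
  then have f0: "f i = 0" for i by (cases "i < m") auto
  then have "rows_diagram f = {}" by (auto simp: rows_diagram_def)
  moreover have "std {} = {\<lambda>_. 0}" by (auto simp: std_def bij_betw_def)
  ultimately have one: "card (std (rows_diagram f)) = 1" by simp
  have V: "vandermonde m (\<lambda>i. real (f i + (m - 1 - i))) = (\<Prod>j<m. fact j)"
    by (rule vandermonde_arithmetic) (use f0 in auto)
  have P: "(\<Prod>i<m. fact (f i + (m - 1 - i)) :: real) = (\<Prod>j<m. fact j)"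
    using prod.nat_diff_reindex[of fact m] f0 by simp
  show ?case unfolding frobenius_count_def V P one by (simp add: f0)
next
  case (Suc n)
  define l where "l i = real (f i + (m - 1 - i))" for i
  define C where "C = (\<Prod>i<m. fact (f i + (m - 1 - i)) :: real)"
  have ldec: "l j < l i" if "i < j" "j < m" for i j
  proof -
    have "f j \<le> f i" using Suc.prems(1) that by (simp add: antimono_def)
    then show ?thesis using that by (simp add: l_def)
  qed
  have inj: "inj_on l {..<m}"
    by (rule linorder_inj_onI) (use ldec in force)+
  have summand: "real (card (std (rows_diagram (f(i := f i - 1)))))
      = fact n * vandermonde m (l(i := l i - 1)) * l i / C" if i: "f (Suc i) < f i" for i
  proof -
    let ?g = "f(i := f i - 1)"
    have im: "i < m" using i Suc.prems(2)[of i] by (cases "i < m") auto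
    have sum: "(\<Sum>i<m. ?g i) = n"
    proof -
      have "(\<Sum>k<m. f k) = f i + (\<Sum>k\<in>{..<m} - {i}. f k)" using im by (intro sum.remove) auto
      moreover have "(\<Sum>k<m. ?g k) = ?g i + (\<Sum>k\<in>{..<m} - {i}. ?g k)" using im by (intro sum.remove) auto
      moreover have "(\<Sum>k\<in>{..<m} - {i}. ?g k) = (\<Sum>k\<in>{..<m} - {i}. f k)" by (intro sum.cong) auto
      ultimately show ?thesis using Suc.hyps(2) i by simp
    qed
    have "antimono ?g"
      unfolding antimono_def
    proof (intro allI impI)
      fix p q :: nat assume pq: "p \<le> q"
      have "f q \<le> f p" using Suc.prems(1) pq by (simp add: antimono_def)
      moreover have "f q \<le> f (Suc i)" if "p = i" "q \<noteq> i"
        using Suc.prems(1) pq that by (simp add: antimono_def)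
      ultimately show "?g q \<le> ?g p" using i by auto
    qed
    then have "real (card (std (rows_diagram ?g))) = frobenius_count m ?g"
      using Suc.hyps(1)[of ?g] sum Suc.prems(2) im by auto
    also have "\<dots> = fact n * vandermonde m (l(i := l i - 1)) * l i / C"
    proof -
      have "vandermonde m (\<lambda>k. real (?g k + (m - 1 - k))) = vandermonde m (l(i := l i - 1))"
        by (rule vandermonde_cong) (use i in \<open>auto simp: l_def of_nat_diff\<close>)
      moreover have "C = l i * (\<Prod>k<m. fact (?g k + (m - 1 - k)))"
      proof -
        have "C = fact (f i + (m - 1 - i)) * (\<Prod>k\<in>{..<m} - {i}. fact (f k + (m - 1 - k)))"
          unfolding C_def using im by (intro prod.remove) auto
        moreover have "(\<Prod>k<m. fact (?g k + (m - 1 - k)) :: real)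
            = fact (?g i + (m - 1 - i)) * (\<Prod>k\<in>{..<m} - {i}. fact (?g k + (m - 1 - k)))"
          using im by (intro prod.remove) auto
        moreover have "(\<Prod>k\<in>{..<m} - {i}. fact (?g k + (m - 1 - k)) :: real)
            = (\<Prod>k\<in>{..<m} - {i}. fact (f k + (m - 1 - k)))" by (intro prod.cong) auto
        moreover have "(fact (f i + (m - 1 - i)) :: real) = l i * fact (?g i + (m - 1 - i))"
          using i fact_reduce[of "f i + (m - 1 - i)", where 'a = real] by (simp add: l_def)
        ultimately show ?thesis by simp
      qed
      moreover have "l i \<noteq> 0" using i by (simp add: l_def)
      ultimately show ?thesis unfolding frobenius_count_def sum by simp
    qed
    finally show ?thesis .
  qed
  have zero: "vandermonde m (l(i := l i - 1)) * l i = 0" if "i < m" "\<not> f (Suc i) < f i" for i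
  proof (cases "Suc i < m")
    case True
    have "f (Suc i) = f i" using that(2) antimonoD[OF Suc.prems(1), of i "Suc i"] by simp
    then have "l i - 1 = l (Suc i)" using True by (auto simp: l_def of_nat_diff)
    then have "(\<Prod>k<Suc i. (l(i := l i - 1)) k - (l(i := l i - 1)) (Suc i)) = 0" by simp
    then have "\<exists>j\<in>{..<m}. (\<Prod>k<j. (l(i := l i - 1)) k - (l(i := l i - 1)) j) = 0"
      using True by blast
    then have "vandermonde m (l(i := l i - 1)) = 0"
      unfolding vandermonde_def by (rule prod_zero[OF finite_lessThan])
    then show ?thesis by simp
  next
    case False
    then have "f i = 0" "m = Suc i" using that Suc.prems(2)[of "Suc i"] by auto
    then show ?thesis by (simp add: l_def)
  qed
  have ne: "rows_diagram f \<noteq> {}"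
    using Suc.hyps(2) card_rows_diagram[of m f] Suc.prems(2) by auto
  have suml: "(\<Sum>i<m. l i) - real m * (real m - 1) / 2 = real (Suc n)"
  proof -
    have "(\<Sum>i<m. real (m - 1 - i)) = (\<Sum>i<m. real i)"
      using sum.nat_diff_reindex[of real m] by simp
    also have "\<dots> = real m * (real m - 1) / 2" by (induction m) (auto simp: field_simps)
    finally have q: "(\<Sum>i<m. real (m - 1 - i)) = real m * (real m - 1) / 2" .
    have "(\<Sum>i<m. l i) = (\<Sum>i<m. real (f i)) + (\<Sum>i<m. real (m - 1 - i))"
      unfolding l_def of_nat_add sum.distrib ..
    then show ?thesis unfolding Suc.hyps(2) q by simp
  qed
  have "real (card (std (rows_diagram f)))
      = (\<Sum>x\<in>corners (rows_diagram f). real (card (std (rows_diagram f - {x}))))"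
    using card_std_rec[OF young_ideal_rows_diagram[of f m, OF Suc.prems] ne] by simp
  also have "\<dots> = (\<Sum>i\<in>{i. f (Suc i) < f i}. real (card (std (rows_diagram f - {(i, f i - 1)}))))"
    unfolding corners_rows_diagram[OF Suc.prems(1)] by (subst sum.reindex) (auto simp: inj_on_def)
  also have "\<dots> = (\<Sum>i\<in>{i. f (Suc i) < f i}. fact n * vandermonde m (l(i := l i - 1)) * l i / C)"
    by (rule sum.cong[OF refl], subst rows_diagram_remove) (auto intro: summand simp del: One_nat_def)
  also have "\<dots> = (\<Sum>i<m. fact n * vandermonde m (l(i := l i - 1)) * l i / C)"
  proof (rule sum.mono_neutral_left)
    have "i < m" if "f (Suc i) < f i" for i using that Suc.prems(2)[of i] by (cases "i < m") auto
    then show "{i. f (Suc i) < f i} \<subseteq> {..<m}" by auto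
  qed (use zero in auto)
  also have "\<dots> = (\<Sum>i<m. (fact n * vandermonde m l / C) *
      (l i * (\<Prod>j\<in>{..<m} - {i}. (l i - 1 - l j) / (l i - l j))))"
    by (rule sum.cong) (auto simp: vandermonde_update[OF inj])
  also have "\<dots> = (fact n * vandermonde m l / C) * real (Suc n)"
    unfolding sum_distrib_left[symmetric] sum_shifted_ratios[OF inj] suml ..
  also have "\<dots> = frobenius_count m f"
    unfolding frobenius_count_def Suc.hyps(2)[symmetric] by (simp add: C_def l_def[abs_def])
  finally show ?case .
qed

text \<open>Only the node l k moves, so all other factors cancel. In the theorem the ratio of d to r
  n is the product over j divided by l k + 1.\<close>

lemma frobenius_count_add_box:
  assumes "antimono f" "k < m"
  defines "l \<equiv> (\<lambda>i. real (f i + (m - 1 - i)))"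
  shows "frobenius_count m (f(k := Suc (f k))) = real (Suc (\<Sum>i<m. f i)) * frobenius_count m f *
    (\<Prod>j\<in>{..<m} - {k}. (l k + 1 - l j) / (l k - l j)) / (l k + 1)"
proof -
  let ?g = "f(k := Suc (f k))"
  have inj: "inj_on l {..<m}"
  proof (rule linorder_inj_onI)
    fix i j assume ij: "i < j" "i \<in> {..<m}" "j \<in> {..<m}"
    then have "f j \<le> f i" using assms(1) by (simp add: antimono_def)
    then show "l i \<noteq> l j" using ij by (simp add: l_def)
  qed auto
  define C where "C = (\<Prod>i<m. fact (f i + (m - 1 - i)) :: real)"
  have e1: "(\<Sum>i<m. ?g i) = Suc (\<Sum>i<m. f i)"
  proof -
    have "(\<Sum>i<m. f i) = f k + (\<Sum>i\<in>{..<m} - {k}. f i)" using assms(2) by (intro sum.remove) auto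
    moreover have "(\<Sum>i<m. ?g i) = ?g k + (\<Sum>i\<in>{..<m} - {k}. ?g i)" using assms(2) by (intro sum.remove) auto
    moreover have "(\<Sum>i\<in>{..<m} - {k}. ?g i) = (\<Sum>i\<in>{..<m} - {k}. f i)" by (intro sum.cong) auto
    ultimately show ?thesis by simp
  qed
  have e2: "vandermonde m (\<lambda>i. real (?g i + (m - 1 - i))) = vandermonde m (l(k := l k + 1))"
    by (rule vandermonde_cong) (auto simp: l_def)
  have e3: "(\<Prod>i<m. fact (?g i + (m - 1 - i)) :: real) = (l k + 1) * C"
  proof -
    have "(\<Prod>i<m. fact (f i + (m - 1 - i)) :: real)
        = fact (f k + (m - 1 - k)) * (\<Prod>i\<in>{..<m} - {k}. fact (f i + (m - 1 - i)))"
      using assms(2) by (intro prod.remove) auto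
    moreover have "(\<Prod>i<m. fact (?g i + (m - 1 - i)) :: real)
        = fact (?g k + (m - 1 - k)) * (\<Prod>i\<in>{..<m} - {k}. fact (?g i + (m - 1 - i)))"
      using assms(2) by (intro prod.remove) auto
    moreover have "(\<Prod>i\<in>{..<m} - {k}. fact (?g i + (m - 1 - i)) :: real)
        = (\<Prod>i\<in>{..<m} - {k}. fact (f i + (m - 1 - i)))" by (intro prod.cong) auto
    ultimately show ?thesis by (simp add: l_def C_def algebra_simps)
  qed
  have "frobenius_count m f = fact (\<Sum>i<m. f i) * vandermonde m l / C"
    unfolding frobenius_count_def C_def l_def ..
  then show ?thesis
    unfolding frobenius_count_def[of m ?g] e1 e2 e3 vandermonde_update[OF inj assms(2)]
    by (simp add: mult_ac)
qed

subsection \<open>Numbers of standard tableaux of the exceptional shapes\<close>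

definition rows_of :: "nat list \<Rightarrow> nat \<Rightarrow> nat" where
  "rows_of lam i = (if i < length lam then lam ! i else 0)"

lemma diagram_eq_rows_diagram: "diagram lam = rows_diagram (rows_of lam)"
  by (auto simp: diagram_def rows_diagram_def rows_of_def split: if_splits)

lemma antimono_rows_of: "partition_of n lam \<Longrightarrow> antimono (rows_of lam)"
  using partition_of_nth_mono by (auto simp: antimono_def rows_of_def)

lemma card_std_diagram:
  assumes "partition_of n lam" "length lam \<le> m"
  shows "real (card (std (diagram lam))) = frobenius_count m (rows_of lam)"
  unfolding diagram_eq_rows_diagram
  by (rule card_std_eq_frobenius_count) (use assms antimono_rows_of in \<open>auto simp: rows_of_def\<close>)

lemma sum_rows_of:
  assumes "length lam \<le> m"
  shows "(\<Sum>i<m. rows_of lam i) = sum_list lam"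
proof -
  have "(\<Sum>i<m. rows_of lam i) = (\<Sum>i<length lam. rows_of lam i)"
    using assms by (intro sum.mono_neutral_right) (auto simp: rows_of_def)
  then show ?thesis by (simp add: sum_list_sum_nth atLeast0LessThan rows_of_def)
qed

lemma card_std_add_box:
  assumes "partition_of n lam" "partition_of n' \<mu>" "length lam \<le> m" "length \<mu> \<le> m" "k < m"
    and "rows_of lam = (rows_of \<mu>)(k := Suc (rows_of \<mu> k))"
  defines "l \<equiv> (\<lambda>i. real (rows_of \<mu> i + (m - 1 - i)))"
  shows "real (card (std (diagram lam))) = real (Suc n') * real (card (std (diagram \<mu>))) *
    (\<Prod>j\<in>{..<m} - {k}. (l k + 1 - l j) / (l k - l j)) / (l k + 1)"
proof -
  have "(\<Sum>i<m. rows_of \<mu> i) = n'"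
    using sum_rows_of[OF assms(4)] assms(2) by (simp add: partition_of_def)
  then show ?thesis
    unfolding card_std_diagram[OF assms(1,3)] card_std_diagram[OF assms(2,4)] assms(6) l_def
    using frobenius_count_add_box[OF antimono_rows_of[OF assms(2)] assms(5)] by simp
qed

section \<open>Telescoping and symmetric products\<close>

lemma prod_Suc_shift: "(\<Prod>j<q. real (Suc (p + j))) = fact (p + q) / fact p"
proof (induction q)
  case (Suc q)
  show ?case unfolding prod.lessThan_Suc Suc.IH by (simp add: mult.commute)
qed simp

lemma shifted_ratio: "(z + 1 - (z + y + 1)) / (z - (z + y + 1)) = y / (y + 1)" for y z :: real
proof -
  have "z + 1 - (z + y + 1) = - y" "z - (z + y + 1) = - (y + 1)" by simp_all
  then show ?thesis by (simp only: divide_minus_left divide_minus_right minus_minus)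
qed

text \<open>Both sides are the product of 1 / (c + k + j + 1) over a rectangle of indices,
  multiplied out by rows or by columns. This is why r has two expressions.\<close>

lemma prod_fact_ratio_swap:
  "(\<Prod>k<a. fact (c + k) / fact (c + k + b) :: real) = (\<Prod>k<b. fact (c + k) / fact (c + k + a))"
proof -
  have e: "(fact (c + k) / fact (c + k + b) :: real) = (\<Prod>j<b. 1 / real (Suc (c + k + j)))" for k b
    unfolding prod_dividef prod_Suc_shift by simp
  have "(\<Prod>k<a. fact (c + k) / fact (c + k + b) :: real) = (\<Prod>j<b. \<Prod>k<a. 1 / real (Suc (c + k + j)))"
    unfolding e by (rule prod.swap)
  also have "\<dots> = (\<Prod>j<b. \<Prod>k<a. 1 / real (Suc (c + j + k)))" by (simp add: add_ac)
  finally show ?thesis unfolding e .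
qed

lemma prod_Suc_ratio: "1 \<le> c \<Longrightarrow> (\<Prod>j\<in>{1..<c}. (real j + 1) / real j) = real c"
proof (induction c rule: dec_induct)
  case (step c)
  then show ?case by (simp add: field_simps)
qed simp

lemma prod_pred_ratio: "1 \<le> c \<Longrightarrow> (\<Prod>i<a. real (c + i) / real (c + i + 1)) = real c / real (a + c)"
proof (induction a)
  case (Suc a)
  then show ?case by (simp add: field_simps)
qed simp

section \<open>The shapes of the theorem and their counts\<close>

lemma partition_of_replicate: "1 \<le> b \<Longrightarrow> partition_of (a * b) (replicate a b)"
  by (auto simp: partition_of_def sorted_wrt_iff_nth_less sum_list_replicate)

lemma partition_of_rect_longer_row:
  "1 \<le> b \<Longrightarrow> 1 \<le> a \<Longrightarrow> partition_of (a * b + 1) ((b + 1) # replicate (a - 1) b)"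
  by (cases a) (auto simp: partition_of_def sorted_wrt_iff_nth_less sum_list_replicate nth_Cons split: nat.splits)

lemma partition_of_rect_new_row:
  "1 \<le> a \<Longrightarrow> partition_of (a * b + 1) (replicate b a @ [1])"
  by (auto simp: partition_of_def sorted_wrt_iff_nth_less sum_list_replicate nth_append)

lemma partition_of_two_step:
  "1 \<le> b \<Longrightarrow> partition_of (a * b + a * c + b * c) (replicate a (b + c) @ replicate c b)"
  by (auto simp: partition_of_def sorted_wrt_iff_nth_less sum_list_replicate nth_append algebra_simps)

lemma partition_of_two_step_inner:
  "1 \<le> b \<Longrightarrow> 1 \<le> c \<Longrightarrow>
    partition_of (a * b + a * c + b * c + 1) (replicate a (b + c) @ [b + 1] @ replicate (c - 1) b)"
  by (cases c) (auto simp: partition_of_def sorted_wrt_iff_nth_less sum_list_replicate nth_append nth_Cons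
      algebra_simps split: nat.splits)

lemma card_std_rect:
  assumes "1 \<le> b"
  shows "real (card (std (diagram (replicate a b)))) = fact (a * b) * (\<Prod>k<a. fact k / fact (k + b))"
proof -
  let ?f = "rows_of (replicate a b)"
  have "vandermonde a (\<lambda>i. real (?f i + (a - 1 - i))) = (\<Prod>j<a. fact j)"
    by (rule vandermonde_arithmetic) (auto simp: rows_of_def)
  moreover have "(\<Prod>i<a. fact (?f i + (a - 1 - i)) :: real) = (\<Prod>i<a. fact (i + b))"
    unfolding prod.nat_diff_reindex[of "\<lambda>i. fact (i + b) :: real" a, symmetric]
    by (rule prod.cong) (auto simp: rows_of_def add.commute)
  moreover have "(\<Sum>i<a. ?f i) = a * b" by (simp add: rows_of_def)
  ultimately show ?thesis
    unfolding card_std_diagram[OF partition_of_replicate[OF assms] order_refl, simplified] frobenius_count_def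
    by (simp add: prod_dividef)
qed

lemma card_std_rect_longer_row:
  assumes "1 \<le> b" "1 \<le> a"
  shows "real (card (std (diagram ((b + 1) # replicate (a - 1) b)))) =
    real a / real (a + b) * real (card (std (diagram (replicate a b)))) * real (a * b + 1)"
proof -
  let ?f = "rows_of (replicate a b)"
  let ?l = "\<lambda>i. real (?f i + (a - 1 - i))"
  have "rows_of ((b + 1) # replicate (a - 1) b) = ?f(0 := Suc (?f 0))"
    using assms by (auto simp: rows_of_def fun_eq_iff nth_Cons split: nat.splits)
  then have eq: "real (card (std (diagram ((b + 1) # replicate (a - 1) b)))) =
      real (Suc (a * b)) * real (card (std (diagram (replicate a b)))) *
      (\<Prod>j\<in>{..<a} - {0}. (?l 0 + 1 - ?l j) / (?l 0 - ?l j)) / (?l 0 + 1)"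
    using assms by (intro card_std_add_box[OF partition_of_rect_longer_row partition_of_replicate]) auto
  have "(\<Prod>j\<in>{..<a} - {0}. (?l 0 + 1 - ?l j) / (?l 0 - ?l j)) = (\<Prod>j\<in>{1..<a}. (real j + 1) / real j)"
    by (rule prod.cong) (auto simp: rows_of_def of_nat_diff)
  also have "\<dots> = real a" by (rule prod_Suc_ratio[OF assms(2)])
  finally have p: "(\<Prod>j\<in>{..<a} - {0}. (?l 0 + 1 - ?l j) / (?l 0 - ?l j)) = real a" .
  have "?l 0 + 1 = real (a + b)" using assms by (simp add: rows_of_def of_nat_diff)
  then show ?thesis unfolding eq p by simp
qed

lemma card_std_rect_new_row:
  assumes "1 \<le> a"
  shows "real (card (std (diagram (replicate b a @ [1])))) =
    real a / real (a + b) * real (card (std (diagram (replicate b a)))) * real (a * b + 1)"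
proof -
  let ?f = "rows_of (replicate b a)"
  \<comment> \<open>One row more than the rectangle has: the added box lies in the row of index b,
    whose node is 0.\<close>
  let ?l = "\<lambda>i. real (?f i + (Suc b - 1 - i))"
  have "rows_of (replicate b a @ [1]) = ?f(b := Suc (?f b))"
    by (auto simp: rows_of_def fun_eq_iff nth_append)
  then have eq: "real (card (std (diagram (replicate b a @ [1])))) =
      real (Suc (b * a)) * real (card (std (diagram (replicate b a)))) *
      (\<Prod>j\<in>{..<Suc b} - {b}. (?l b + 1 - ?l j) / (?l b - ?l j)) / (?l b + 1)"
    using assms by (intro card_std_add_box[OF partition_of_rect_new_row partition_of_replicate]) auto
  have lb: "?l b = 0" by (simp add: rows_of_def)
  have "(\<Prod>j\<in>{..<Suc b} - {b}. (?l b + 1 - ?l j) / (?l b - ?l j))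
      = (\<Prod>j<b. real (a + (b - Suc j)) / real (a + (b - Suc j) + 1))"
  proof (rule prod.cong)
    fix j assume "j \<in> {..<b}"
    then have lj: "?l j = ?l b + real (a + (b - Suc j)) + 1" unfolding lb by (simp add: rows_of_def of_nat_diff)
    show "(?l b + 1 - ?l j) / (?l b - ?l j) = real (a + (b - Suc j)) / real (a + (b - Suc j) + 1)"
      unfolding lj shifted_ratio by simp
  qed auto
  also have "\<dots> = (\<Prod>i<b. real (a + i) / real (a + i + 1))"
    by (rule prod.nat_diff_reindex)
  also have "\<dots> = real a / real (a + b)"
    using prod_pred_ratio[OF assms, of b] by (simp add: add.commute)
  finally show ?thesis unfolding eq lb by (simp add: mult.commute)
qed

text \<open>The nodes form two arithmetic progressions. Each block contributes a product of
  factorials; for a fixed upper row the differences to the lower rows are consecutive integers and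
  give a quotient of factorials.\<close>

lemma card_std_two_step:
  assumes "1 \<le> b"
  shows "real (card (std (diagram (replicate a (b + c) @ replicate c b)))) =
    fact (a * b + a * c + b * c) * (\<Prod>k<c. (fact k)\<^sup>2 / (fact (a + k) * fact (b + k))) *
    (\<Prod>l<a. fact (2 * c + l) / fact (2 * c + b + l))"
proof -
  let ?f = "rows_of (replicate a (b + c) @ replicate c b)"
  let ?l = "\<lambda>i. real (?f i + (a + c - 1 - i))"
  have f1: "?f i = b + c" if "i < a" for i using that by (simp add: rows_of_def nth_append)
  have f2: "?f (a + i) = b" if "i < c" for i using that by (simp add: rows_of_def nth_append)
  have V1: "vandermonde a ?l = (\<Prod>j<a. fact j)"
    by (rule vandermonde_arithmetic) (auto simp: f1 of_nat_diff)
  have V2: "vandermonde c (\<lambda>i. ?l (a + i)) = (\<Prod>j<c. fact j)"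
    by (rule vandermonde_arithmetic) (auto simp: f2 of_nat_diff)
  have V3: "(\<Prod>j<c. \<Prod>i<a. ?l i - ?l (a + j)) = (\<Prod>i<a. fact (2 * c + i) / fact (c + i))"
  proof -
    have "(\<Prod>j<c. \<Prod>i<a. ?l i - ?l (a + j)) = (\<Prod>i<a. \<Prod>j<c. ?l i - ?l (a + j))"
      by (rule prod.swap)
    also have "\<dots> = (\<Prod>i<a. fact (2 * c + (a - Suc i)) / fact (c + (a - Suc i)))"
    proof (rule prod.cong)
      fix i assume i: "i \<in> {..<a}"
      have "(\<Prod>j<c. ?l i - ?l (a + j)) = (\<Prod>j<c. real (Suc (c + (a - Suc i) + j)))"
        using i by (intro prod.cong) (auto simp: f1 f2 of_nat_diff)
      also have "\<dots> = fact (c + (a - Suc i) + c) / fact (c + (a - Suc i))"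
        by (rule prod_Suc_shift)
      finally show "(\<Prod>j<c. ?l i - ?l (a + j)) = fact (2 * c + (a - Suc i)) / fact (c + (a - Suc i))"
        by (simp add: mult_2 add_ac)
    qed simp
    also have "\<dots> = (\<Prod>i<a. fact (2 * c + i) / fact (c + i))"
      by (rule prod.nat_diff_reindex)
    finally show ?thesis .
  qed
  have P: "(\<Prod>i<a + c. fact (?f i + (a + c - 1 - i)) :: real)
      = (\<Prod>l<a. fact (2 * c + b + l)) * (\<Prod>k<c. fact (b + k))"
  proof -
    have "(\<Prod>i<a. fact (?f i + (a + c - 1 - i)) :: real) = (\<Prod>i<a. fact (2 * c + b + (a - Suc i)))"
      by (rule prod.cong) (auto simp: f1 intro!: arg_cong[where f = fact])
    also have "\<dots> = (\<Prod>l<a. fact (2 * c + b + l))" by (rule prod.nat_diff_reindex)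
    finally have 1: "(\<Prod>i<a. fact (?f i + (a + c - 1 - i)) :: real) = (\<Prod>l<a. fact (2 * c + b + l))" .
    have "(\<Prod>i<c. fact (?f (a + i) + (a + c - 1 - (a + i))) :: real) = (\<Prod>i<c. fact (b + (c - Suc i)))"
      by (rule prod.cong) (auto simp: f2 intro!: arg_cong[where f = fact])
    also have "\<dots> = (\<Prod>k<c. fact (b + k))" by (rule prod.nat_diff_reindex)
    finally show ?thesis unfolding prod_lessThan_add 1 by simp
  qed
  have S: "(\<Sum>i<a + c. ?f i) = a * b + a * c + b * c"
    using sum_rows_of[of "replicate a (b + c) @ replicate c b" "a + c"] by (simp add: sum_list_replicate algebra_simps)
  \<comment> \<open>Exchanges a product over the a upper rows for one over the c lower rows, as in
    the stated formula.\<close>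
  have sw: "(\<Prod>k<a. fact k / fact (c + k) :: real) = (\<Prod>k<c. fact k / fact (a + k))"
    using prod_fact_ratio_swap[where a = a and b = c and c = 0] by (simp add: add.commute)
  have "real (card (std (diagram (replicate a (b + c) @ replicate c b)))) = frobenius_count (a + c) ?f"
    by (rule card_std_diagram[OF partition_of_two_step[OF assms]]) simp
  also have "\<dots> = fact (a * b + a * c + b * c) *
      ((\<Prod>j<a. fact j) * (\<Prod>j<c. fact j) * (\<Prod>i<a. fact (2 * c + i) / fact (c + i))) /
      ((\<Prod>l<a. fact (2 * c + b + l)) * (\<Prod>k<c. fact (b + k)))"
    unfolding frobenius_count_def vandermonde_add V1 V2 V3 P S ..
  also have "\<dots> = fact (a * b + a * c + b * c) *
      ((\<Prod>k<a. fact k / fact (c + k)) * (\<Prod>j<c. fact j) / (\<Prod>k<c. fact (b + k))) *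
      (\<Prod>l<a. fact (2 * c + l) / fact (2 * c + b + l))"
    by (simp add: prod_dividef mult_ac)
  also have "(\<Prod>k<a. fact k / fact (c + k)) * (\<Prod>j<c. fact j) / (\<Prod>k<c. fact (b + k))
      = (\<Prod>k<c. (fact k)\<^sup>2 / (fact (a + k) * fact (b + k)) :: real)"
    unfolding sw by (simp add: prod_dividef prod.distrib power2_eq_square mult_ac)
  finally show ?thesis .
qed

text \<open>The rows above the new box contribute c / (a + c), the rows below contribute c, and the
  shifted node of its own row is b + c.\<close>

lemma card_std_two_step_inner:
  assumes "1 \<le> b" "1 \<le> c"
  shows "real (card (std (diagram (replicate a (b + c) @ [b + 1] @ replicate (c - 1) b)))) =
    (real c)\<^sup>2 / (real (a + c) * real (b + c)) *
    real (card (std (diagram (replicate a (b + c) @ replicate c b)))) * real (a * b + a * c + b * c + 1)"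
proof -
  let ?mu = "replicate a (b + c) @ replicate c b"
  let ?lam = "replicate a (b + c) @ [b + 1] @ replicate (c - 1) b"
  let ?f = "rows_of ?mu"
  let ?l = "\<lambda>i. real (?f i + (a + c - 1 - i))"
  have f1: "?f i = b + c" if "i < a" for i using that by (simp add: rows_of_def nth_append)
  have f2: "?f (a + i) = b" if "i < c" for i using that by (simp add: rows_of_def nth_append)
  have "rows_of ?lam = ?f(a := Suc (?f a))"
    using assms by (auto simp: rows_of_def fun_eq_iff nth_append nth_Cons split: nat.splits)
  then have eq: "real (card (std (diagram ?lam))) =
      real (Suc (a * b + a * c + b * c)) * real (card (std (diagram ?mu))) *
      (\<Prod>j\<in>{..<a + c} - {a}. (?l a + 1 - ?l j) / (?l a - ?l j)) / (?l a + 1)"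
    using assms by (intro card_std_add_box[OF partition_of_two_step_inner partition_of_two_step]) auto
  have fa: "?f a = b" using f2[of 0] assms by simp
  then have la: "?l a + 1 = real (b + c)" using assms by (simp add: of_nat_diff)
  have split: "{..<a + c} - {a} = {..<a} \<union> (\<lambda>i. a + i) ` {1..<c}"
  proof -
    have "j \<in> (\<lambda>i. a + i) ` {1..<c}" if "a < j" "j < a + c" for j
      using that by (intro image_eqI[of _ _ "j - a"]) auto
    then show ?thesis using assms by (auto simp: not_less le_less)
  qed
  have "(\<Prod>j\<in>{..<a + c} - {a}. (?l a + 1 - ?l j) / (?l a - ?l j))
      = (\<Prod>j<a. (?l a + 1 - ?l j) / (?l a - ?l j)) *
        (\<Prod>j\<in>(\<lambda>i. a + i) ` {1..<c}. (?l a + 1 - ?l j) / (?l a - ?l j))"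
    unfolding split by (rule prod.union_disjoint) auto
  also have "(\<Prod>j<a. (?l a + 1 - ?l j) / (?l a - ?l j))
      = (\<Prod>j<a. real (c + (a - Suc j)) / real (c + (a - Suc j) + 1))"
  proof (rule prod.cong)
    fix j assume "j \<in> {..<a}"
    then have lj: "?l j = ?l a + real (c + (a - Suc j)) + 1"
      using assms f1[of j] fa by (simp add: of_nat_diff)
    show "(?l a + 1 - ?l j) / (?l a - ?l j) = real (c + (a - Suc j)) / real (c + (a - Suc j) + 1)"
      unfolding lj shifted_ratio by simp
  qed simp
  also have "\<dots> = (\<Prod>i<a. real (c + i) / real (c + i + 1))" by (rule prod.nat_diff_reindex)
  also have "\<dots> = real c / real (a + c)" by (rule prod_pred_ratio[OF assms(2)])
  also have "(\<Prod>j\<in>(\<lambda>i. a + i) ` {1..<c}. (?l a + 1 - ?l j) / (?l a - ?l j))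
      = (\<Prod>i\<in>{1..<c}. (?l a + 1 - ?l (a + i)) / (?l a - ?l (a + i)))"
    by (subst prod.reindex) auto
  also have "\<dots> = (\<Prod>i\<in>{1..<c}. (real i + 1) / real i)"
  proof (rule prod.cong)
    fix i assume "i \<in> {1..<c}"
    then have "?l a = ?l (a + i) + real i" using f2[of i] fa by (simp add: of_nat_diff)
    then show "(?l a + 1 - ?l (a + i)) / (?l a - ?l (a + i)) = (real i + 1) / real i" by simp
  qed simp
  also have "\<dots> = real c" by (rule prod_Suc_ratio[OF assms(2)])
  finally show ?thesis unfolding eq la by (simp add: power2_eq_square)
qed

subsection \<open>The exceptional shapes and the theorem\<close>

lemma diagram_replicate: "diagram (replicate a b) = {(i, j). i < a \<and> j < b}"
  by (auto simp: diagram_def)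

lemma diagram_rect_longer_row:
  "1 \<le> a \<Longrightarrow> diagram ((b + 1) # replicate (a - 1) b) = insert (0, b) {(i, j). i < a \<and> j < b}"
  by (auto simp: diagram_def nth_Cons split: nat.splits)

lemma diagram_rect_new_row:
  "diagram (replicate b a @ [1]) = insert (b, 0) {(i, j). i < b \<and> j < a}"
  by (auto simp: diagram_def nth_append split: if_splits)

lemma diagram_two_step:
  "diagram (replicate a (b + c) @ replicate c b) = {(i, j). i < a \<and> j < b + c \<or> i < a + c \<and> j < b}"
  by (auto simp: diagram_def nth_append split: if_splits)

lemma diagram_two_step_inner:
  assumes "1 \<le> c"
  shows "diagram (replicate a (b + c) @ [b + 1] @ replicate (c - 1) b) =
    insert (a, b) {(i, j). i < a \<and> j < b + c \<or> i < a + c \<and> j < b}"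
proof -
  have "(replicate a (b + c) @ [b + 1] @ replicate (c - 1) b) ! i =
      (if i < a then b + c else if i = a then b + 1 else b)" if "i < a + c" for i
    using that assms by (auto simp: nth_append nth_Cons')
  then show ?thesis using assms by (auto simp: diagram_def split: if_splits)
qed

lemma corners_rect: "y \<in> corners {(i, j). i < a \<and> j < b} \<Longrightarrow> y = (a - 1, b - 1)"
proof -
  assume y: "y \<in> corners {(i, j). i < a \<and> j < b}"
  obtain i j where e: "y = (i, j)" by fastforce
  have ij: "i < a" "j < b" using y e by (auto simp: corners_def)
  have "\<not> (i, j) < (a - 1, b - 1)" using y e ij by (auto simp: corners_def)
  then show ?thesis using ij e by (auto simp: less_prod_def less_eq_prod_def)
qed

lemma corners_two_step:
  assumes "y \<in> corners {(i, j). i < a \<and> j < b + c \<or> i < a + c \<and> j < b}"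
  shows "y = (a - 1, b + c - 1) \<or> y = (a + c - 1, b - 1)"
proof -
  let ?D = "{(i, j). i < a \<and> j < b + c \<or> i < a + c \<and> j < b}"
  obtain i j where e: "y = (i, j)" by fastforce
  have ij: "i < a \<and> j < b + c \<or> i < a + c \<and> j < b"
    and max: "\<And>z. z \<in> ?D \<Longrightarrow> \<not> (i, j) < z"
    using assms e by (auto simp: corners_def)
  show ?thesis
  proof (cases "i < a \<and> j < b + c")
    case True
    then have "\<not> (i, j) < (a - 1, b + c - 1)" by (intro max) auto
    then show ?thesis using True e by (auto simp: less_prod_def less_eq_prod_def)
  next
    case False
    then have "\<not> (i, j) < (a + c - 1, b - 1)" using ij by (intro max) auto
    then show ?thesis using False ij e by (auto simp: less_prod_def less_eq_prod_def)
  qed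
qed

text \<open>A rectangle has only one corner. In the two-step case x = (a, b), and the corners (a -
  1, b + c - 1) and (a + c - 1, b - 1) have contents c above and c below that of x.\<close>

lemma equidistant_if_exceptional:
  assumes "diagram \<mu> = diagram lam - {x}"
    and "rect_longer_row a b \<mu> lam \<or> rect_new_row a b \<mu> lam \<or> two_step_inner a b c \<mu> lam"
  shows "\<exists>d. \<forall>y\<in>corners (diagram \<mu>). \<bar>content x - content y\<bar> = d"
  using assms(2)
proof (elim disjE)
  assume "rect_longer_row a b \<mu> lam"
  then have "diagram \<mu> = {(i, j). i < a \<and> j < b}" by (simp add: rect_longer_row_def diagram_replicate)
  then show ?thesis using corners_rect by metis
next
  assume "rect_new_row a b \<mu> lam"
  then have "diagram \<mu> = {(i, j). i < b \<and> j < a}" by (simp add: rect_new_row_def diagram_replicate)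
  then show ?thesis using corners_rect by metis
next
  assume t: "two_step_inner a b c \<mu> lam"
  then have mu: "diagram \<mu> = {(i, j). i < a \<and> j < b + c \<or> i < a + c \<and> j < b}"
    and abc: "1 \<le> a" "1 \<le> b" "2 \<le> c"
    by (simp_all only: two_step_inner_def diagram_two_step)
  have lam: "diagram lam = insert (a, b) {(i, j). i < a \<and> j < b + c \<or> i < a + c \<and> j < b}"
    using t diagram_two_step_inner[of c a b] abc(3) unfolding two_step_inner_def by simp
  have "(a, b) \<in> diagram lam - diagram \<mu>" using mu lam by simp
  then have x: "x = (a, b)" using assms(1) by auto
  have "\<bar>content x - content y\<bar> = int c" if "y \<in> corners (diagram \<mu>)" for y
  proof -
    have "y = (a - 1, b + c - 1) \<or> y = (a + c - 1, b - 1)"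
      using corners_two_step[of y a b c] that unfolding mu by blast
    then show ?thesis using abc unfolding x by (auto simp: content_def)
  qed
  then show ?thesis by (intro exI[of _ "int c"] ballI)
qed

text \<open>Turns knowledge of the corners into knowledge of the whole shape.\<close>

lemma young_ideal_eq_below_corners:
  assumes "young_ideal D"
  shows "D = {z. \<exists>y\<in>corners D. z \<le> y}"
proof (intro equalityI subsetI)
  fix z assume "z \<in> D"
  then show "z \<in> {z. \<exists>y\<in>corners D. z \<le> y}" using corner_above[OF assms, of z] by blast
next
  fix z assume "z \<in> {z. \<exists>y\<in>corners D. z \<le> y}"
  then show "z \<in> D" using young_idealD[OF assms] corners_subset by blast
qed

text \<open>With one corner the smaller shape is a rectangle, and x prolongs its first row or first
  column. With two corners, x must fill the notch between them. The further corner z excludes the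
  cases where every box lies below x, which are those with a single row, a single column or a notch
  of width 1.\<close>

lemma exceptional_if_equidistant:
  assumes lam: "partition_of n lam" and mu: "partition_of n' \<mu>"
    and x: "x \<in> diagram lam" and D: "diagram \<mu> = diagram lam - {x}"
    and z: "z \<in> corners (diagram lam)" "z \<noteq> x"
    and d: "\<And>y. y \<in> corners (diagram \<mu>) \<Longrightarrow> \<bar>content x - content y\<bar> = d"
  shows "(\<exists>a b. rect_longer_row a b \<mu> lam) \<or> (\<exists>a b. rect_new_row a b \<mu> lam) \<or>
    (\<exists>a b c. two_step_inner a b c \<mu> lam)"
proof -
  note I = young_ideal_diagram[OF lam] and J = young_ideal_diagram[OF mu]
  have lam_D: "diagram lam = insert x (diagram \<mu>)" using D x by auto
  have x_notin: "x \<notin> diagram \<mu>" using D by simp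
  have zD: "z \<in> diagram \<mu>" using z D corners_subset by auto
  have not_less: "\<not> z < x" using z x by (auto simp: corners_def)
  obtain i j where ij: "x = (i, j)" by fastforce
  have below: "(i', j') \<in> diagram \<mu>" if "i' \<le> i" "j' \<le> j" "(i', j') \<noteq> (i, j)" for i' j'
    using young_idealD[OF I x, of "(i', j')"] that ij lam_D by auto
  obtain y1 where y1: "y1 \<in> corners (diagram \<mu>)" using corner_above[OF J zD] by blast
  show ?thesis
  proof (cases "corners (diagram \<mu>) = {y1}")
    case True
    obtain p q where pq: "y1 = (p, q)" by fastforce
    define a b where "a = Suc p" and "b = Suc q"
    have mu_D: "diagram \<mu> = {(i, j). i < a \<and> j < b}"
      using young_ideal_eq_below_corners[OF J] True pq
      by (auto simp: a_def b_def less_eq_prod_def less_Suc_eq_le)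
    have mu_eq: "\<mu> = replicate a b"
      by (rule partition_eq_if_diagram_eq[OF mu partition_of_replicate])
        (auto simp: mu_D diagram_replicate b_def)
    obtain k l where kl: "z = (k, l)" "k < a" "l < b" using zD mu_D by auto
    \<comment> \<open>The neighbours of x to the left and above, and the start of its row, belong to
      the rectangle.\<close>
    have "i = 0 \<and> j = b \<or> i = a \<and> j = 0"
    proof (cases i)
      case 0
      have "j \<ge> b" using x_notin ij mu_D 0 by (simp add: a_def)
      moreover have "j - 1 < b" using below[of 0 "j - 1"] 0 mu_D \<open>j \<ge> b\<close> by (auto simp: b_def)
      ultimately show ?thesis using 0 by (simp add: b_def)
    next
      case (Suc i')
      have i': "i' < a" "j < b" using below[of i' j] Suc mu_D by auto
      then have "i = a" using x_notin ij mu_D Suc by auto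
      moreover have "j = 0"
      proof (rule ccontr)
        assume "j \<noteq> 0"
        then have "(i, 0) \<in> diagram \<mu>" using below[of i 0] by auto
        then show False using \<open>i = a\<close> mu_D by auto
      qed
      ultimately show ?thesis by simp
    qed
    then show ?thesis
    proof
      assume e: "i = 0 \<and> j = b"
      have "a \<ge> 2"
      proof (rule ccontr)
        assume "\<not> a \<ge> 2"
        then have "z < x" using kl ij e by (auto simp: less_prod_def less_eq_prod_def)
        then show False using not_less by simp
      qed
      moreover have "lam = (b + 1) # replicate (a - 1) b"
      proof (rule partition_eq_if_diagram_eq[OF lam partition_of_rect_longer_row])
        show "diagram lam = diagram ((b + 1) # replicate (a - 1) b)"
          using diagram_rect_longer_row[of a b] lam_D mu_D ij e by (simp add: a_def)
      qed (simp_all add: a_def b_def)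
      ultimately have "rect_longer_row a b \<mu> lam"
        using mu_eq by (simp add: rect_longer_row_def b_def)
      then show ?thesis by blast
    next
      assume e: "i = a \<and> j = 0"
      have "b \<ge> 2"
      proof (rule ccontr)
        assume "\<not> b \<ge> 2"
        then have "z < x" using kl ij e by (auto simp: less_prod_def less_eq_prod_def)
        then show False using not_less by simp
      qed
      moreover have "lam = replicate a b @ [1]"
      proof (rule partition_eq_if_diagram_eq[OF lam partition_of_rect_new_row])
        show "diagram lam = diagram (replicate a b @ [1])"
          using diagram_rect_new_row[of a b] lam_D mu_D ij e by simp
      qed (simp add: b_def)
      \<comment> \<open>In \<open>rect_new_row\<close> the first parameter is the row length, hence
        the exchange of a and b.\<close>
      ultimately have "rect_new_row b a \<mu> lam"
        using mu_eq by (simp add: rect_new_row_def a_def)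
      then show ?thesis by blast
    qed
  next
    case False
    then obtain y2 where y2: "y2 \<in> corners (diagram \<mu>)" "y2 \<noteq> y1" using y1 by blast
    have ne: "content u \<noteq> content u'" if "u \<in> corners (diagram \<mu>)" "u' \<in> corners (diagram \<mu>)" "u \<noteq> u'" for u u'
      using corners_content_inj that by blast
    \<comment> \<open>Distinct contents at the same distance d from the content of x lie on opposite
      sides of it.\<close>
    have "\<exists>u w. u \<in> corners (diagram \<mu>) \<and> w \<in> corners (diagram \<mu>) \<and>
        content u = content x + d \<and> content w = content x - d \<and> 0 < d"
      using d[OF y1] d[OF y2(1)] ne[OF y2(1) y1 y2(2)] y1 y2(1) by (smt (verit))
    then obtain u w where u: "u \<in> corners (diagram \<mu>)" "content u = content x + d"
      and w: "w \<in> corners (diagram \<mu>)" "content w = content x - d" and d0: "0 < d" by blast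
    obtain p1 q1 where pq1: "u = (p1, q1)" by fastforce
    obtain p2 q2 where pq2: "w = (p2, q2)" by fastforce
    have K: "corners (diagram \<mu>) = {u, w}"
    proof -
      have "y = u \<or> y = w" if "y \<in> corners (diagram \<mu>)" for y
        using d[OF that] ne[OF that u(1)] ne[OF that w(1)] u(2) w(2) by (smt (verit))
      then show ?thesis using u(1) w(1) by blast
    qed
    have "\<not> u < w" "\<not> w < u" using u(1) w(1) by (auto simp: corners_def)
    moreover have "content w < content u" using u w d0 by simp
    ultimately have pq: "p1 < p2" "q2 < q1"
      using pq1 pq2 by (auto simp: content_def less_prod_def less_eq_prod_def)
    have mem: "(k, l) \<in> diagram \<mu> \<longleftrightarrow> k \<le> p1 \<and> l \<le> q1 \<or> k \<le> p2 \<and> l \<le> q2" for k l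
      using young_ideal_eq_below_corners[OF J] K pq1 pq2 by (auto simp: less_eq_prod_def)
    have nij: "\<not> (i \<le> p1 \<and> j \<le> q1 \<or> i \<le> p2 \<and> j \<le> q2)" using x_notin ij mem by simp
    \<comment> \<open>A box beyond the end of the first row would have larger content than u, and
      one below the first column, as excluded next, smaller content than w.\<close>
    have i0: "i \<noteq> 0"
    proof
      assume "i = 0"
      then have "j > q1" using nij pq by auto
      then show False using \<open>i = 0\<close> u(2) d0 ij pq1 by (auto simp: content_def)
    qed
    have j0: "j \<noteq> 0"
    proof
      assume "j = 0"
      then have "i > p2" using nij pq by auto
      then show False using \<open>j = 0\<close> w(2) d0 ij pq2 by (auto simp: content_def)
    qed
    have "(i - 1, j) \<in> diagram \<mu>" "(i, j - 1) \<in> diagram \<mu>"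
      using i0 j0 by (auto intro!: below)
    then have "i - 1 \<le> p1 \<and> j \<le> q1 \<or> i - 1 \<le> p2 \<and> j \<le> q2"
      "i \<le> p1 \<and> j - 1 \<le> q1 \<or> i \<le> p2 \<and> j - 1 \<le> q2" unfolding mem by auto
    then have xe: "i = Suc p1" "j = Suc q2" using nij pq i0 j0 by arith+
    define a b c where "a = Suc p1" and "b = Suc q2" and "c = p2 - p1"
    \<comment> \<open>Equal distances from x to both corners make the notch square; c is its side
      length.\<close>
    have "q1 - q2 = p2 - p1"
      using u(2) w(2) xe ij pq1 pq2 pq by (auto simp: content_def)
    then have e: "p1 = a - 1" "q2 = b - 1" "p2 = a + c - 1" "q1 = b + c - 1" and abc: "1 \<le> a" "1 \<le> b" "1 \<le> c"
      using pq by (auto simp: a_def b_def c_def)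
    have mu_D: "diagram \<mu> = {(i, j). i < a \<and> j < b + c \<or> i < a + c \<and> j < b}"
      using mem e abc by (auto simp: Suc_le_eq less_Suc_eq_le le_diff_conv2) 
    have mu_eq: "\<mu> = replicate a (b + c) @ replicate c b"
      by (rule partition_eq_if_diagram_eq[OF mu partition_of_two_step[OF abc(2)]])
        (simp only: mu_D diagram_two_step)
    \<comment> \<open>For c = 1 the larger shape is a rectangle with greatest box x, which leaves no
      room for z.\<close>
    have "c \<ge> 2"
    proof (rule ccontr)
      assume "\<not> c \<ge> 2"
      then have "c = 1" using abc by simp
      obtain k l where kl: "z = (k, l)" by fastforce
      have "k \<le> p1 \<and> l \<le> q1 \<or> k \<le> p2 \<and> l \<le> q2" using zD kl mem by simp
      then have "z \<le> x" using kl ij xe e abc \<open>c = 1\<close> by (auto simp: less_eq_prod_def)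
      then show False using not_less z(2) by (simp add: order_less_le)
    qed
    moreover have "lam = replicate a (b + c) @ [b + 1] @ replicate (c - 1) b"
    proof (rule partition_eq_if_diagram_eq[OF lam partition_of_two_step_inner[OF abc(2,3)]])
      have "x = (a, b)" using xe ij by (simp add: a_def b_def)
      then show "diagram lam = diagram (replicate a (b + c) @ [b + 1] @ replicate (c - 1) b)"
        using diagram_two_step_inner[OF abc(3), of a b] lam_D mu_D by simp
    qed
    ultimately have "two_step_inner a b c \<mu> lam"
      using mu_eq abc by (simp add: two_step_inner_def)
    then show ?thesis by blast
  qed
qed

text \<open>If x were the only corner, every tableau would have its largest entry there, and W would
  contain the whole basis.\<close>

lemma (in young_restriction) ex_other_corner:
  assumes "W \<noteq> UNIV"
  obtains z where "z \<in> corners D" "z \<noteq> x"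
proof -
  have "\<exists>z\<in>corners D. z \<noteq> x"
  proof (rule ccontr)
    assume no: "\<not> (\<exists>z\<in>corners D. z \<noteq> x)"
    have "T \<in> top_tabs" if T: "T \<in> std D" for T
    proof -
      obtain y where y: "y \<in> D" "T y = card D" using std_ex_box[OF T card_D] by auto
      then show ?thesis using no std_max_corner[OF T y] T by (auto simp: top_tabs_def)
    qed
    then have "top_tabs = std D" by (auto simp: top_tabs_def)
    then show False using assms W_eq V.span_v by simp
  qed
  then show ?thesis using that by blast
qed

theorem theorem5p3:
  fixes n :: nat and lam \<mu> :: "nat list"
    and v :: "tableau \<Rightarrow> 'v::euclidean_space" and \<pi> :: "(nat \<Rightarrow> nat) \<Rightarrow> 'v \<Rightarrow> 'v"
    and w :: "tableau \<Rightarrow> 'w::euclidean_space" and \<rho> :: "(nat \<Rightarrow> nat) \<Rightarrow> 'w \<Rightarrow> 'w"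
    and W :: "'v set" and t :: "nat \<Rightarrow> nat \<Rightarrow> nat" and Ws :: "nat \<Rightarrow> 'v set"
  assumes lam: "partition_of n lam" and mu: "\<mu> \<in> down lam"
    and V_lam: "young_orthogonal_form n lam v \<pi>"
    and V_mu: "young_orthogonal_form (n - 1) \<mu> w \<rho>"
    and W: "W = isotypic_component (n - 1) \<rho> \<pi>"
    and W_proper: "W \<noteq> UNIV"
    and t: "\<And>k. k \<in> {1..n} \<Longrightarrow> t k permutes {1..n} \<and> t k n = k"
    and Ws: "Ws = (\<lambda>k. \<pi> (t k) ` W)"
  shows
    "(tight_fusion_frame (dim W) {1..n} Ws \<and> equi_chordal (dim W) {1..n} Ws \<and>
      totally_symmetric {1..n} Ws) \<and>
     (equi_isoclinic (dim W) {1..n} Ws \<longleftrightarrow>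
        (\<exists>a b. rect_longer_row a b \<mu> lam) \<or>
        (\<exists>a b. rect_new_row a b \<mu> lam) \<or>
        (\<exists>a b c. two_step_inner a b c \<mu> lam)) \<and>
     (\<forall>a b. rect_longer_row a b \<mu> lam \<or> rect_new_row a b \<mu> lam \<longrightarrow>
        (\<exists>r. tight_fusion_frame r {1..n} Ws \<and> equi_isoclinic r {1..n} Ws \<and>
          totally_symmetric {1..n} Ws \<and>
          real DIM('v) = real a / real (a + b) * real r * real n \<and>
          real r = fact (a * b) * (\<Prod>k<a. fact k / fact (k + b)) \<and>
          real r = fact (a * b) * (\<Prod>k<b. fact k / fact (k + a)) \<and>
          n = a * b + 1)) \<and>
     (\<forall>a b c. two_step_inner a b c \<mu> lam \<longrightarrow>
        (\<exists>r. tight_fusion_frame r {1..n} Ws \<and> equi_isoclinic r {1..n} Ws \<and>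
          totally_symmetric {1..n} Ws \<and>
          real DIM('v) = (real c)\<^sup>2 / (real (a + c) * real (b + c)) * real r * real n \<and>
          real r = fact (a * b + a * c + b * c) *
            (\<Prod>k<c. (fact k)\<^sup>2 / (fact (a + k) * fact (b + k))) *
            (\<Prod>l<a. fact (2 * c + l) / fact (2 * c + b + l)) \<and>
          real r = fact (a * b + a * c + b * c) *
            (\<Prod>k<c. (fact k)\<^sup>2 / (fact (a + k) * fact (b + k))) *
            (\<Prod>l<b. fact (2 * c + l) / fact (2 * c + a + l)) \<and>
          n = a * b + a * c + b * c + 1))"
proof -
  have sum_lam: "sum_list lam = n" using lam by (simp add: partition_of_def)
  then obtain x where mu_part: "partition_of (n - 1) \<mu>" and x: "x \<in> diagram lam"
    and mu_D: "diagram \<mu> = diagram lam - {x}"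
    using mu by (auto simp: down_def)
  have n: "card (diagram lam) = n" using sum_lam by (simp add: card_diagram)
  have repV: "young_rep (diagram lam) v \<pi>"
    by (rule young_rep_of_young_orthogonal_form[OF lam V_lam])
  have repM: "young_rep (diagram lam - {x}) w \<rho>"
    using young_rep_of_young_orthogonal_form[OF mu_part V_mu] mu_D by simp
  interpret F: young_frame "diagram lam" x v \<pi> w \<rho> t
  proof (intro young_frame.intro young_restriction.intro young_restriction_axioms.intro
      young_frame_axioms.intro repV repM)
    show "x \<in> corners (diagram lam)"
      using corner_if_young_ideal_remove[OF _ x] young_ideal_diagram[OF mu_part] mu_D by simp
  qed (use t n in auto)
  have W_F: "W = F.W" unfolding W F.W_def n ..
  have Ws_F: "Ws = F.Ws" unfolding Ws F.Ws_def[abs_def] W_F ..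
  obtain z where z: "z \<in> corners (diagram lam)" "z \<noteq> x"
    using F.ex_other_corner W_proper W_F by blast
  \<comment> \<open>The two corners also give n \<ge> 2, so that the swap of n - 1 and n
    exists.\<close>
  have "card {x, z} \<le> card (diagram lam)"
    using z x corners_subset F.fin_D by (intro card_mono) auto
  then have n2: "2 \<le> card (diagram lam)" using z(2) by auto
  have frame: "tight_fusion_frame (dim W) {1..n} Ws" "equi_chordal (dim W) {1..n} Ws"
    "totally_symmetric {1..n} Ws"
    unfolding W_F Ws_F n[symmetric]
    using F.tight_fusion_frame_Ws F.equi_chordal_Ws[OF n2] F.totally_symmetric_Ws .
  have isoclinic: "equi_isoclinic (dim W) {1..n} Ws \<longleftrightarrow>
      (\<exists>a b. rect_longer_row a b \<mu> lam) \<or> (\<exists>a b. rect_new_row a b \<mu> lam) \<or>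
      (\<exists>a b c. two_step_inner a b c \<mu> lam)"
  proof -
    have "equi_isoclinic (dim W) {1..n} Ws \<longleftrightarrow>
        (\<exists>d. \<forall>y\<in>corners (diagram \<mu>). \<bar>content x - content y\<bar> = d)"
      unfolding W_F Ws_F n[symmetric] mu_D by (rule F.equi_isoclinic_iff_contents[OF n2])
    then show ?thesis
      using exceptional_if_equidistant[OF lam mu_part x mu_D z] equidistant_if_exceptional[OF mu_D] by blast
  qed
  have r: "dim W = card (std (diagram \<mu>))" unfolding W_F F.dim_W mu_D ..
  have d: "DIM('v) = card (std (diagram lam))" by (rule F.V.dim_eq_card_std)
  have rect: "real DIM('v) = real a / real (a + b) * real (dim W) * real n \<and>
      real (dim W) = fact (a * b) * (\<Prod>k<a. fact k / fact (k + b)) \<and>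
      real (dim W) = fact (a * b) * (\<Prod>k<b. fact k / fact (k + a)) \<and> n = a * b + 1"
    if ab: "rect_longer_row a b \<mu> lam \<or> rect_new_row a b \<mu> lam" for a b
  proof -
    have swap: "(\<Prod>k<a. fact k / fact (k + b) :: real) = (\<Prod>k<b. fact k / fact (k + a))"
      using prod_fact_ratio_swap[where a = a and b = b and c = 0] by simp
    from ab show ?thesis
    proof
      assume s: "rect_longer_row a b \<mu> lam"
      then have a: "1 \<le> b" "1 \<le> a" and e: "\<mu> = replicate a b" "lam = (b + 1) # replicate (a - 1) b"
        by (auto simp: rect_longer_row_def)
      have n': "n = a * b + 1"
        using partition_of_rect_longer_row[OF a] sum_lam e by (simp add: partition_of_def)
      show ?thesis
        using card_std_rect[OF a(1), of a] card_std_rect_longer_row[OF a] swap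
        unfolding r d n' e by simp
    next
      assume s: "rect_new_row a b \<mu> lam"
      then have a: "1 \<le> a" and e: "\<mu> = replicate b a" "lam = replicate b a @ [1]"
        by (auto simp: rect_new_row_def)
      have n': "n = a * b + 1"
        using partition_of_rect_new_row[OF a, of b] sum_lam e by (simp add: partition_of_def)
      show ?thesis
        using card_std_rect[OF a, of b] card_std_rect_new_row[OF a, of b] swap
        unfolding r d n' e by (simp add: mult.commute)
    qed
  qed
  have step: "real DIM('v) = (real c)\<^sup>2 / (real (a + c) * real (b + c)) * real (dim W) * real n \<and>
      real (dim W) = fact (a * b + a * c + b * c) *
        (\<Prod>k<c. (fact k)\<^sup>2 / (fact (a + k) * fact (b + k))) *
        (\<Prod>l<a. fact (2 * c + l) / fact (2 * c + b + l)) \<and>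
      real (dim W) = fact (a * b + a * c + b * c) *
        (\<Prod>k<c. (fact k)\<^sup>2 / (fact (a + k) * fact (b + k))) *
        (\<Prod>l<b. fact (2 * c + l) / fact (2 * c + a + l)) \<and>
      n = a * b + a * c + b * c + 1"
    if s: "two_step_inner a b c \<mu> lam" for a b c
  proof -
    have a: "1 \<le> b" "1 \<le> c" and e: "\<mu> = replicate a (b + c) @ replicate c b"
        "lam = replicate a (b + c) @ [b + 1] @ replicate (c - 1) b"
      using s by (auto simp: two_step_inner_def)
    have n': "n = a * b + a * c + b * c + 1"
      using partition_of_two_step_inner[OF a, of a] sum_lam unfolding e(2) partition_of_def by simp
    have "(\<Prod>l<a. fact (2 * c + l) / fact (2 * c + b + l) :: real)
        = (\<Prod>l<b. fact (2 * c + l) / fact (2 * c + a + l))"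
      using prod_fact_ratio_swap[where a = a and b = b and c = "2 * c"] by (simp add: add_ac)
    then show ?thesis
      using card_std_two_step[OF a(1), of a c] card_std_two_step_inner[OF a, of a]
      unfolding r d n' e by simp
  qed
  show ?thesis
  proof (intro conjI)
    show "\<forall>a b. rect_longer_row a b \<mu> lam \<or> rect_new_row a b \<mu> lam \<longrightarrow>
        (\<exists>r. tight_fusion_frame r {1..n} Ws \<and> equi_isoclinic r {1..n} Ws \<and>
          totally_symmetric {1..n} Ws \<and>
          real DIM('v) = real a / real (a + b) * real r * real n \<and>
          real r = fact (a * b) * (\<Prod>k<a. fact k / fact (k + b)) \<and>
          real r = fact (a * b) * (\<Prod>k<b. fact k / fact (k + a)) \<and>
          n = a * b + 1)"
      using rect frame isoclinic by blast
    show "\<forall>a b c. two_step_inner a b c \<mu> lam \<longrightarrow>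
        (\<exists>r. tight_fusion_frame r {1..n} Ws \<and> equi_isoclinic r {1..n} Ws \<and>
          totally_symmetric {1..n} Ws \<and>
          real DIM('v) = (real c)\<^sup>2 / (real (a + c) * real (b + c)) * real r * real n \<and>
          real r = fact (a * b + a * c + b * c) *
            (\<Prod>k<c. (fact k)\<^sup>2 / (fact (a + k) * fact (b + k))) *
            (\<Prod>l<a. fact (2 * c + l) / fact (2 * c + b + l)) \<and>
          real r = fact (a * b + a * c + b * c) *
            (\<Prod>k<c. (fact k)\<^sup>2 / (fact (a + k) * fact (b + k))) *
            (\<Prod>l<b. fact (2 * c + l) / fact (2 * c + a + l)) \<and>
          n = a * b + a * c + b * c + 1)"
      using step frame isoclinic by blast
  qed (use frame isoclinic in auto)
qed

end
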